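(* Let $u_0\in L^\infty(\Omega)$ satisfy $s_*\le\langle u_0\rangle\le s^*$ and assume that $$|\{x\in\Omega: u_0(x)=s\}|=0\quad\text{for all } s\in\mathbb{R}.$$ Then $\omega(u_0)$ contains only one element $\varphi$, and it is a step function that takes at most two values. More precisely, one of the following holds: (a) there exist $a_-,a_+$ with $s_*<a_-<m$, $M<a_+<s^*$, $f(a_-)=f(a_+)$ and disjoint subsets $\Omega_-,\Omega_+\subset\Omega$ with $\Omega_-\cup\Omega_+=\Omega$ such that $\varphi(x)=a_-\chi_{\Omega_-}(x)+a_+\chi_{\Omega_+}(x)$ for a.e. $x\in\Omega$; (b) $\varphi(x)\in\{m,s^*\}$ for a.e. $x\in\Omega$; (c) $\varphi(x)\in\{s_*,M\}$ for a.e. $x\in\Omega$.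
   Context: $\Omega\subset\mathbb{R}^N$ ($N\ge1$) is a (nonempty) bounded open set, $|A|$ is the Lebesgue measure of $A$, $\chi_A$ is the characteristic function of $A$, and $\langle g\rangle:=\frac1{|\Omega|}\int_\Omega g\,dx$. The function $f:\mathbb{R}\to\mathbb{R}$ satisfies the following. $f\in C^1(\mathbb{R})$ and there are $m<M$ with $f'(m)=f'(M)=0$, $f'<0$ on $(-\infty,m)\cup(M,\infty)$, $f'>0$ on $(m,M)$; and there are $s_*<s^*$ with $s_*<m<M<s^*$, $f(s_* )=f(M)$, $f(s^* )=f(m)$. Problem $(P)$: $\frac{du}{dt}=f(u)-\langle f(u)\rangle$ for $t>0$, $u(0)=u_0$, viewed as an ordinary differential equation in $L^\infty(\Omega)$; for $u_0\in L^\infty(\Omega)$ it has a unique global solution $u\in C^1([0,\infty);L^\infty(\Omega))$. The $\omega$-limit set of $u_0$ is $$\omega(u_0):=\{\varphi\in L^1(\Omega):\ \exists\, t_n\to\infty \text{ with } u(t_n)\to\varphi \text{ in } L^1(\Omega)\text{ as }n\to\infty\}.$$ *)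

theory Defs
  imports "HOL-Analysis.Analysis" "HOL-Probability.Essential_Supremum"
begin

text \<open>Elements of \<open>L\<^sup>\<infinity>(\<Omega>)\<close> and \<open>L\<^sup>1(\<Omega>)\<close> are represented by functions on the whole space that
  are measurable on \<open>\<Omega>\<close>; two of them are identified when they agree almost everywhere in \<open>\<Omega>\<close>.
  All notions below are invariant under this identification.\<close>

definition Linf_norm :: "'a::euclidean_space set \<Rightarrow> ('a \<Rightarrow> real) \<Rightarrow> ereal" where
  "Linf_norm \<Omega> g = esssup (lebesgue_on \<Omega>) (\<lambda>x. ereal \<bar>g x\<bar>)"

definition Linf :: "'a::euclidean_space set \<Rightarrow> ('a \<Rightarrow> real) set" where
  "Linf \<Omega> = {g \<in> borel_measurable (lebesgue_on \<Omega>). Linf_norm \<Omega> g < \<infinity>}"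

definition average :: "'a::euclidean_space set \<Rightarrow> ('a \<Rightarrow> real) \<Rightarrow> real" where
  "average \<Omega> g = (1 / measure lebesgue \<Omega>) * (LINT x|lebesgue_on \<Omega>. g x)"

text \<open>\<open>u \<in> C\<^sup>1([0,\<infinity>); L\<^sup>\<infinity>(\<Omega>))\<close> with derivative \<open>v\<close>: limits of difference quotients and continuity of
  the derivative are taken in the \<open>L\<^sup>\<infinity>\<close> norm, and the derivative at time 0 is one-sided. Values at
  negative times play no role.\<close>

definition C1_Linf ::
  "'a::euclidean_space set \<Rightarrow> (real \<Rightarrow> 'a \<Rightarrow> real) \<Rightarrow> (real \<Rightarrow> 'a \<Rightarrow> real) \<Rightarrow> bool" where
  "C1_Linf \<Omega> u v \<longleftrightarrow>
    (\<forall>t\<ge>0. u t \<in> Linf \<Omega> \<and> v t \<in> Linf \<Omega> \<and>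
      ((\<lambda>r. Linf_norm \<Omega> (\<lambda>x. (u r x - u t x) / (r - t) - v t x)) \<longlongrightarrow> 0) (at t within {0..}) \<and>
      ((\<lambda>r. Linf_norm \<Omega> (\<lambda>x. v r x - v t x)) \<longlongrightarrow> 0) (at t within {0..}))"

definition solution_P ::
  "(real \<Rightarrow> real) \<Rightarrow> 'a::euclidean_space set \<Rightarrow> ('a \<Rightarrow> real) \<Rightarrow> (real \<Rightarrow> 'a \<Rightarrow> real) \<Rightarrow> bool" where
  "solution_P f \<Omega> u\<^sub>0 u \<longleftrightarrow>
    (\<exists>v. C1_Linf \<Omega> u v \<and>
      (\<forall>t>0. AE x in lebesgue_on \<Omega>. v t x = f (u t x) - average \<Omega> (\<lambda>y. f (u t y)))) \<and>
    (AE x in lebesgue_on \<Omega>. u 0 x = u\<^sub>0 x)"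

text \<open>The \<open>\<omega>\<close>-limit set of the initial value of the trajectory \<open>u\<close>. As a set of representatives it
  is closed under almost everywhere equality.\<close>

definition omega_limit :: "'a::euclidean_space set \<Rightarrow> (real \<Rightarrow> 'a \<Rightarrow> real) \<Rightarrow> ('a \<Rightarrow> real) set" where
  "omega_limit \<Omega> u = {\<phi>. integrable (lebesgue_on \<Omega>) \<phi> \<and>
    (\<exists>t::nat \<Rightarrow> real. (\<forall>n. t n \<ge> 0) \<and> filterlim t at_top sequentially \<and>
      (\<lambda>n. LINT x|lebesgue_on \<Omega>. \<bar>u (t n) x - \<phi> x\<bar>) \<longlonglongrightarrow> 0)}"

end

theory Submission
  imports Defs
begin

text \<open>
  Up to null sets, every value \<open>u t x\<close> solves the scalar equation \<open>y' = f y - lam t\<close> with the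
  common forcing \<open>lam t = \<langle>f (u t)\<rangle>\<close>. Once \<open>lam\<close> is known to converge, each such solution converges
  to a root of \<open>f = lim lam\<close>, and the middle root attracts at most one initial value, because
  differences of solutions that stay in \<open>[m, M]\<close> grow; the absence of atoms discards it.

  Convergence of \<open>lam\<close>: the lowest solution increases as long as it lies below \<open>s_lo\<close>. Either it stays
  there forever, hence converges and forces \<open>lam\<close> to converge, or it reaches \<open>s_lo\<close>, and from then on
  \<open>lam \<le> f M\<close>. Symmetrically \<open>f m \<le> lam\<close> eventually. Then the regions below \<open>m\<close> and above \<open>M\<close> are
  invariant, almost every solution ends up in one of them, and solutions in the same region approach
  each other. With \<open>p\<close> and \<open>q\<close> the relative measures of the two regions and \<open>w\<close>, \<open>z\<close> one solution in
  each, mass conservation gives \<open>p w + q z \<rightarrow> \<mu>\<close>, so that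
  \<open>w' = q (f w - f ((\<mu> - p w) / q)) + o(1)\<close>. The right-hand side is strictly decreasing in \<open>w\<close>, which
  makes \<open>w\<close>, \<open>z\<close> and \<open>lam\<close> converge.
\<close>

section \<open>Scalar differential inequalities\<close>

text \<open>The obstacle is that \<open>lam\<close> is produced by the whole family of solutions, so
  no single value obeys an autonomous equation whose limit could be read off. Comparison is the way
  out: in the difference of two solutions \<open>lam\<close> cancels, and the monotonicity of
  \<open>f\<close> on the branch containing both decides between contraction and expansion.

  The numbers \<open>s_lo\<close> and \<open>s_hi\<close> enter because for r \<le>
  \<open>s_lo\<close> the value \<open>f r\<close> is the maximum of \<open>f\<close> on [r,
  \<infinity>). A lowest solution situated there has \<open>f\<close> at least as large as the
  average, hence it cannot fall. The band between \<open>f m\<close> and \<open>f M\<close> matters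
  because it turns \<open>m\<close> and \<open>M\<close> into barriers: the velocity
  \<open>f m - lam\<close> is nonpositive at \<open>m\<close>, and \<open>f M - lam\<close> is
  nonnegative at \<open>M\<close>.

  Upper and lower statements are exchanged by the reflection u \<mapsto> -u, which replaces
  \<open>f\<close> by s \<mapsto> -f(-s); only one of each pair is proved by hand.

  A solution in L\<infinity> is a family of classes of functions, whereas the comparison needs
  individual trajectories. The dynamics is therefore studied for an abstract flow that satisfies the
  scalar equation at every point, and such a flow is then extracted from the given solution.\<close>

lemma frequently_at_top_iff:
  fixes P :: "'a::linorder \<Rightarrow> bool"
  shows "frequently P at_top \<longleftrightarrow> (\<forall>r. \<exists>t\<ge>r. P t)"
  by (auto simp: frequently_def eventually_at_top_linorder)

text \<open>Inside the strip \<open>0 \<le> d t \<le> \<delta>\<close> the bound makes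
  \<open>d t * exp (L * t)\<close> nondecreasing, so \<open>d\<close> cannot descend from a positive
  level to 0 in finite time. \<open>L = 0\<close> gives ordinary barriers; a positive
  \<open>L\<close> covers a field that may vanish at the barrier itself.\<close>

lemma positivity_barrier:
  fixes d d' :: "real \<Rightarrow> real"
  assumes cont: "continuous_on {t0..} d"
    and der: "\<And>t. t > t0 \<Longrightarrow> (d has_real_derivative d' t) (at t)"
    and pos: "d t0 > 0" and "\<delta> > 0"
    and bound: "\<And>t. t > t0 \<Longrightarrow> 0 \<le> d t \<Longrightarrow> d t \<le> \<delta> \<Longrightarrow> d' t \<ge> - L * d t"
    and "t \<ge> t0"
  shows "d t > 0"
proof (rule ccontr)
  assume "\<not> d t > 0"
  \<comment> \<open>The first time \<open>\<tau>\<close> with \<open>d \<le> 0\<close> is compared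
    with the last earlier time \<open>\<sigma>\<close> with \<open>d \<ge> e\<close>: between them
    \<open>d\<close> stays in the strip. Taking \<open>e \<le> d t0\<close> guarantees that
    \<open>\<sigma>\<close> exists.\<close>
  define Z where "Z = {t0..t} \<inter> d -` {..0}"
  have "compact Z"
    unfolding Z_def compact_eq_bounded_closed
    by (intro conjI bounded_Int continuous_closed_preimage continuous_on_subset[OF cont]) auto
  moreover have "t \<in> Z" using \<open>\<not> d t > 0\<close> \<open>t \<ge> t0\<close> by (auto simp: Z_def)
  ultimately obtain \<tau> where \<tau>: "\<tau> \<in> Z" "\<And>s. s \<in> Z \<Longrightarrow> \<tau> \<le> s"
    using compact_attains_inf[of Z] by blast
  define e where "e = min \<delta> (d t0)"
  have "e > 0" using pos \<open>\<delta> > 0\<close> by (simp add: e_def)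
  define Y where "Y = {t0..\<tau>} \<inter> d -` {e..}"
  have "compact Y"
    unfolding Y_def compact_eq_bounded_closed
    by (intro conjI bounded_Int continuous_closed_preimage continuous_on_subset[OF cont]) auto
  moreover have "t0 \<in> Y" using \<tau> by (auto simp: Y_def Z_def e_def)
  ultimately obtain \<sigma> where \<sigma>: "\<sigma> \<in> Y" "\<And>s. s \<in> Y \<Longrightarrow> s \<le> \<sigma>"
    using compact_attains_sup[of Y] by blast
  have "\<sigma> \<noteq> \<tau>" using \<sigma> \<tau> \<open>e > 0\<close> by (auto simp: Y_def Z_def)
  then have less: "\<sigma> < \<tau>" using \<sigma> by (auto simp: Y_def)
  have inside: "0 \<le> d s \<and> d s \<le> \<delta>" if "\<sigma> < s" "s < \<tau>" for s
  proof -
    have "s \<notin> Z" "s \<notin> Y" using \<tau>(2)[of s] \<sigma>(2)[of s] that by auto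
    then show ?thesis using that \<sigma>(1) \<tau>(1) by (auto simp: Z_def Y_def e_def)
  qed
  have "d \<sigma> * exp (L * \<sigma>) \<le> d \<tau> * exp (L * \<tau>)"
  proof (rule DERIV_nonneg_imp_increasing_open[of \<sigma> \<tau> "\<lambda>s. d s * exp (L * s)"])
    show "continuous_on {\<sigma>..\<tau>} (\<lambda>s. d s * exp (L * s))"
      using \<sigma> by (intro continuous_intros continuous_on_subset[OF cont]) (auto simp: Y_def)
  next
    fix s assume s: "\<sigma> < s" "s < \<tau>"
    then have "s > t0" using \<sigma> by (auto simp: Y_def)
    have "((\<lambda>s. d s * exp (L * s)) has_real_derivative (d' s + L * d s) * exp (L * s)) (at s)"
      by (auto intro!: derivative_eq_intros der[OF \<open>s > t0\<close>] simp: algebra_simps)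
    moreover have "0 \<le> d' s + L * d s"
      using bound[OF \<open>s > t0\<close>] inside[OF s] by simp
    ultimately show "\<exists>y. ((\<lambda>s. d s * exp (L * s)) has_real_derivative y) (at s) \<and> 0 \<le> y"
      by force
  qed (use less in auto)
  moreover have "d \<sigma> > 0" using \<sigma> \<open>e > 0\<close> by (auto simp: Y_def)
  moreover have "d \<tau> \<le> 0" using \<tau> by (auto simp: Z_def)
  ultimately show False
    by (smt (verit) exp_gt_zero mult_nonpos_nonneg mult_pos_pos)
qed

lemma derivative_bounded_below_imp_unbounded:
  fixes d d' :: "real \<Rightarrow> real"
  assumes der: "\<And>t. t > t0 \<Longrightarrow> (d has_real_derivative d' t) (at t)"
    and "c > 0" and low: "\<And>t. t > t0 \<Longrightarrow> d' t \<ge> c" and up: "\<And>t. t > t0 \<Longrightarrow> d t \<le> B"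
  shows False
proof -
  \<comment> \<open>At speed \<open>c\<close> the time \<open>h\<close> gains
    \<open>B - d (t0 + 1) + c\<close>, which exceeds the remaining room by \<open>c\<close>. The
    start is moved to \<open>t0 + 1\<close> because the assumptions speak of times after
    \<open>t0\<close> only.\<close>
  define h where "h = (B - d (t0 + 1)) / c + 1"
  have "d (t0 + 1) \<le> B" by (rule up) simp
  then have "h > 0" using \<open>c > 0\<close> by (auto simp: h_def intro!: add_nonneg_pos divide_nonneg_pos)
  obtain z where z: "z > t0 + 1" "z < t0 + 1 + h" "d (t0 + 1 + h) - d (t0 + 1) = h * d' z"
    using MVT2[of "t0 + 1" "t0 + 1 + h" d d'] der \<open>h > 0\<close> by (force simp: algebra_simps)
  have "h * c \<le> h * d' z" using \<open>h > 0\<close> low[of z] z by (intro mult_left_mono) auto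
  moreover have "h * c = B - d (t0 + 1) + c" using \<open>c > 0\<close> by (simp add: h_def field_simps)
  moreover have "d (t0 + 1 + h) \<le> B" using \<open>h > 0\<close> by (intro up) simp
  ultimately show False using z \<open>c > 0\<close> by simp
qed

text \<open>Barbalat's lemma: a Lipschitz \<open>g\<close> is nearly constant on a short window, and
  somewhere in the window it equals the increment of the convergent \<open>y\<close> divided by the
  window length.\<close>

lemma Lipschitz_derivative_tendsto_0:
  fixes y g :: "real \<Rightarrow> real"
  assumes der: "\<And>t. t > t0 \<Longrightarrow> (y has_real_derivative g t) (at t)"
    and lip: "\<And>s t. t0 < s \<Longrightarrow> s \<le> t \<Longrightarrow> \<bar>g t - g s\<bar> \<le> K * (t - s)"
    and lim: "(y \<longlongrightarrow> l) at_top"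
  shows "(g \<longlongrightarrow> 0) at_top"
proof (rule tendstoI)
  fix e :: real assume "e > 0"
  \<comment> \<open>On a window of this length \<open>g\<close> varies by at most
    \<open>e / 2\<close>; the summand 1 keeps the denominator positive.\<close>
  define h where "h = e / (2 * (\<bar>K\<bar> + 1))"
  have "h > 0" using \<open>e > 0\<close> by (simp add: h_def)
  have Kh: "\<bar>K\<bar> * h \<le> e / 2"
    using \<open>e > 0\<close> by (simp add: h_def field_simps)
  have "((\<lambda>t. y (t + h) - y t) \<longlongrightarrow> l - l) at_top"
    by (intro tendsto_diff lim filterlim_compose[OF lim] filterlim_tendsto_add_at_top[OF tendsto_const filterlim_ident, of h, simplified add.commute])
  then have "eventually (\<lambda>t. dist (y (t + h) - y t) 0 < h * (e / 2)) at_top"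
    using \<open>h > 0\<close> \<open>e > 0\<close> by (intro tendstoD) auto
  then show "eventually (\<lambda>t. dist (g t) 0 < e) at_top"
    using eventually_gt_at_top[of t0]
  proof eventually_elim
    case (elim t)
    obtain z where z: "z > t" "z < t + h" "y (t + h) - y t = h * g z"
      using MVT2[of t "t + h" y g] der \<open>h > 0\<close> elim by force
    have "\<bar>g z - g t\<bar> \<le> K * (z - t)" using lip[of t z] z elim by auto
    also have "\<dots> \<le> \<bar>K\<bar> * h" using z by (intro mult_mono) auto
    finally have "\<bar>g z - g t\<bar> \<le> e / 2" using Kh by simp
    moreover have "h * \<bar>g z\<bar> < h * (e / 2)" using elim z \<open>h > 0\<close> by (simp add: abs_mult)
    then have "\<bar>g z\<bar> < e / 2" using \<open>h > 0\<close> by simp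
    ultimately show ?case unfolding dist_real_def by linarith
  qed
qed

text \<open>By compactness \<open>h (x + \<delta>) - h x\<close> attains its minimum, which is
  positive. This yields a uniform speed although the slope of the nonlinearity degenerates at
  \<open>m\<close> and \<open>M\<close>.\<close>

lemma strict_increase_gap:
  fixes h :: "real \<Rightarrow> real"
  assumes cont: "continuous_on {a..b} h"
    and inc: "\<And>x y. a \<le> x \<Longrightarrow> x < y \<Longrightarrow> y \<le> b \<Longrightarrow> h x < h y" and "\<delta> > 0"
  shows "\<exists>c>0. \<forall>x y. a \<le> x \<longrightarrow> x + \<delta> \<le> y \<longrightarrow> y \<le> b \<longrightarrow> h x + c \<le> h y"
proof (cases "a + \<delta> \<le> b")
  case True
  have "\<exists>x\<in>{a..b-\<delta>}. \<forall>y\<in>{a..b-\<delta>}. h (x + \<delta>) - h x \<le> h (y + \<delta>) - h y"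
    using True \<open>\<delta> > 0\<close>
    by (intro continuous_attains_inf continuous_intros continuous_on_subset[OF cont]
        continuous_on_compose2[OF cont]) auto
  then obtain x0 where x0: "a \<le> x0" "x0 + \<delta> \<le> b"
    "\<And>y. a \<le> y \<Longrightarrow> y + \<delta> \<le> b \<Longrightarrow> h (x0 + \<delta>) - h x0 \<le> h (y + \<delta>) - h y"
    by (auto simp: algebra_simps)
  have "h x + (h (x0 + \<delta>) - h x0) \<le> h y" if "a \<le> x" "x + \<delta> \<le> y" "y \<le> b" for x y
  proof -
    have "h (x + \<delta>) \<le> h y"
      using inc[of "x + \<delta>" y] that \<open>\<delta> > 0\<close> by (cases "x + \<delta> = y") auto
    then show ?thesis using x0(3)[of x] that by simp
  qed
  moreover have "h (x0 + \<delta>) - h x0 > 0" using inc[of x0 "x0 + \<delta>"] x0 \<open>\<delta> > 0\<close> by simp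
  ultimately show ?thesis by blast
next
  case False
  then have "\<forall>x y. a \<le> x \<longrightarrow> x + \<delta> \<le> y \<longrightarrow> y \<le> b \<longrightarrow> h x + 1 \<le> h y" by auto
  then show ?thesis using zero_less_one by blast
qed

text \<open>If the lower limit were smaller than the upper one, two levels strictly between them
  would both be passed at arbitrarily late times. As extended reals both limits exist; the bound
  makes their common value finite.\<close>

lemma bounded_oscillation_imp_convergent:
  fixes y :: "real \<Rightarrow> real"
  assumes bdd: "eventually (\<lambda>t. \<bar>y t\<bar> \<le> R) at_top"
    and osc: "\<And>a b. a < b \<Longrightarrow> frequently (\<lambda>t. y t \<le> a) at_top \<Longrightarrow> frequently (\<lambda>t. y t \<ge> b) at_top \<Longrightarrow> False"
  shows "\<exists>l. (y \<longlongrightarrow> l) at_top"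
proof -
  let ?Y = "\<lambda>t. ereal (y t)"
  let ?i = "Liminf at_top ?Y" and ?s = "Limsup at_top ?Y"
  have i: "ereal (-R) \<le> ?i" by (rule Liminf_bounded) (use bdd in eventually_elim, auto)
  have s: "?s \<le> ereal R" by (rule Limsup_bounded) (use bdd in eventually_elim, auto)
  have le: "?i \<le> ?s" by (rule Liminf_le_Limsup) simp
  have "?i = ?s"
  proof (rule ccontr)
    assume "?i \<noteq> ?s"
    then have "?i < ?s" using le by simp
    then obtain a where a: "?i < ereal a" "ereal a < ?s" using ereal_dense2 by blast
    then obtain b where b: "ereal a < ereal b" "ereal b < ?s" using ereal_dense2 by blast
    have "frequently (\<lambda>t. y t \<le> a) at_top"
    proof (rule ccontr)
      assume "\<not> frequently (\<lambda>t. y t \<le> a) at_top"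
      then have "eventually (\<lambda>t. ereal a \<le> ?Y t) at_top"
        unfolding not_frequently by (rule eventually_mono) auto
      from Liminf_bounded[OF this] a show False by simp
    qed
    moreover have "frequently (\<lambda>t. y t \<ge> b) at_top"
    proof (rule ccontr)
      assume "\<not> frequently (\<lambda>t. y t \<ge> b) at_top"
      then have "eventually (\<lambda>t. ?Y t \<le> ereal b) at_top"
        unfolding not_frequently by (rule eventually_mono) auto
      from Limsup_bounded[OF this] b show False by simp
    qed
    ultimately show False using osc b by auto
  qed
  moreover obtain l where "?i = ereal l" using i s le by (cases ?i) auto
  ultimately have "(?Y \<longlongrightarrow> ereal l) at_top" by (intro Liminf_eq_Limsup) auto
  then show ?thesis by auto
qed

text \<open>Once \<open>e\<close> is small, the sign of \<open>g c\<close> at a level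
  \<open>c\<close> between \<open>a\<close> and \<open>b\<close> allows crossing in one direction
  only, so \<open>y\<close> cannot visit both sides forever. In \<open>nondeg\<close> the recurrence
  of the two levels is available as a premise, so that \<open>c\<close> has to be found only inside
  a range that \<open>y\<close> keeps visiting.\<close>

lemma asymptotically_autonomous_convergent:
  fixes y g e :: "real \<Rightarrow> real"
  assumes der: "\<And>t. t > t0 \<Longrightarrow> (y has_real_derivative g (y t) + e t) (at t)"
    and e: "(e \<longlongrightarrow> 0) at_top"
    and bdd: "\<And>t. t > t0 \<Longrightarrow> \<bar>y t\<bar> \<le> R"
    and nondeg: "\<And>a b. a < b \<Longrightarrow> frequently (\<lambda>t. y t \<le> a) at_top \<Longrightarrow> frequently (\<lambda>t. y t \<ge> b) at_top
        \<Longrightarrow> \<exists>c. a < c \<and> c < b \<and> g c \<noteq> 0 \<and> isCont g c"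
  shows "\<exists>l. (y \<longlongrightarrow> l) at_top"
proof (rule bounded_oscillation_imp_convergent)
  show "eventually (\<lambda>t. \<bar>y t\<bar> \<le> R) at_top"
    using eventually_gt_at_top[of t0] by eventually_elim (rule bdd)
next
  fix a b :: real
  assume ab: "a < b" and fa: "frequently (\<lambda>t. y t \<le> a) at_top" and fb: "frequently (\<lambda>t. y t \<ge> b) at_top"
  obtain c where c: "a < c" "c < b" "g c \<noteq> 0" "isCont g c" using nondeg[OF ab fa fb] by blast
  \<comment> \<open>With this choice \<open>\<bar>g s\<bar>\<close> stays above
    \<open>\<eta>\<close> near \<open>c\<close>, which dominates the perturbation
    \<open>\<bar>e t\<bar> < \<eta>\<close>.\<close>
  define \<eta> where "\<eta> = \<bar>g c\<bar> / 2"
  have "\<eta> > 0" using c by (simp add: \<eta>_def)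
  obtain \<delta> where \<delta>: "\<delta> > 0" "\<And>s. \<bar>s - c\<bar> < \<delta> \<Longrightarrow> \<bar>g s - g c\<bar> < \<eta>"
    using c(4)[unfolded continuous_at_eps_delta] \<open>\<eta> > 0\<close> by (auto simp: dist_real_def)
  have "eventually (\<lambda>t. \<bar>e t\<bar> < \<eta>) at_top"
    using tendstoD[OF e \<open>\<eta> > 0\<close>] by (simp add: dist_real_def)
  then obtain T1 where T1: "\<And>t. t \<ge> T1 \<Longrightarrow> \<bar>e t\<bar> < \<eta>" by (auto simp: eventually_at_top_linorder)
  define T where "T = max T1 (t0 + 1)"
  have T: "\<bar>e t\<bar> < \<eta>" "t > t0" if "t \<ge> T" for t using T1[of t] that by (auto simp: T_def)
  have cont: "continuous_on {r..} y" if "r \<ge> T" for r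
    by (rule DERIV_continuous_on, rule has_field_derivative_at_within, rule der)
      (use that T(2) in force)
  show False
  proof (cases "g c > 0")
    case True
    have above: "y t - c > 0" if "r \<ge> T" "y r \<ge> b" "t \<ge> r" for r t
    proof (rule positivity_barrier[where d = "\<lambda>t. y t - c" and d' = "\<lambda>t. g (y t) + e t" and \<delta> = "\<delta>/2" and L = 0])
      fix s assume "s > r" "0 \<le> y s - c" "y s - c \<le> \<delta>/2"
      then have "\<bar>g (y s) - g c\<bar> < \<eta>" "\<bar>e s\<bar> < \<eta>" using \<delta> T that by auto
      then have "0 \<le> g (y s) + e s" using True unfolding \<eta>_def by linarith
      then show "- 0 * (y s - c) \<le> g (y s) + e s" by simp
    qed (use that c \<delta> T in \<open>auto intro!: continuous_intros cont derivative_eq_intros der\<close>)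
    obtain r where r: "r \<ge> T" "y r \<ge> b"
      using fb by (auto simp: frequently_at_top_iff)
    obtain t where "t \<ge> r" "y t \<le> a" using fa by (auto simp: frequently_at_top_iff)
    then show False using above[OF r] c by force
  next
    case False
    have below: "c - y t > 0" if "r \<ge> T" "y r \<le> a" "t \<ge> r" for r t
    proof (rule positivity_barrier[where d = "\<lambda>t. c - y t" and d' = "\<lambda>t. - (g (y t) + e t)" and \<delta> = "\<delta>/2" and L = 0])
      fix s assume "s > r" "0 \<le> c - y s" "c - y s \<le> \<delta>/2"
      then have "\<bar>g (y s) - g c\<bar> < \<eta>" "\<bar>e s\<bar> < \<eta>" using \<delta> T that by auto
      then have "g (y s) + e s \<le> 0" using False unfolding \<eta>_def by linarith
      then show "- 0 * (c - y s) \<le> - (g (y s) + e s)" by simp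
    qed (use that c \<delta> T in \<open>auto intro!: continuous_intros cont derivative_eq_intros der\<close>)
    obtain r where r: "r \<ge> T" "y r \<le> a"
      using fa by (auto simp: frequently_at_top_iff)
    obtain t where "t \<ge> r" "y t \<ge> b" using fb by (auto simp: frequently_at_top_iff)
    then show False using below[OF r] c by force
  qed
qed

text \<open>The start may lie exactly on the level \<open>B\<close>, so the strict barrier is
  applied at every lower level \<open>B - e\<close>.\<close>

lemma barrier_ge:
  fixes y y' :: "real \<Rightarrow> real"
  assumes cont: "continuous_on {t0..} y"
    and der: "\<And>t. t > t0 \<Longrightarrow> (y has_real_derivative y' t) (at t)"
    and "y t0 \<ge> B"
    and nonneg: "\<And>t. t > t0 \<Longrightarrow> y t \<le> B \<Longrightarrow> y' t \<ge> 0"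
    and "t \<ge> t0"
  shows "y t \<ge> B"
proof (rule field_le_epsilon)
  fix e :: real assume "e > 0"
  have "y t - (B - e) > 0"
    by (rule positivity_barrier[where d = "\<lambda>t. y t - (B - e)" and d' = y' and \<delta> = e and L = 0])
      (use assms \<open>e > 0\<close> in \<open>auto intro!: continuous_intros derivative_eq_intros der\<close>)
  then show "B \<le> y t + e" by simp
qed

lemma continuous_on_atLeast:
  fixes y :: "real \<Rightarrow> real"
  assumes "\<And>T. continuous_on {a..T} y"
  shows "continuous_on {a..} y"
  unfolding continuous_on_eq_continuous_within
proof
  fix t assume "t \<in> {a..}"
  then have "continuous (at t within {a..t+1}) y"
    using assms[of "t + 1"] by (auto simp: continuous_on_eq_continuous_within)
  moreover have "at t within {a..} = at t within {a..t+1}"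
    by (rule at_within_nhd[of _ "{..<t+1}"]) auto
  ultimately show "continuous (at t within {a..}) y" by simp
qed

section \<open>Trajectories of a bistable nonlinearity\<close>

text \<open>The equation is imposed for positive times, as in \<open>solution_P\<close>, and
  continuity links it to the value at time 0. The forcing is an arbitrary function of time; it
  cancels in differences of trajectories.\<close>

definition trajectory :: "(real \<Rightarrow> real) \<Rightarrow> (real \<Rightarrow> real) \<Rightarrow> (real \<Rightarrow> real) \<Rightarrow> bool" where
  "trajectory f lam y \<longleftrightarrow> continuous_on {0..} y \<and>
    (\<forall>t>0. (y has_real_derivative f (y t) - lam t) (at t))"

lemma trajectoryD:
  assumes "trajectory f lam y"
  shows "a \<ge> 0 \<Longrightarrow> continuous_on {a..} y"
    and "t > 0 \<Longrightarrow> (y has_real_derivative f (y t) - lam t) (at t)"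
  using assms by (auto simp: trajectory_def intro: continuous_on_subset)

text \<open>The squared difference multiplied by \<open>exp (2 * L * t)\<close> is nondecreasing,
  and multiplied by \<open>exp (- 2 * L * t)\<close> nonincreasing; squaring avoids differentiating
  an absolute value. The second estimate runs backward in time and yields uniqueness of the
  past.\<close>

lemma trajectory_gronwall:
  assumes y: "trajectory f lam y" and z: "trajectory f lam z"
    and "0 \<le> a" "a \<le> b"
    and R: "\<And>t. a \<le> t \<Longrightarrow> t \<le> b \<Longrightarrow> \<bar>y t\<bar> \<le> R \<and> \<bar>z t\<bar> \<le> R"
    and L: "\<And>r s. \<bar>r\<bar> \<le> R \<Longrightarrow> \<bar>s\<bar> \<le> R \<Longrightarrow> \<bar>f r - f s\<bar> \<le> L * \<bar>r - s\<bar>"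
  shows "\<bar>y b - z b\<bar> \<le> \<bar>y a - z a\<bar> * exp (L * (b - a))"
    and "\<bar>y a - z a\<bar> \<le> \<bar>y b - z b\<bar> * exp (L * (b - a))"
proof -
  define d where "d t = y t - z t" for t
  have cont: "continuous_on {a..b} d"
    unfolding d_def using \<open>0 \<le> a\<close>
    by (intro continuous_intros continuous_on_subset[OF trajectoryD(1)[OF y, of a]]
        continuous_on_subset[OF trajectoryD(1)[OF z, of a]]) auto
  have sq: "\<bar>d t * (f (y t) - f (z t))\<bar> \<le> L * (d t)\<^sup>2" if "a \<le> t" "t \<le> b" for t
  proof -
    have "\<bar>f (y t) - f (z t)\<bar> \<le> L * \<bar>d t\<bar>" using L R[OF that] by (auto simp: d_def)
    then have "\<bar>d t\<bar> * \<bar>f (y t) - f (z t)\<bar> \<le> \<bar>d t\<bar> * (L * \<bar>d t\<bar>)"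
      by (intro mult_left_mono) auto
    then show ?thesis by (simp add: abs_mult power2_eq_square abs_mult_self_eq mult.left_commute)
  qed
  \<comment> \<open>One formula serves both directions: \<open>k = L\<close> for the backward
    estimate, \<open>k = - L\<close> for the forward one.\<close>
  have der: "((\<lambda>t. (d t)\<^sup>2 * exp (2 * k * t)) has_real_derivative
      2 * exp (2 * k * t) * (d t * (f (y t) - f (z t)) + k * (d t)\<^sup>2)) (at t)" if "t > a" for k t
    unfolding d_def using that \<open>0 \<le> a\<close>
    by (auto intro!: derivative_eq_intros trajectoryD(2)[OF y] trajectoryD(2)[OF z]
        simp: algebra_simps power2_eq_square)
  have exp_sq: "exp (2 * L * (b - a)) = (exp (L * (b - a)))\<^sup>2"
    using exp_double[of "L * (b - a)"] by (simp add: mult.assoc)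
  have "(d a)\<^sup>2 * exp (2 * L * a) \<le> (d b)\<^sup>2 * exp (2 * L * b)"
  proof (rule DERIV_nonneg_imp_increasing_open[of a b "\<lambda>t. (d t)\<^sup>2 * exp (2 * L * t)"])
    fix t assume t: "a < t" "t < b"
    have "0 \<le> d t * (f (y t) - f (z t)) + L * (d t)\<^sup>2" using sq[of t] t by linarith
    then show "\<exists>v. ((\<lambda>t. (d t)\<^sup>2 * exp (2 * L * t)) has_real_derivative v) (at t) \<and> 0 \<le> v"
      using der[of t L] t by (auto intro!: exI[of _ "2 * exp (2 * L * t) * (d t * (f (y t) - f (z t)) + L * (d t)\<^sup>2)"])
  qed (use \<open>a \<le> b\<close> cont in \<open>auto intro!: continuous_intros\<close>)
  then have "(d a)\<^sup>2 * exp (2 * L * a) * exp (- 2 * L * a) \<le> (d b)\<^sup>2 * exp (2 * L * b) * exp (- 2 * L * a)"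
    by (intro mult_right_mono) auto
  then have "(d a)\<^sup>2 \<le> (d b)\<^sup>2 * exp (2 * L * (b - a))"
    by (simp add: mult.assoc flip: exp_add) (simp add: algebra_simps)
  also have "\<dots> = (\<bar>d b\<bar> * exp (L * (b - a)))\<^sup>2"
    by (simp add: power_mult_distrib exp_sq)
  finally have "\<bar>d a\<bar>\<^sup>2 \<le> (\<bar>d b\<bar> * exp (L * (b - a)))\<^sup>2" by simp
  then have "\<bar>d a\<bar> \<le> \<bar>d b\<bar> * exp (L * (b - a))"
    by (rule power2_le_imp_le) simp
  then show "\<bar>y a - z a\<bar> \<le> \<bar>y b - z b\<bar> * exp (L * (b - a))"
    by (simp add: d_def)
  have "(d b)\<^sup>2 * exp (2 * (- L) * b) \<le> (d a)\<^sup>2 * exp (2 * (- L) * a)"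
  proof (rule DERIV_nonpos_imp_decreasing_open[of a b "\<lambda>t. (d t)\<^sup>2 * exp (2 * (- L) * t)"])
    fix t assume t: "a < t" "t < b"
    have "d t * (f (y t) - f (z t)) + (- L) * (d t)\<^sup>2 \<le> 0" using sq[of t] t by simp
    then show "\<exists>v. ((\<lambda>t. (d t)\<^sup>2 * exp (2 * (- L) * t)) has_real_derivative v) (at t) \<and> v \<le> 0"
      using der[of t "- L"] t
      by (intro exI[of _ "2 * exp (2 * (- L) * t) * (d t * (f (y t) - f (z t)) + (- L) * (d t)\<^sup>2)"]
          conjI mult_nonneg_nonpos) auto
  qed (use \<open>a \<le> b\<close> cont in \<open>auto intro!: continuous_intros\<close>)
  then have "(d b)\<^sup>2 * exp (2 * (- L) * b) * exp (2 * L * b) \<le> (d a)\<^sup>2 * exp (2 * (- L) * a) * exp (2 * L * b)"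
    by (intro mult_right_mono) auto
  then have "(d b)\<^sup>2 \<le> (d a)\<^sup>2 * exp (2 * L * (b - a))"
    by (simp add: mult.assoc flip: exp_add) (simp add: algebra_simps)
  also have "\<dots> = (\<bar>d a\<bar> * exp (L * (b - a)))\<^sup>2"
    by (simp add: power_mult_distrib exp_sq)
  finally have "\<bar>d b\<bar>\<^sup>2 \<le> (\<bar>d a\<bar> * exp (L * (b - a)))\<^sup>2" by simp
  then have "\<bar>d b\<bar> \<le> \<bar>d a\<bar> * exp (L * (b - a))"
    by (rule power2_le_imp_le) simp
  then show "\<bar>y b - z b\<bar> \<le> \<bar>y a - z a\<bar> * exp (L * (b - a))"
    by (simp add: d_def)
qed

text \<open>The smoothness of the nonlinearity enters as local Lipschitz continuity and the signs of
  its derivative as strict monotonicity on the closed branches. In this form the class is closed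
  under reflection.\<close>

locale bistable =
  fixes f :: "real \<Rightarrow> real" and m M s_lo s_hi :: real
  assumes lipschitz: "\<And>R. \<exists>L\<ge>0. \<forall>r s. \<bar>r\<bar> \<le> R \<longrightarrow> \<bar>s\<bar> \<le> R \<longrightarrow> \<bar>f r - f s\<bar> \<le> L * \<bar>r - s\<bar>"
    and m_less_M: "m < M" and s_lo_less: "s_lo < m" and s_hi_greater: "M < s_hi"
    and f_s_lo: "f s_lo = f M" and f_s_hi: "f s_hi = f m"
    and dec_lo: "\<And>r s. r < s \<Longrightarrow> s \<le> m \<Longrightarrow> f s < f r"
    and inc_mid: "\<And>r s. m \<le> r \<Longrightarrow> r < s \<Longrightarrow> s \<le> M \<Longrightarrow> f r < f s"
    and dec_hi: "\<And>r s. M \<le> r \<Longrightarrow> r < s \<Longrightarrow> f s < f r"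
begin

text \<open>If y' = f(y) - lam, then -y solves the reflected equation with forcing -lam; the two
  outer branches change places.\<close>

lemma bistable_dual: "bistable (\<lambda>s. - f (- s)) (- M) (- m) (- s_hi) (- s_lo)"
proof
  fix R
  obtain L where "L \<ge> 0" "\<forall>r s. \<bar>r\<bar> \<le> R \<longrightarrow> \<bar>s\<bar> \<le> R \<longrightarrow> \<bar>f r - f s\<bar> \<le> L * \<bar>r - s\<bar>"
    using lipschitz by blast
  then have "\<bar>f (- s) - f (- r)\<bar> \<le> L * \<bar>- s - - r\<bar>" if "\<bar>r\<bar> \<le> R" "\<bar>s\<bar> \<le> R" for r s
    using that by (metis abs_minus_cancel)
  with \<open>L \<ge> 0\<close> show "\<exists>L\<ge>0. \<forall>r s. \<bar>r\<bar> \<le> R \<longrightarrow> \<bar>s\<bar> \<le> R \<longrightarrow> \<bar>- f (- r) - - f (- s)\<bar> \<le> L * \<bar>r - s\<bar>"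
    by (intro exI[of _ L]) auto
qed (use m_less_M s_lo_less s_hi_greater f_s_lo f_s_hi in \<open>auto intro: dec_lo inc_mid dec_hi\<close>)

lemma isCont_f: "isCont f r"
proof -
  obtain L where L: "L \<ge> 0"
    "\<And>a b. \<bar>a\<bar> \<le> \<bar>r\<bar> + 1 \<Longrightarrow> \<bar>b\<bar> \<le> \<bar>r\<bar> + 1 \<Longrightarrow> \<bar>f a - f b\<bar> \<le> L * \<bar>a - b\<bar>"
    using lipschitz by meson
  have "((\<lambda>s. f s - f r) \<longlongrightarrow> 0) (at r)"
  proof (rule Lim_null_comparison)
    show "eventually (\<lambda>s. norm (f s - f r) \<le> L * \<bar>s - r\<bar>) (at r)"
      unfolding eventually_at using L(2)[of _ r] by (intro exI[of _ 1]) (auto simp: dist_real_def)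
    show "((\<lambda>s. L * \<bar>s - r\<bar>) \<longlongrightarrow> 0) (at r)"
      by (auto intro!: tendsto_eq_intros)
  qed
  then show ?thesis by (simp add: isCont_def LIM_zero_iff)
qed

lemma continuous_on_f: "continuous_on S f"
  by (intro continuous_at_imp_continuous_on) (simp add: isCont_f)

lemma f_borel [measurable]: "f \<in> borel_measurable borel"
  by (rule borel_measurable_continuous_onI[OF continuous_on_f])

lemma f_bounded: "\<exists>F. \<forall>r. \<bar>r\<bar> \<le> R \<longrightarrow> \<bar>f r\<bar> \<le> F"
proof -
  obtain L where L: "L \<ge> 0" "\<And>r s. \<bar>r\<bar> \<le> R \<Longrightarrow> \<bar>s\<bar> \<le> R \<Longrightarrow> \<bar>f r - f s\<bar> \<le> L * \<bar>r - s\<bar>"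
    using lipschitz by meson
  have "\<bar>f r\<bar> \<le> \<bar>f 0\<bar> + L * R" if "\<bar>r\<bar> \<le> R" for r
  proof -
    have "\<bar>f r - f 0\<bar> \<le> L * \<bar>r - 0\<bar>" using that by (intro L) auto
    also have "\<dots> \<le> L * R" using L that by (intro mult_left_mono) auto
    finally show ?thesis by linarith
  qed
  then show ?thesis by blast
qed

text \<open>To the right of \<open>m\<close> the function never exceeds \<open>f M = f s_lo\<close>,
  and to the left of \<open>m\<close> it decreases. This is what pushes the lowest solution upwards
  while it is below \<open>s_lo\<close>.\<close>

lemma f_max_left: "r \<le> s_lo \<Longrightarrow> r \<le> s \<Longrightarrow> f s \<le> f r"
proof -
  assume rs: "r \<le> s_lo" "r \<le> s"
  have lo: "f s' \<le> f r" if "r \<le> s'" "s' \<le> m" for s'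
    using dec_lo[of r s'] that by (cases "r = s'") auto
  have "f M \<le> f r" using lo[of s_lo] rs s_lo_less f_s_lo by simp
  moreover have "f s \<le> f M" if "m \<le> s"
    using inc_mid[of s M] dec_hi[of M s] that by (cases s M rule: linorder_cases) auto
  ultimately show ?thesis using lo[of s] rs by (cases "s \<le> m") auto
qed

lemma f_le_fM: "s_lo \<le> s \<Longrightarrow> f s \<le> f M"
  using f_max_left[of s_lo s] f_s_lo by simp

lemma f_min_right: "s_hi \<le> r \<Longrightarrow> s \<le> r \<Longrightarrow> f r \<le> f s"
  using bistable.f_max_left[OF bistable_dual, of "- r" "- s"] by simp

lemma f_ge_fm: "s \<le> s_hi \<Longrightarrow> f m \<le> f s"
  using f_min_right[of s_hi s] f_s_hi by simp

section \<open>Comparison and long-time behaviour of scalar trajectories\<close>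

lemma trajectory_bounded:
  assumes "trajectory f lam y" "0 \<le> T"
  shows "\<exists>R. \<forall>t\<in>{0..T}. \<bar>y t\<bar> \<le> R"
proof -
  have "compact (y ` {0..T})"
    by (intro compact_continuous_image continuous_on_subset[OF trajectoryD(1)[OF assms(1), of 0]]) auto
  then show ?thesis by (auto dest!: compact_imp_bounded simp: bounded_iff)
qed

lemma trajectory_eq_iff:
  assumes y: "trajectory f lam y" and z: "trajectory f lam z"
    and "0 \<le> a" "a \<le> b"
  shows "y a = z a \<longleftrightarrow> y b = z b"
proof -
  obtain R1 R2 where "\<forall>t\<in>{0..b}. \<bar>y t\<bar> \<le> R1" "\<forall>t\<in>{0..b}. \<bar>z t\<bar> \<le> R2"
    using trajectory_bounded[OF y, of b] trajectory_bounded[OF z, of b] assms by auto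
  then have R: "\<bar>y t\<bar> \<le> max R1 R2 \<and> \<bar>z t\<bar> \<le> max R1 R2" if "a \<le> t" "t \<le> b" for t
    using that \<open>0 \<le> a\<close> by (auto simp: le_max_iff_disj)
  obtain L where L: "\<And>r s. \<bar>r\<bar> \<le> max R1 R2 \<Longrightarrow> \<bar>s\<bar> \<le> max R1 R2 \<Longrightarrow> \<bar>f r - f s\<bar> \<le> L * \<bar>r - s\<bar>"
    using lipschitz by meson
  from trajectory_gronwall[OF y z assms(3,4) R L] show ?thesis by auto
qed

lemma trajectory_less:
  assumes y: "trajectory f lam y" and z: "trajectory f lam z"
    and "0 \<le> a" "a \<le> b" "y a < z a"
  shows "y b < z b"
proof (rule ccontr)
  assume "\<not> y b < z b"
  have "\<exists>t\<ge>a. t \<le> b \<and> y t - z t = 0"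
  proof (rule IVT')
    show "continuous_on {a..b} (\<lambda>t. y t - z t)"
      using \<open>0 \<le> a\<close> by (intro continuous_intros continuous_on_subset[OF trajectoryD(1)[OF y, of a]]
        continuous_on_subset[OF trajectoryD(1)[OF z, of a]]) auto
  qed (use assms \<open>\<not> y b < z b\<close> in auto)
  then obtain t where "a \<le> t" "t \<le> b" "y t = z t" by auto
  with trajectory_eq_iff[OF y z \<open>0 \<le> a\<close>] assms show False by simp
qed

text \<open>On the increasing branch the gap between two distinct trajectories never shrinks, so by
  compactness it grows at a speed bounded below and outgrows \<open>M - m\<close>. Uniqueness of the
  past carries the equality from \<open>T\<close> back to time 0.\<close>

lemma trajectory_middle_unique:
  assumes y: "trajectory f lam y" and z: "trajectory f lam z" and "T \<ge> 0"
    and mid: "\<And>t. t \<ge> T \<Longrightarrow> m \<le> y t \<and> y t \<le> M" "\<And>t. t \<ge> T \<Longrightarrow> m \<le> z t \<and> z t \<le> M"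
  shows "y 0 = z 0"
proof -
  have no_gap: False if y: "trajectory f lam y" and z: "trajectory f lam z" and "y T < z T"
    and mid: "\<And>t. t \<ge> T \<Longrightarrow> m \<le> y t \<and> y t \<le> M" "\<And>t. t \<ge> T \<Longrightarrow> m \<le> z t \<and> z t \<le> M" for y z
  proof -
    define d where "d t = z t - y t" for t
    have der: "(d has_real_derivative f (z t) - f (y t)) (at t)" if "t > T" for t
      unfolding d_def using that \<open>T \<ge> 0\<close>
      by (auto intro!: derivative_eq_intros trajectoryD(2)[OF y] trajectoryD(2)[OF z])
    have less: "y t < z t" if "t \<ge> T" for t
      using trajectory_less[OF y z \<open>T \<ge> 0\<close> that \<open>y T < z T\<close>] .
    have expand: "d t \<ge> d T" if "t \<ge> T" for t
    proof (rule barrier_ge[OF _ der order_refl _ that])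
      show "continuous_on {T..} d"
        unfolding d_def using trajectoryD(1)[OF y \<open>T \<ge> 0\<close>] trajectoryD(1)[OF z \<open>T \<ge> 0\<close>]
        by (intro continuous_intros)
      show "f (z t) - f (y t) \<ge> 0" if "t > T" for t
        using inc_mid[of "y t" "z t"] mid[of t] less[of t] that by simp
    qed
    have "d T > 0" using \<open>y T < z T\<close> by (simp add: d_def)
    then obtain c where c: "c > 0" "\<And>r s. m \<le> r \<Longrightarrow> r + d T \<le> s \<Longrightarrow> s \<le> M \<Longrightarrow> f r + c \<le> f s"
      using strict_increase_gap[of m M f "d T"] inc_mid continuous_on_f by blast
    show False
    proof (rule derivative_bounded_below_imp_unbounded[OF der c(1)])
      show "c \<le> f (z t) - f (y t)" if "t > T" for t
        using c(2)[of "y t" "z t"] mid[of t] expand[of t] that by (simp add: d_def)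
      show "d t \<le> M - m" if "t > T" for t using mid[of t] that by (simp add: d_def)
    qed
  qed
  have "y T = z T"
    using no_gap[OF y z _ mid] no_gap[OF z y _ mid(2,1)] by (cases "y T" "z T" rule: linorder_cases) auto
  then show ?thesis using trajectory_eq_iff[OF y z order_refl \<open>T \<ge> 0\<close>] by simp
qed

text \<open>On the decreasing branch the gap is nonincreasing. If it stayed above some
  \<open>e\<close>, it would shrink at a uniform speed and become negative; the bound
  \<open>- R\<close> supplies the compact interval for that speed.\<close>

lemma trajectory_contract:
  assumes y: "trajectory f lam y" and z: "trajectory f lam z" and "T \<ge> 0"
    and lo: "\<And>t. t \<ge> T \<Longrightarrow> - R \<le> y t \<and> y t \<le> m" "\<And>t. t \<ge> T \<Longrightarrow> - R \<le> z t \<and> z t \<le> m"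
  shows "((\<lambda>t. y t - z t) \<longlongrightarrow> 0) at_top"
proof -
  have contract: "((\<lambda>t. z t - y t) \<longlongrightarrow> 0) at_top" if y: "trajectory f lam y" and z: "trajectory f lam z" and "y T < z T"
    and lo: "\<And>t. t \<ge> T \<Longrightarrow> - R \<le> y t \<and> y t \<le> m" "\<And>t. t \<ge> T \<Longrightarrow> - R \<le> z t \<and> z t \<le> m" for y z
  proof (rule tendstoI)
    fix e :: real assume "e > 0"
    define d where "d t = z t - y t" for t
    \<comment> \<open>The gap is negated so that its shrinking becomes growth, the form in which the
      barrier and unboundedness lemmas are stated.\<close>
    have der: "((\<lambda>t. - d t) has_real_derivative f (y t) - f (z t)) (at t)" if "t > T" for t
      unfolding d_def using that \<open>T \<ge> 0\<close>
      by (auto intro!: derivative_eq_intros trajectoryD(2)[OF y] trajectoryD(2)[OF z])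
    have less: "y t < z t" if "t \<ge> T" for t
      using trajectory_less[OF y z \<open>T \<ge> 0\<close> that \<open>y T < z T\<close>] .
    have anti: "- d t \<ge> - d s" if "T \<le> s" "s \<le> t" for s t
    proof (rule barrier_ge[where ?t0.0 = s and y = "\<lambda>t. - d t" and B = "- d s" and y' = "\<lambda>t. f (y t) - f (z t)"])
      have "s \<ge> 0" using that \<open>T \<ge> 0\<close> by simp
      show "continuous_on {s..} (\<lambda>t. - d t)"
        unfolding d_def using trajectoryD(1)[OF y \<open>s \<ge> 0\<close>] trajectoryD(1)[OF z \<open>s \<ge> 0\<close>]
        by (intro continuous_intros)
      show "f (y t) - f (z t) \<ge> 0" if "t > s" for t
        using dec_lo[of "y t" "z t"] lo[of t] less[of t] that \<open>T \<le> s\<close> by simp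
    qed (use that der in auto)
    have "\<exists>s\<ge>T. d s < e"
    proof (rule ccontr)
      assume "\<not> (\<exists>s\<ge>T. d s < e)"
      then have large: "d s \<ge> e" if "s \<ge> T" for s using that by force
      obtain c where c: "c > 0" "\<And>r s. - R \<le> r \<Longrightarrow> r + e \<le> s \<Longrightarrow> s \<le> m \<Longrightarrow> - f r + c \<le> - f s"
        using strict_increase_gap[of "- R" m "\<lambda>s. - f s" e] dec_lo \<open>e > 0\<close> by (force intro!: continuous_intros continuous_on_f)
      show False
      proof (rule derivative_bounded_below_imp_unbounded[OF der c(1)])
        show "c \<le> f (y t) - f (z t)" if "t > T" for t
          using c(2)[of "y t" "z t"] lo[of t] large[of t] that by (simp add: d_def)
        show "- d t \<le> 0" if "t > T" for t using less[of t] that by (simp add: d_def)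
      qed
    qed
    then obtain s where s: "s \<ge> T" "d s < e" by blast
    show "eventually (\<lambda>t. dist (z t - y t) 0 < e) at_top"
      using eventually_ge_at_top[of s]
    proof eventually_elim
      case (elim t)
      then show ?case using anti[OF s(1) elim] less[of t] s by (simp add: d_def dist_real_def)
    qed
  qed
  show ?thesis
  proof (cases "y T" "z T" rule: linorder_cases)
    case less
    from tendsto_minus[OF contract[OF y z this lo]] show ?thesis by simp
  next
    case equal
    have "eventually (\<lambda>t. 0 = y t - z t) at_top"
      using eventually_ge_at_top[of T]
      by eventually_elim (use trajectory_eq_iff[OF y z \<open>T \<ge> 0\<close>] equal in simp)
    then show ?thesis using tendsto_cong tendsto_const by fast
  next
    case greater
    from contract[OF z y this lo(2,1)] show ?thesis .
  qed
qed

text \<open>This is the nondegeneracy of the field \<open>f - l\<close>. Every interval contains a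
  piece of a single monotone branch, and of two points in that piece at most one has the value
  \<open>l\<close>.\<close>

lemma f_not_constant:
  assumes "a < b"
  shows "\<exists>c. a < c \<and> c < b \<and> f c \<noteq> l"
proof -
  have ex: "\<exists>c. a < c \<and> c < b \<and> f c \<noteq> l"
    if le: "a \<le> a'" "a' < b'" "b' \<le> b" and inj: "\<And>r s. a' < r \<Longrightarrow> r < s \<Longrightarrow> s < b' \<Longrightarrow> f r \<noteq> f s" for a' b'
  proof -
    obtain r where r: "a' < r" "r < b'" using dense[OF le(2)] by blast
    obtain s where s: "r < s" "s < b'" using dense[OF r(2)] by blast
    have "f r \<noteq> l \<or> f s \<noteq> l" using inj[OF r(1) s] by auto
    moreover have "a < r" "r < b" "a < s" "s < b" using r s le by auto
    ultimately show ?thesis by blast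
  qed
  consider "a < m" | "m \<le> a" "a < M" | "M \<le> a" by linarith
  then show ?thesis
  proof cases
    case 1
    show ?thesis
    proof (rule ex[of a "min b m"])
      show "f r \<noteq> f s" if "a < r" "r < s" "s < min b m" for r s
        using dec_lo[of r s] that 1 by simp
    qed (use 1 assms in auto)
  next
    case 2
    show ?thesis
    proof (rule ex[of a "min b M"])
      show "f r \<noteq> f s" if "a < r" "r < s" "s < min b M" for r s
        using inc_mid[of r s] that 2 by simp
    qed (use 2 assms in auto)
  next
    case 3
    show ?thesis
    proof (rule ex[of a "b"])
      show "f r \<noteq> f s" if "a < r" "r < s" "s < b" for r s
        using dec_hi[of r s] that 3 by simp
    qed (use 3 assms in auto)
  qed
qed

lemma f_eq_fM: "f r = f M \<Longrightarrow> r \<in> {s_lo, M}"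
proof (rule ccontr)
  assume eq: "f r = f M" and "r \<notin> {s_lo, M}"
  then consider "r < s_lo" | "s_lo < r" "r \<le> m" | "m \<le> r" "r < M" | "M < r" by fastforce
  then show False
    using eq dec_lo[of r s_lo] dec_lo[of s_lo r] inc_mid[of r M] dec_hi[of M r] f_s_lo s_lo_less
    by cases auto
qed

lemma f_eq_fm: "f r = f m \<Longrightarrow> r \<in> {m, s_hi}"
  using bistable.f_eq_fM[OF bistable_dual, of "- r"] by auto

end

section \<open>Flows driven by the average of the nonlinearity\<close>

text \<open>The scalar equation holds at every point of the space, not just almost everywhere, so
  that single points can serve as comparison trajectories and infima over all points are meaningful.
  \<open>\<mu>\<close> is the conserved mean.\<close>

locale nonlocal_flow = bistable f m M s_lo s_hi + finite_measure N
  for f m M s_lo s_hi and N :: "'a measure" +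
  fixes W :: "real \<Rightarrow> 'a \<Rightarrow> real" and lam :: "real \<Rightarrow> real" and \<mu> :: real
  assumes N_pos: "measure N (space N) > 0"
    and W_measurable: "\<And>t. t \<ge> 0 \<Longrightarrow> W t \<in> borel_measurable N"
    and W_locally_bounded: "\<And>T. \<exists>C. \<forall>t\<in>{0..T}. \<forall>x\<in>space N. \<bar>W t x\<bar> \<le> C"
    and W_trajectory: "\<And>x. x \<in> space N \<Longrightarrow> trajectory f lam (\<lambda>t. W t x)"
    and lam_average: "\<And>t. t \<ge> 0 \<Longrightarrow> lam t * measure N (space N) = (LINT x|N. f (W t x))"
    and mass: "\<And>t. t \<ge> 0 \<Longrightarrow> (LINT x|N. W t x) = \<mu> * measure N (space N)"
    and nonatomic: "\<And>s. AE x in N. W 0 x \<noteq> s"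
begin

lemma flow_dual:
  "nonlocal_flow (\<lambda>s. - f (- s)) (- M) (- m) (- s_hi) (- s_lo) N (\<lambda>t x. - W t x) (\<lambda>t. - lam t) (- \<mu>)"
proof (intro nonlocal_flow.intro bistable_dual nonlocal_flow_axioms.intro)
  fix x assume "x \<in> space N"
  from trajectoryD[OF W_trajectory[OF this]]
  show "trajectory (\<lambda>s. - f (- s)) (\<lambda>t. - lam t) (\<lambda>t. - W t x)"
    by (auto simp: trajectory_def intro!: continuous_intros derivative_eq_intros)
next
  fix s show "AE x in N. - W 0 x \<noteq> s"
    using nonatomic[of "- s"] by eventually_elim auto
qed (use N_pos W_measurable W_locally_bounded lam_average mass in
    \<open>auto intro: finite_measure_axioms\<close>)

lemma space_nonempty: "space N \<noteq> {}"
  using N_pos by auto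

text \<open>The infimum of the initial values need not be attained. The trajectory issuing from it
  is obtained as a limit along a minimizing sequence of points, since Gronwall makes values and
  velocities converge uniformly on bounded time intervals.\<close>

lemma lower_trajectory:
  "\<exists>y. trajectory f lam y \<and> (\<forall>t\<ge>0. \<forall>x\<in>space N. y t \<le> W t x)"
proof -
  define i where "i = Inf (W 0 ` space N)"
  obtain C0 where C0: "\<And>x. x \<in> space N \<Longrightarrow> \<bar>W 0 x\<bar> \<le> C0"
    using W_locally_bounded[of 0] by auto
  have bdd: "bdd_below (W 0 ` space N)"
    by (rule bdd_belowI[of _ "- C0"]) (use C0 in force)
  have i_le: "i \<le> W 0 x" if "x \<in> space N" for x
    unfolding i_def using bdd that by (auto intro: cInf_lower)
  have "\<exists>x\<in>space N. W 0 x < i + 1 / (real n + 1)" for n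
    using cInf_lessD[of "W 0 ` space N" "i + 1 / (real n + 1)"] space_nonempty
    by (auto simp: i_def)
  then obtain X where X: "\<And>n. X n \<in> space N" "\<And>n. W 0 (X n) < i + 1 / (real n + 1)"
    by metis
  define y where "y t = lim (\<lambda>n. W t (X n))" for t
  have approx: "\<exists>K C L. K \<ge> 0 \<and> L \<ge> 0 \<and>
      (\<forall>r s. \<bar>r\<bar> \<le> C \<longrightarrow> \<bar>s\<bar> \<le> C \<longrightarrow> \<bar>f r - f s\<bar> \<le> L * \<bar>r - s\<bar>) \<and>
      (\<forall>t x z. 0 \<le> t \<longrightarrow> t \<le> T \<longrightarrow> x \<in> space N \<longrightarrow> z \<in> space N \<longrightarrow>
         \<bar>W t x\<bar> \<le> C \<and> \<bar>W t x - W t z\<bar> \<le> K * \<bar>W 0 x - W 0 z\<bar>)" for T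
  proof -
    obtain C where C: "\<forall>t\<in>{0..T}. \<forall>x\<in>space N. \<bar>W t x\<bar> \<le> C"
      using W_locally_bounded by blast
    obtain L where L: "L \<ge> 0" "\<And>r s. \<bar>r\<bar> \<le> C \<Longrightarrow> \<bar>s\<bar> \<le> C \<Longrightarrow> \<bar>f r - f s\<bar> \<le> L * \<bar>r - s\<bar>"
      using lipschitz by meson
    have "\<bar>W t x - W t z\<bar> \<le> exp (L * T) * \<bar>W 0 x - W 0 z\<bar>"
      if "0 \<le> t" "t \<le> T" "x \<in> space N" "z \<in> space N" for t x z
    proof -
      have "\<bar>W t x - W t z\<bar> \<le> \<bar>W 0 x - W 0 z\<bar> * exp (L * (t - 0))"
        by (rule trajectory_gronwall(1)[OF W_trajectory W_trajectory _ _ _ L(2), of x z 0 t])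
          (use that C in auto)
      also have "\<dots> \<le> \<bar>W 0 x - W 0 z\<bar> * exp (L * T)"
        using that L by (intro mult_left_mono) (auto intro: mult_left_mono)
      finally show ?thesis by (simp add: mult.commute)
    qed
    moreover have "\<bar>W t x\<bar> \<le> C" if "0 \<le> t" "t \<le> T" "x \<in> space N" for t x
      using C that by auto
    moreover have "exp (L * T) \<ge> 0" by simp
    ultimately show ?thesis using L by blast
  qed
  \<comment> \<open>Both initial values lie between \<open>i\<close> and
    \<open>i + 1 / (real n + 1)\<close>.\<close>
  have gap: "\<bar>W 0 (X k) - W 0 (X n)\<bar> \<le> 1 / (real n + 1)" if "n \<le> k" for n k
  proof -
    have "1 / (real k + 1) \<le> 1 / (real n + 1)" using that by (auto simp: field_simps)
    then show ?thesis using X(2)[of n] X(2)[of k] i_le[OF X(1), of n] i_le[OF X(1), of k] by auto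
  qed
  have inv_0: "(\<lambda>n. K * (1 / (real n + 1))) \<longlonglongrightarrow> 0" for K
    using tendsto_mult_right[OF LIMSEQ_inverse_real_of_nat, of K]
    by (simp add: inverse_eq_divide algebra_simps)
  have conv: "(\<lambda>n. W t (X n)) \<longlonglongrightarrow> y t" if t: "t \<ge> 0" for t
  proof -
    obtain K where K: "K \<ge> 0" "\<And>x z. x \<in> space N \<Longrightarrow> z \<in> space N \<Longrightarrow> \<bar>W t x - W t z\<bar> \<le> K * \<bar>W 0 x - W 0 z\<bar>"
      using approx[of t] t by (metis order_refl)
    have "Cauchy (\<lambda>n. W t (X n))"
    proof (rule CauchyI')
      fix e :: real assume "e > 0"
      from order_tendstoD(2)[OF inv_0 this, of K]
      obtain n0 where n0: "\<And>n. n \<ge> n0 \<Longrightarrow> K * (1 / (real n + 1)) < e"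
        by (auto simp: eventually_sequentially)
      have "dist (W t (X n)) (W t (X k)) < e" if "n \<ge> n0" "n < k" for n k
      proof -
        have "\<bar>W t (X k) - W t (X n)\<bar> \<le> K * \<bar>W 0 (X k) - W 0 (X n)\<bar>" using K X by auto
        also have "\<dots> \<le> K * (1 / (real n + 1))"
          by (intro mult_left_mono gap) (use that K in auto)
        finally show ?thesis using n0[OF that(1)] by (simp add: dist_real_def abs_minus_commute)
      qed
      then show "\<exists>M. \<forall>m\<ge>M. \<forall>n>m. dist (W t (X m)) (W t (X n)) < e" by blast
    qed
    then show ?thesis by (simp add: y_def Cauchy_convergent_iff convergent_LIMSEQ_iff)
  qed
  have err: "\<exists>K C L. K \<ge> 0 \<and> L \<ge> 0 \<and>
      (\<forall>r s. \<bar>r\<bar> \<le> C \<longrightarrow> \<bar>s\<bar> \<le> C \<longrightarrow> \<bar>f r - f s\<bar> \<le> L * \<bar>r - s\<bar>) \<and>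
      (\<forall>t n. 0 \<le> t \<longrightarrow> t \<le> T \<longrightarrow> \<bar>W t (X n)\<bar> \<le> C \<and> \<bar>y t\<bar> \<le> C \<and>
        \<bar>W t (X n) - y t\<bar> \<le> K * (1 / (real n + 1)))" for T
  proof -
    obtain K C L where K: "K \<ge> 0" and L: "L \<ge> 0"
      "\<forall>r s. \<bar>r\<bar> \<le> C \<longrightarrow> \<bar>s\<bar> \<le> C \<longrightarrow> \<bar>f r - f s\<bar> \<le> L * \<bar>r - s\<bar>"
      and KC: "\<And>t x z. 0 \<le> t \<Longrightarrow> t \<le> T \<Longrightarrow> x \<in> space N \<Longrightarrow> z \<in> space N \<Longrightarrow>
         \<bar>W t x\<bar> \<le> C \<and> \<bar>W t x - W t z\<bar> \<le> K * \<bar>W 0 x - W 0 z\<bar>"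
      using approx[of T] by blast
    have "\<bar>y t\<bar> \<le> C" if "0 \<le> t" "t \<le> T" for t
      by (rule tendsto_upperbound[OF tendsto_rabs[OF conv]])
        (use KC[OF that X(1) X(1)] that in auto)
    moreover have "\<bar>W t (X n) - y t\<bar> \<le> K * (1 / (real n + 1))" if "0 \<le> t" "t \<le> T" for t n
    proof (rule tendsto_upperbound)
      show "((\<lambda>k. \<bar>W t (X n) - W t (X k)\<bar>) \<longlongrightarrow> \<bar>W t (X n) - y t\<bar>) sequentially"
        by (intro tendsto_intros conv that)
      show "eventually (\<lambda>k. \<bar>W t (X n) - W t (X k)\<bar> \<le> K * (1 / (real n + 1))) sequentially"
        using eventually_ge_at_top[of n]
      proof eventually_elim
        case (elim k)
        have "\<bar>W t (X k) - W t (X n)\<bar> \<le> K * \<bar>W 0 (X k) - W 0 (X n)\<bar>" using KC X that by auto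
        also have "\<dots> \<le> K * (1 / (real n + 1))"
          by (intro mult_left_mono gap) (use elim K in auto)
        finally show ?case by (simp add: abs_minus_commute)
      qed
    qed simp
    moreover have "\<bar>W t (X n)\<bar> \<le> C" if "0 \<le> t" "t \<le> T" for t n
      using KC[OF that X(1) X(1)] by simp
    ultimately have "\<forall>t n. 0 \<le> t \<longrightarrow> t \<le> T \<longrightarrow> \<bar>W t (X n)\<bar> \<le> C \<and> \<bar>y t\<bar> \<le> C \<and>
        \<bar>W t (X n) - y t\<bar> \<le> K * (1 / (real n + 1))"
      by simp
    with K L show ?thesis by (intro exI conjI)
  qed
  have "trajectory f lam y"
    unfolding trajectory_def
  proof (intro conjI allI impI)
    show "continuous_on {0..} y"
    proof (rule continuous_on_atLeast)
      fix T
      obtain K where K: "K \<ge> 0" "\<And>t n. 0 \<le> t \<Longrightarrow> t \<le> T \<Longrightarrow> \<bar>W t (X n) - y t\<bar> \<le> K * (1 / (real n + 1))"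
        using err[of T] by blast
      show "continuous_on {0..T} y"
      proof (rule uniform_limit_theorem[where f = "\<lambda>n t. W t (X n)" and F = sequentially])
        show "uniform_limit {0..T} (\<lambda>n t. W t (X n)) y sequentially"
        proof (rule uniform_limitI)
          fix e :: real assume "e > 0"
          from order_tendstoD(2)[OF inv_0 this, of K]
          show "eventually (\<lambda>n. \<forall>t\<in>{0..T}. dist (W t (X n)) (y t) < e) sequentially"
          proof eventually_elim
            case (elim n)
            show ?case
            proof
              fix t assume "t \<in> {0..T}"
              then show "dist (W t (X n)) (y t) < e" using K(2)[of t n] elim by (simp add: dist_real_def)
            qed
          qed
        qed
        show "eventually (\<lambda>n. continuous_on {0..T} (\<lambda>t. W t (X n))) sequentially"
          using trajectoryD(1)[OF W_trajectory[OF X(1)], of 0]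
          by (intro always_eventually allI continuous_on_subset[where t = "{0..T}" and s = "{0..}"]) auto
      qed simp
    qed
  next
    fix t :: real assume t: "t > 0"
    obtain K C L where K: "K \<ge> 0" and L: "L \<ge> 0"
      "\<And>r s. \<bar>r\<bar> \<le> C \<Longrightarrow> \<bar>s\<bar> \<le> C \<Longrightarrow> \<bar>f r - f s\<bar> \<le> L * \<bar>r - s\<bar>"
      and KC: "\<And>s n. 0 \<le> s \<Longrightarrow> s \<le> t + 1 \<Longrightarrow> \<bar>W s (X n)\<bar> \<le> C \<and> \<bar>y s\<bar> \<le> C \<and>
        \<bar>W s (X n) - y s\<bar> \<le> K * (1 / (real n + 1))"
      using err[of "t + 1"] by blast
    \<comment> \<open>On this bounded interval the Gronwall estimates are uniform, and since it is
      open, a derivative within it is a two-sided derivative at \<open>t\<close>.\<close>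
    let ?S = "{0<..<t+1}"
    have "\<exists>g. \<forall>s\<in>?S. (\<lambda>n. W s (X n)) \<longlonglongrightarrow> g s \<and>
      (g has_derivative (\<lambda>h. (f (y s) - lam s) * h)) (at s within ?S)"
    proof (rule has_derivative_sequence[where f = "\<lambda>n s. W s (X n)" and f' = "\<lambda>n s h. (f (W s (X n)) - lam s) * h" and ?x0.0 = t])
      fix n s assume "s \<in> ?S"
      then show "((\<lambda>s. W s (X n)) has_derivative (\<lambda>h. (f (W s (X n)) - lam s) * h)) (at s within ?S)"
        using trajectoryD(2)[OF W_trajectory[OF X(1)], of s n]
        by (auto simp: has_field_derivative_def intro: has_derivative_at_withinI)
    next
      fix e :: real assume "e > 0"
      from order_tendstoD(2)[OF inv_0 this, of "L * K"]
      show "eventually (\<lambda>n. \<forall>s\<in>?S. \<forall>h. norm ((f (W s (X n)) - lam s) * h - (f (y s) - lam s) * h) \<le> e * norm h) sequentially"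
      proof eventually_elim
        case (elim n)
        show ?case
        proof (intro ballI allI)
          fix s h assume s: "s \<in> ?S"
          have "\<bar>f (W s (X n)) - f (y s)\<bar> \<le> L * \<bar>W s (X n) - y s\<bar>"
            using KC[of s n] s by (intro L) auto
          also have "\<dots> \<le> L * (K * (1 / (real n + 1)))"
            using KC[of s n] s L by (intro mult_left_mono) auto
          finally have "\<bar>f (W s (X n)) - f (y s)\<bar> \<le> e" using elim by (simp add: mult.assoc)
          then have "\<bar>f (W s (X n)) - f (y s)\<bar> * \<bar>h\<bar> \<le> e * \<bar>h\<bar>" by (intro mult_right_mono) auto
          then show "norm ((f (W s (X n)) - lam s) * h - (f (y s) - lam s) * h) \<le> e * norm h"
            by (simp add: abs_mult[symmetric] algebra_simps)
        qed
      qed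
    qed (use t conv[of t] in auto)
    then obtain g where g: "\<And>s. s \<in> ?S \<Longrightarrow> (\<lambda>n. W s (X n)) \<longlonglongrightarrow> g s"
      "\<And>s. s \<in> ?S \<Longrightarrow> (g has_derivative (\<lambda>h. (f (y s) - lam s) * h)) (at s within ?S)" by blast
    have "g s = y s" if "s \<in> ?S" for s
      using LIMSEQ_unique[OF g(1)[OF that] conv] that by simp
    moreover have "(g has_derivative (\<lambda>h. (f (y t) - lam t) * h)) (at t)"
      using g(2)[of t] t by (simp add: at_within_open[of t ?S])
    ultimately have "(y has_derivative (\<lambda>h. (f (y t) - lam t) * h)) (at t)"
      using t by (auto intro: has_derivative_transform_within_open[of g _ t UNIV ?S])
    then show "(y has_real_derivative f (y t) - lam t) (at t)"
      by (simp add: has_field_derivative_def)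
  qed
  moreover have "y t \<le> W t x" if t: "t \<ge> 0" and x: "x \<in> space N" for t x
  proof -
    \<comment> \<open>If \<open>x\<close> starts above the infimum, the sequence eventually starts
      below \<open>x\<close> and the order persists. If \<open>x\<close> attains the infimum, the
      sequence converges to the trajectory of \<open>x\<close> itself.\<close>
    have "eventually (\<lambda>n. W t (X n) \<le> W t x) sequentially \<or> y t = W t x"
    proof (cases "W 0 x = i")
      case False
      then have "W 0 x - i > 0" using i_le[OF x] by simp
      from order_tendstoD(2)[OF inv_0 this, of 1]
      have "eventually (\<lambda>n. W t (X n) \<le> W t x) sequentially"
      proof eventually_elim
        case (elim n)
        then have "W 0 (X n) < W 0 x" using X(2)[of n] by simp
        from trajectory_less[OF W_trajectory W_trajectory _ _ this] X(1) x t
        show ?case by (auto intro: less_imp_le)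
      qed
      then show ?thesis ..
    next
      case True
      obtain K where K: "K \<ge> 0" "\<And>x z. x \<in> space N \<Longrightarrow> z \<in> space N \<Longrightarrow> \<bar>W t x - W t z\<bar> \<le> K * \<bar>W 0 x - W 0 z\<bar>"
        using approx[of t] t by (metis order_refl)
      have "(\<lambda>n. W t (X n) - W t x) \<longlonglongrightarrow> 0"
      proof (rule Lim_null_comparison[OF _ inv_0[of K]])
        show "eventually (\<lambda>n. norm (W t (X n) - W t x) \<le> K * (1 / (real n + 1))) sequentially"
        proof (intro always_eventually allI)
          fix n
          have "\<bar>W t (X n) - W t x\<bar> \<le> K * \<bar>W 0 (X n) - W 0 x\<bar>" using K X x by auto
          also have "\<dots> \<le> K * (1 / (real n + 1))"
            using True X(2)[of n] i_le[OF X(1), of n] K by (intro mult_left_mono) auto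
          finally show "norm (W t (X n) - W t x) \<le> K * (1 / (real n + 1))" by simp
        qed
      qed
      then have "(\<lambda>n. W t (X n)) \<longlonglongrightarrow> W t x" by (simp add: LIM_zero_iff)
      with conv[OF t] show ?thesis using LIMSEQ_unique by blast
    qed
    then show ?thesis using tendsto_upperbound[OF conv[OF t]] by auto
  qed
  ultimately show ?thesis by blast
qed

section \<open>A priori bounds and the forcing\<close>

lemma integrable_bounded:
  fixes g :: "'a \<Rightarrow> real"
  assumes "g \<in> borel_measurable N" "\<And>x. x \<in> space N \<Longrightarrow> \<bar>g x\<bar> \<le> B"
  shows "integrable N g"
  by (rule integrable_const_bound[where B = B]) (use assms in auto)

lemma integrable_W: "t \<ge> 0 \<Longrightarrow> integrable N (W t)"
  and integrable_fW: "t \<ge> 0 \<Longrightarrow> integrable N (\<lambda>x. f (W t x))"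
proof -
  assume t: "t \<ge> 0"
  obtain C where C: "\<And>x. x \<in> space N \<Longrightarrow> \<bar>W t x\<bar> \<le> C" using W_locally_bounded[of t] t by fastforce
  note [measurable] = W_measurable[OF t]
  show "integrable N (W t)" by (rule integrable_bounded[of _ C]) (use C in auto)
  obtain F where "\<And>r. \<bar>r\<bar> \<le> C \<Longrightarrow> \<bar>f r\<bar> \<le> F" using f_bounded by blast
  then show "integrable N (\<lambda>x. f (W t x))" by (intro integrable_bounded[of _ F]) (use C in auto)
qed

lemma lam_le:
  assumes "t \<ge> 0" "\<And>x. x \<in> space N \<Longrightarrow> f (W t x) \<le> B"
  shows "lam t \<le> B"
proof -
  have "lam t * measure N (space N) \<le> (LINT x|N. B)"
    unfolding lam_average[OF assms(1)] by (intro integral_mono integrable_fW assms) auto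
  then show ?thesis using N_pos by (simp add: mult.commute)
qed

text \<open>Below \<open>s_lo\<close> the lowest trajectory carries a value of \<open>f\<close> that
  dominates \<open>f\<close> at all points of the flow, hence their average \<open>lam\<close>. It
  cannot decrease there, which gives a floor for all times.\<close>

lemma W_lower_bound: "\<exists>B. \<forall>t\<ge>0. \<forall>x\<in>space N. B \<le> W t x"
proof -
  obtain y where y: "trajectory f lam y" "\<And>t x. t \<ge> 0 \<Longrightarrow> x \<in> space N \<Longrightarrow> y t \<le> W t x"
    using lower_trajectory by blast
  have "y t \<ge> min s_lo (y 0)" if "t \<ge> 0" for t
  proof (rule barrier_ge[OF trajectoryD(1)[OF y(1), of 0]])
    fix t :: real assume "t > 0" "y t \<le> min s_lo (y 0)"
    then show "f (y t) - lam t \<ge> 0" using y(2)[of t] by (auto intro!: lam_le f_max_left)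
  qed (use that trajectoryD(2)[OF y(1)] in auto)
  then show ?thesis using y(2) by (meson order_trans)
qed

lemma W_bounded: "\<exists>R. \<forall>t\<ge>0. \<forall>x\<in>space N. \<bar>W t x\<bar> \<le> R"
proof -
  obtain B1 where "\<forall>t\<ge>0. \<forall>x\<in>space N. B1 \<le> W t x" using W_lower_bound by blast
  moreover obtain B2 where "\<forall>t\<ge>0. \<forall>x\<in>space N. B2 \<le> - W t x"
    using nonlocal_flow.W_lower_bound[OF flow_dual] by blast
  ultimately have "\<forall>t\<ge>0. \<forall>x\<in>space N. \<bar>W t x\<bar> \<le> max (- B1) (- B2)" by fastforce
  then show ?thesis by blast
qed

definition R where "R = (SOME R. \<forall>t\<ge>0. \<forall>x\<in>space N. \<bar>W t x\<bar> \<le> R)"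

lemma R: "t \<ge> 0 \<Longrightarrow> x \<in> space N \<Longrightarrow> \<bar>W t x\<bar> \<le> R"
  using someI_ex[OF W_bounded] by (auto simp: R_def)

lemma lam_bounded: "\<exists>F. \<forall>t\<ge>0. \<bar>lam t\<bar> \<le> F \<and> (\<forall>x\<in>space N. \<bar>f (W t x)\<bar> \<le> F)"
proof -
  obtain F where F: "\<And>r. \<bar>r\<bar> \<le> R \<Longrightarrow> \<bar>f r\<bar> \<le> F" using f_bounded by blast
  have fF: "\<bar>f (W t x)\<bar> \<le> F" if "t \<ge> 0" "x \<in> space N" for t x using F R that by auto
  have "lam t \<le> F" if "t \<ge> 0" for t
    using fF[OF that] by (intro lam_le that) (simp add: abs_le_iff)
  moreover have "- lam t \<le> F" if "t \<ge> 0" for t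
    using fF[OF that] by (intro nonlocal_flow.lam_le[OF flow_dual] that) (simp add: abs_le_iff)
  ultimately have "\<bar>lam t\<bar> \<le> F" if "t \<ge> 0" for t using that by (simp add: abs_le_iff)
  then show ?thesis using fF by blast
qed

text \<open>Since \<open>f\<close> along the flow and \<open>lam\<close> are bounded by the same
  \<open>F\<close>, all values move with speed at most \<open>2 * F\<close>, and averaging preserves
  the Lipschitz estimate. Barbalat's lemma can then be applied to the velocity of the lowest
  trajectory.\<close>

lemma lam_Lipschitz: "\<exists>K\<ge>0. \<forall>s t. 0 < s \<longrightarrow> s \<le> t \<longrightarrow> \<bar>lam t - lam s\<bar> \<le> K * (t - s)"
proof -
  obtain F where F: "\<And>t. t \<ge> 0 \<Longrightarrow> \<bar>lam t\<bar> \<le> F" "\<And>t x. t \<ge> 0 \<Longrightarrow> x \<in> space N \<Longrightarrow> \<bar>f (W t x)\<bar> \<le> F"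
    using lam_bounded by blast
  have "F \<ge> 0" using F(1)[of 0] by simp
  obtain L where L: "L \<ge> 0" "\<And>r s. \<bar>r\<bar> \<le> R \<Longrightarrow> \<bar>s\<bar> \<le> R \<Longrightarrow> \<bar>f r - f s\<bar> \<le> L * \<bar>r - s\<bar>"
    using lipschitz by meson
  have W_lip: "\<bar>W t x - W s x\<bar> \<le> 2 * F * (t - s)" if "0 < s" "s \<le> t" "x \<in> space N" for s t x
  proof -
    have "norm (W t x - W s x) \<le> 2 * F * norm (t - s)"
    proof (rule field_differentiable_bound[of "{s..t}" "\<lambda>t. W t x" "\<lambda>t. f (W t x) - lam t"])
      fix r assume r: "r \<in> {s..t}"
      then show "((\<lambda>t. W t x) has_field_derivative f (W r x) - lam r) (at r within {s..t})"
        using trajectoryD(2)[OF W_trajectory[OF \<open>x \<in> space N\<close>], of r] that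
        by (auto intro: has_field_derivative_at_within)
      show "norm (f (W r x) - lam r) \<le> 2 * F" using F(1)[of r] F(2)[of r x] r that by auto
    qed (use that in auto)
    then show ?thesis using that by simp
  qed
  have "\<bar>lam t - lam s\<bar> \<le> L * (2 * F) * (t - s)" if st: "0 < s" "s \<le> t" for s t
  proof -
    have "(lam t - lam s) * measure N (space N) = (LINT x|N. f (W t x) - f (W s x))"
      using st by (simp add: left_diff_distrib lam_average integrable_fW)
    also have "\<bar>\<dots>\<bar> \<le> (LINT x|N. \<bar>f (W t x) - f (W s x)\<bar>)"
      by (rule integral_abs_bound)
    also have "\<dots> \<le> (LINT x|N. L * (2 * F) * (t - s))"
    proof (intro integral_mono integrable_abs Bochner_Integration.integrable_diff integrable_fW)
      fix x assume x: "x \<in> space N"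
      have "\<bar>f (W t x) - f (W s x)\<bar> \<le> L * \<bar>W t x - W s x\<bar>" using R st x by (intro L) auto
      also have "\<dots> \<le> L * (2 * F * (t - s))" using L W_lip[OF st x] by (intro mult_left_mono)
      finally show "\<bar>f (W t x) - f (W s x)\<bar> \<le> L * (2 * F) * (t - s)" by (simp add: mult.assoc)
    qed (use st in auto)
    also have "\<dots> = (L * (2 * F) * (t - s)) * measure N (space N)" by simp
    finally have "\<bar>lam t - lam s\<bar> * measure N (space N) \<le> (L * (2 * F) * (t - s)) * measure N (space N)"
      by (simp only: abs_mult abs_of_nonneg[OF measure_nonneg])
    then show ?thesis using N_pos by (rule mult_right_le_imp_le)
  qed
  then show ?thesis using L \<open>F \<ge> 0\<close> by (intro exI[of _ "L * (2 * F)"]) auto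
qed

lemma lam_convergent_or_le: "(\<exists>l. (lam \<longlongrightarrow> l) at_top) \<or> eventually (\<lambda>t. lam t \<le> f M) at_top"
proof -
  obtain y where y: "trajectory f lam y" "\<And>t x. t \<ge> 0 \<Longrightarrow> x \<in> space N \<Longrightarrow> y t \<le> W t x"
    using lower_trajectory by blast
  have y'_nonneg: "f (y t) - lam t \<ge> 0" if "t > 0" "y t \<le> s_lo" for t
    using that y(2)[of t] by (auto intro!: lam_le f_max_left)
  show ?thesis
  proof (cases "\<exists>t0\<ge>0. y t0 \<ge> s_lo")
    case True
    then obtain t0 where t0: "t0 \<ge> 0" "y t0 \<ge> s_lo" by blast
    have "y t \<ge> s_lo" if "t \<ge> t0" for t
      by (rule barrier_ge[OF trajectoryD(1)[OF y(1) t0(1)] trajectoryD(2)[OF y(1)] t0(2)])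
        (use that t0 y'_nonneg in auto)
    then have "lam t \<le> f M" if "t \<ge> t0" for t
      using that t0 y(2)[of t] by (force intro!: lam_le f_le_fM)
    then show ?thesis by (auto simp: eventually_at_top_linorder)
  next
    case False
    then have below: "y t < s_lo" if "t \<ge> 0" for t using that by force
    have mono: "y s \<le> y t" if "0 \<le> s" "s \<le> t" for s t
      by (rule barrier_ge[OF trajectoryD(1)[OF y(1) that(1)] trajectoryD(2)[OF y(1)]])
        (use that y'_nonneg less_imp_le[OF below] in auto)
    have y_bdd: "\<bar>y t\<bar> \<le> \<bar>y 0\<bar> + \<bar>s_lo\<bar>" if "t \<ge> 0" for t
      using mono[of 0 t] below[of t] that by linarith
    have "\<exists>l. (y \<longlongrightarrow> l) at_top"
    proof (rule bounded_oscillation_imp_convergent)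
      show "eventually (\<lambda>t. \<bar>y t\<bar> \<le> \<bar>y 0\<bar> + \<bar>s_lo\<bar>) at_top"
        using eventually_ge_at_top[of 0] by eventually_elim (rule y_bdd)
    next
      fix a b assume ab: "a < b" and fa: "frequently (\<lambda>t. y t \<le> a) at_top"
        and fb: "frequently (\<lambda>t. b \<le> y t) at_top"
      obtain r where r: "r \<ge> 0" "y r \<ge> b" using fb by (auto simp: frequently_at_top_iff)
      obtain t where "t \<ge> r" "y t \<le> a" using fa by (auto simp: frequently_at_top_iff)
      then show False using mono[of r t] r ab by simp
    qed
    then obtain l where l: "(y \<longlongrightarrow> l) at_top" by blast
    obtain K where K: "K \<ge> 0" "\<And>s t. 0 < s \<Longrightarrow> s \<le> t \<Longrightarrow> \<bar>lam t - lam s\<bar> \<le> K * (t - s)"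
      using lam_Lipschitz by meson
    obtain F where F: "\<And>t. t \<ge> 0 \<Longrightarrow> \<bar>lam t\<bar> \<le> F" using lam_bounded by blast
    define R' where "R' = \<bar>y 0\<bar> + \<bar>s_lo\<bar>"
    obtain F' where F': "\<And>r. \<bar>r\<bar> \<le> R' \<Longrightarrow> \<bar>f r\<bar> \<le> F'" using f_bounded by blast
    obtain L where L: "L \<ge> 0" "\<And>r s. \<bar>r\<bar> \<le> R' \<Longrightarrow> \<bar>s\<bar> \<le> R' \<Longrightarrow> \<bar>f r - f s\<bar> \<le> L * \<bar>r - s\<bar>"
      using lipschitz by meson
    \<comment> \<open>The velocity is Lipschitz and the trajectory converges, so the velocity tends
      to 0 and \<open>lam\<close> inherits the limit \<open>f l\<close>.\<close>
    have "((\<lambda>t. f (y t) - lam t) \<longlongrightarrow> 0) at_top"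
    proof (rule Lipschitz_derivative_tendsto_0[OF _ _ l])
      show "(y has_real_derivative f (y t) - lam t) (at t)" if "t > 0" for t
        using trajectoryD(2)[OF y(1) that] .
      fix s t :: real assume st: "0 < s" "s \<le> t"
      have "norm (y t - y s) \<le> (F' + F) * norm (t - s)"
      proof (rule field_differentiable_bound[of "{s..t}" y "\<lambda>t. f (y t) - lam t"])
        fix r assume r: "r \<in> {s..t}"
        then show "(y has_field_derivative f (y r) - lam r) (at r within {s..t})"
          using trajectoryD(2)[OF y(1), of r] st by (auto intro: has_field_derivative_at_within)
        show "norm (f (y r) - lam r) \<le> F' + F"
          using F[of r] F'[of "y r"] y_bdd[of r] r st by (auto simp: R'_def)
      qed (use st in auto)
      then have y_lip: "\<bar>y t - y s\<bar> \<le> (F' + F) * (t - s)" using st by simp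
      have "\<bar>f (y t) - f (y s)\<bar> \<le> L * \<bar>y t - y s\<bar>"
        using y_bdd[of s] y_bdd[of t] st by (intro L) (auto simp: R'_def)
      also have "\<dots> \<le> L * ((F' + F) * (t - s))" using L y_lip by (intro mult_left_mono)
      finally have "\<bar>f (y t) - f (y s)\<bar> \<le> (L * (F' + F)) * (t - s)" by (simp add: mult.assoc)
      then show "\<bar>f (y t) - lam t - (f (y s) - lam s)\<bar> \<le> (L * (F' + F) + K) * (t - s)"
        using K(2)[OF st] unfolding distrib_right[of _ K] by linarith
    qed
    then have "((\<lambda>t. f (y t) - (f (y t) - lam t)) \<longlongrightarrow> f l - 0) at_top"
      by (intro tendsto_diff isCont_tendsto_compose[OF isCont_f l])
    then show ?thesis by auto
  qed
qed

lemma lam_convergent_or_between: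
  "(\<exists>l. (lam \<longlongrightarrow> l) at_top) \<or> eventually (\<lambda>t. f m \<le> lam t \<and> lam t \<le> f M) at_top"
proof -
  have "(\<exists>l. (lam \<longlongrightarrow> l) at_top) \<or> eventually (\<lambda>t. f m \<le> lam t) at_top"
    using nonlocal_flow.lam_convergent_or_le[OF flow_dual] tendsto_minus[of "\<lambda>t. - lam t"]
    by fastforce
  with lam_convergent_or_le show ?thesis by (auto intro: eventually_conj)
qed

text \<open>At \<open>m\<close> the velocity \<open>f m - lam t\<close> may vanish, so a plain
  barrier would lose the strict inequality. The Lipschitz bound of \<open>f\<close> near
  \<open>m\<close> lets the distance to \<open>m\<close> decay at most exponentially.\<close>

lemma stays_below:
  assumes lam: "\<And>t. t \<ge> T \<Longrightarrow> f m \<le> lam t" and "T \<ge> 0" and x: "x \<in> space N"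
    and "s \<ge> T" "W s x < m" "t \<ge> s"
  shows "W t x < m"
proof -
  obtain L where L: "L \<ge> 0"
    "\<And>r s. \<bar>r\<bar> \<le> \<bar>m\<bar> + 1 \<Longrightarrow> \<bar>s\<bar> \<le> \<bar>m\<bar> + 1 \<Longrightarrow> \<bar>f r - f s\<bar> \<le> L * \<bar>r - s\<bar>"
    using lipschitz by meson
  have "s \<ge> 0" using assms by simp
  have "m - W t x > 0"
  proof (rule positivity_barrier[where d = "\<lambda>t. m - W t x" and \<delta> = 1 and L = L])
    show "continuous_on {s..} (\<lambda>t. m - W t x)"
      by (intro continuous_intros trajectoryD(1)[OF W_trajectory[OF x] \<open>s \<ge> 0\<close>])
    fix t assume t: "t > s"
    then show "((\<lambda>t. m - W t x) has_real_derivative - (f (W t x) - lam t)) (at t)"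
      using \<open>s \<ge> 0\<close> by (auto intro!: derivative_eq_intros trajectoryD(2)[OF W_trajectory[OF x]])
    assume d: "0 \<le> m - W t x" "m - W t x \<le> 1"
    then have "\<bar>f (W t x) - f m\<bar> \<le> L * \<bar>W t x - m\<bar>" by (intro L) auto
    then show "- L * (m - W t x) \<le> - (f (W t x) - lam t)"
      using lam[of t] t \<open>s \<ge> T\<close> d by (simp add: abs_le_iff)
  qed (use assms in auto)
  then show ?thesis by simp
qed

lemma stays_above:
  assumes lam: "\<And>t. t \<ge> T \<Longrightarrow> lam t \<le> f M" and "T \<ge> 0" and x: "x \<in> space N"
    and "s \<ge> T" "M < W s x" "t \<ge> s"
  shows "M < W t x"
  using nonlocal_flow.stays_below[OF flow_dual, of T x s t] assms by simp

lemma upper_contract: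
  assumes x: "x \<in> space N" "z \<in> space N" and "T \<ge> 0"
    and hi: "\<And>t. t \<ge> T \<Longrightarrow> M \<le> W t x" "\<And>t. t \<ge> T \<Longrightarrow> M \<le> W t z"
  shows "((\<lambda>t. W t x - W t z) \<longlongrightarrow> 0) at_top"
proof -
  have "- R \<le> - W t x \<and> - W t x \<le> - M" "- R \<le> - W t z \<and> - W t z \<le> - M" if "t \<ge> T" for t
    using R[of t x] R[of t z] hi[OF that] x that \<open>T \<ge> 0\<close> by auto
  from bistable.trajectory_contract[OF bistable_dual nonlocal_flow.W_trajectory[OF flow_dual x(1)]
      nonlocal_flow.W_trajectory[OF flow_dual x(2)] \<open>T \<ge> 0\<close> this]
  show ?thesis using tendsto_minus[of "\<lambda>t. - W t x - - W t z" 0] by simp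
qed

lemma lower_contract:
  assumes x: "x \<in> space N" "z \<in> space N" and "T \<ge> 0"
    and lo: "\<And>t. t \<ge> T \<Longrightarrow> W t x \<le> m" "\<And>t. t \<ge> T \<Longrightarrow> W t z \<le> m"
  shows "((\<lambda>t. W t x - W t z) \<longlongrightarrow> 0) at_top"
proof (rule trajectory_contract[OF W_trajectory[OF x(1)] W_trajectory[OF x(2)] \<open>T \<ge> 0\<close>])
  show "- R \<le> W t x \<and> W t x \<le> m" "- R \<le> W t z \<and> W t z \<le> m" if "t \<ge> T" for t
    using R[of t x] R[of t z] lo[OF that] x that \<open>T \<ge> 0\<close> by auto
qed

text \<open>Dominated convergence along continuous time, replacing \<open>V\<close> on each of two
  sets by one scalar function. It is applied to \<open>W\<close> for the mass and to
  \<open>f\<close> of \<open>W\<close> for the forcing.\<close>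

lemma average_tendsto:
  fixes V :: "real \<Rightarrow> 'a \<Rightarrow> real" and a b :: "real \<Rightarrow> real"
  assumes AB: "A \<in> sets N" "B \<in> sets N" and full: "AE x in N. x \<in> A \<union> B"
    and disjoint: "A \<inter> B = {}"
    and meas: "\<And>t. t \<ge> 0 \<Longrightarrow> V t \<in> borel_measurable N"
    and bdd: "\<And>t x. t \<ge> 0 \<Longrightarrow> x \<in> space N \<Longrightarrow> \<bar>V t x\<bar> \<le> C"
      "\<And>t. t \<ge> 0 \<Longrightarrow> \<bar>a t\<bar> \<le> C" "\<And>t. t \<ge> 0 \<Longrightarrow> \<bar>b t\<bar> \<le> C"
    and lim: "\<And>x. x \<in> A \<Longrightarrow> ((\<lambda>t. V t x - a t) \<longlongrightarrow> 0) at_top"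
      "\<And>x. x \<in> B \<Longrightarrow> ((\<lambda>t. V t x - b t) \<longlongrightarrow> 0) at_top"
  shows "((\<lambda>t. (LINT x|N. V t x) - (measure N A * a t + measure N B * b t)) \<longlongrightarrow> 0) at_top"
proof -
  \<comment> \<open>The hypotheses on \<open>V\<close> concern nonnegative times, while dominated
    convergence asks for measurability at every \<open>t\<close>; the value 0 fills in the negative
    times.\<close>
  define D where "D t x = (if t \<ge> 0 then V t x - (indicator A x * a t + indicator B x * b t) else 0)" for t x
  have [measurable]: "A \<in> sets N" "B \<in> sets N" by fact+
  have "((\<lambda>t. LINT x|N. D t x) \<longlongrightarrow> (LINT x|N. 0)) at_top"
  proof (rule integral_dominated_convergence_at_top[where w = "\<lambda>_. 3 * C"])
    show "D t \<in> borel_measurable N" for t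
      by (cases "t \<ge> 0") (use meas[of t] in \<open>auto simp: D_def[abs_def]\<close>)
    show "AE x in N. ((\<lambda>t. D t x) \<longlongrightarrow> 0) at_top"
      using full
    proof eventually_elim
      case (elim x)
      have "eventually (\<lambda>t. D t x = V t x - (indicator A x * a t + indicator B x * b t)) at_top"
        using eventually_ge_at_top[of 0] by eventually_elim (simp add: D_def)
      moreover have "((\<lambda>t. V t x - (indicator A x * a t + indicator B x * b t)) \<longlongrightarrow> 0) at_top"
        using elim lim[of x] disjoint by (auto simp: indicator_def)
      ultimately show ?case by (simp add: tendsto_cong)
    qed
    show "eventually (\<lambda>t. AE x in N. norm (D t x) \<le> 3 * C) at_top"
      using eventually_ge_at_top[of 0]
    proof eventually_elim
      case (elim t)
      have "norm (D t x) \<le> 3 * C" if "x \<in> space N" for x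
        using bdd(1)[OF elim that] bdd(2)[OF elim] bdd(3)[OF elim] elim
        by (auto simp: D_def indicator_def)
      then show ?case by auto
    qed
  qed auto
  moreover have "eventually (\<lambda>t. (LINT x|N. D t x) =
      (LINT x|N. V t x) - (measure N A * a t + measure N B * b t)) at_top"
    using eventually_ge_at_top[of 0]
  proof eventually_elim
    case (elim t)
    have "integrable N (V t)" by (rule integrable_bounded[OF meas[OF elim] bdd(1)[OF elim]])
    moreover have "integrable N (indicator A :: _ \<Rightarrow> real)" "integrable N (indicator B :: _ \<Rightarrow> real)"
      by (auto simp: integrable_indicator_iff less_top[symmetric])
    ultimately show ?case using elim sets.sets_into_space[OF AB(1)] sets.sets_into_space[OF AB(2)]
      by (simp add: D_def Int_absorb2)
  qed
  ultimately show ?thesis by (simp add: tendsto_cong)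
qed

lemma lam_convergent: "\<exists>l. (lam \<longlongrightarrow> l) at_top"
proof (rule ccontr)
  assume not_conv: "\<not> ?thesis"
  then obtain T' where "\<And>t. t \<ge> T' \<Longrightarrow> f m \<le> lam t \<and> lam t \<le> f M"
    using lam_convergent_or_between by (auto simp: eventually_at_top_linorder)
  then obtain T where T: "T \<ge> 0" "\<And>t. t \<ge> T \<Longrightarrow> f m \<le> lam t" "\<And>t. t \<ge> T \<Longrightarrow> lam t \<le> f M"
    by (metis max.bounded_iff order_refl)
  \<comment> \<open>Integer times suffice because neither region can be left after \<open>T\<close>;
    they make both sets countable unions of measurable sets.\<close>
  define A where "A = {x \<in> space N. \<exists>n. T \<le> real n \<and> W (real n) x < m}"
  define B where "B = {x \<in> space N. \<exists>n. T \<le> real n \<and> M < W (real n) x}"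
  have [measurable]: "W (real n) \<in> borel_measurable N" for n by (rule W_measurable) simp
  have A: "A \<in> sets N" and B: "B \<in> sets N" unfolding A_def B_def by measurable
  have A_below: "\<exists>s\<ge>T. \<forall>t\<ge>s. W t x < m" if "x \<in> A" for x
    using that stays_below[OF T(2,1)] unfolding A_def by blast
  have B_above: "\<exists>s\<ge>T. \<forall>t\<ge>s. M < W t x" if "x \<in> B" for x
    using that stays_above[OF T(3,1)] unfolding B_def by blast
  have disjoint: "A \<inter> B = {}"
  proof (rule ccontr)
    assume "A \<inter> B \<noteq> {}"
    then obtain x s r where "\<forall>t\<ge>s. W t x < m" "\<forall>t\<ge>r. M < W t x" using A_below B_above by blast
    then have "W (max s r) x < m" "M < W (max s r) x" by auto
    then show False using m_less_M by simp
  qed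
  \<comment> \<open>A value outside the middle interval at time \<open>t\<close> would still be
    outside, on the same side, at the next integer time.\<close>
  have mid: "m \<le> W t x \<and> W t x \<le> M" if "x \<in> space N" "x \<notin> A \<union> B" "t \<ge> T" for x t
  proof -
    obtain n :: nat where n: "t \<le> real n" using real_arch_simple by blast
    then have "\<not> W t x < m" using stays_below[OF T(2,1) that(1,3), of "real n"] that by (auto simp: A_def)
    moreover have "\<not> M < W t x" using stays_above[OF T(3,1) that(1,3), of "real n"] n that by (auto simp: B_def)
    ultimately show ?thesis by simp
  qed
  \<comment> \<open>All points outside both regions share one initial value, so the absence of atoms
    makes them negligible.\<close>
  have full: "AE x in N. x \<in> A \<union> B"
  proof (cases "\<exists>x0\<in>space N. x0 \<notin> A \<union> B")
    case True
    then obtain x0 where x0: "x0 \<in> space N" "x0 \<notin> A \<union> B" by blast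
    show ?thesis using nonatomic[of "W 0 x0"] AE_space
    proof eventually_elim
      case (elim x)
      show ?case
      proof (rule ccontr)
        assume "x \<notin> A \<union> B"
        from trajectory_middle_unique[OF W_trajectory[OF elim(2)] W_trajectory[OF x0(1)] T(1)
          mid[OF elim(2) this] mid[OF x0]] elim(1)
        show False by simp
      qed
    qed
  qed auto
  \<comment> \<open>If \<open>A\<close> is empty there is no trajectory to follow; the default 0
    does no harm because its weight \<open>measure N A\<close> is 0.\<close>
  obtain w where w: "\<And>x. x \<in> A \<Longrightarrow> ((\<lambda>t. W t x - w t) \<longlongrightarrow> 0) at_top"
    "\<And>t. t \<ge> 0 \<Longrightarrow> \<bar>w t\<bar> \<le> R" "A \<noteq> {} \<Longrightarrow> \<exists>a\<in>A. w = (\<lambda>t. W t a)"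
  proof (cases "A = {}")
    case True
    show ?thesis by (rule that[of "\<lambda>_. 0"]) (use True R space_nonempty in \<open>force+\<close>)
  next
    case False
    then obtain a where a: "a \<in> A" by blast
    have "((\<lambda>t. W t x - W t a) \<longlongrightarrow> 0) at_top" if x: "x \<in> A" for x
    proof -
      obtain s r where "s \<ge> T" "\<forall>t\<ge>s. W t x < m" "\<forall>t\<ge>r. W t a < m"
        using A_below[OF x] A_below[OF a] by blast
      then show ?thesis using T a x
        by (intro lower_contract[of _ _ "max s r"]) (auto simp: A_def intro: less_imp_le)
    qed
    then show ?thesis using that[of "\<lambda>t. W t a"] a R by (auto simp: A_def)
  qed
  obtain z where z: "\<And>x. x \<in> B \<Longrightarrow> ((\<lambda>t. W t x - z t) \<longlongrightarrow> 0) at_top"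
    "\<And>t. t \<ge> 0 \<Longrightarrow> \<bar>z t\<bar> \<le> R" "B \<noteq> {} \<Longrightarrow> \<exists>b\<in>B. z = (\<lambda>t. W t b)"
  proof (cases "B = {}")
    case True
    show ?thesis by (rule that[of "\<lambda>_. 0"]) (use True R space_nonempty in \<open>force+\<close>)
  next
    case False
    then obtain a where a: "a \<in> B" by blast
    have "((\<lambda>t. W t x - W t a) \<longlongrightarrow> 0) at_top" if x: "x \<in> B" for x
    proof -
      obtain s r where "s \<ge> T" "\<forall>t\<ge>s. M < W t x" "\<forall>t\<ge>r. M < W t a"
        using B_above[OF x] B_above[OF a] by blast
      then show ?thesis using T a x
        by (intro upper_contract[of _ _ "max s r"]) (auto simp: B_def intro: less_imp_le)
    qed
    then show ?thesis using that[of "\<lambda>t. W t a"] a R by (auto simp: B_def)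
  qed
  define p where "p = measure N A / measure N (space N)"
  define q where "q = measure N B / measure N (space N)"
  have "measure N A + measure N B = measure N (A \<union> B)"
    using A B disjoint by (simp add: finite_measure_Union)
  also have "\<dots> = measure N (space N)"
    using full A B by (intro measure_eq_AE) auto
  finally have pq: "p + q = 1" using N_pos by (simp add: p_def q_def field_simps)
  have pq_nonneg: "p \<ge> 0" "q \<ge> 0" using N_pos by (auto simp: p_def q_def)
  have pq_measure: "measure N A = p * measure N (space N)" "measure N B = q * measure N (space N)"
    using N_pos by (auto simp: p_def q_def)
  obtain L where L: "L \<ge> 0" "\<And>r s. \<bar>r\<bar> \<le> R \<Longrightarrow> \<bar>s\<bar> \<le> R \<Longrightarrow> \<bar>f r - f s\<bar> \<le> L * \<bar>r - s\<bar>"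
    using lipschitz by meson
  obtain F where F: "\<And>r. \<bar>r\<bar> \<le> R \<Longrightarrow> \<bar>f r\<bar> \<le> F" using f_bounded by blast
  have f_lim: "((\<lambda>t. f (W t x) - f (y t)) \<longlongrightarrow> 0) at_top"
    if "x \<in> space N" "\<And>t. t \<ge> 0 \<Longrightarrow> \<bar>y t\<bar> \<le> R" "((\<lambda>t. W t x - y t) \<longlongrightarrow> 0) at_top" for x y
  proof (rule Lim_null_comparison)
    show "eventually (\<lambda>t. norm (f (W t x) - f (y t)) \<le> L * \<bar>W t x - y t\<bar>) at_top"
      using eventually_ge_at_top[of 0] by eventually_elim (use R that L in auto)
    show "((\<lambda>t. L * \<bar>W t x - y t\<bar>) \<longlongrightarrow> 0) at_top"
      using tendsto_mult_right_zero[OF tendsto_rabs_zero[OF that(3)]] .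
  qed
  have AN: "x \<in> space N" if "x \<in> A" for x using that by (simp add: A_def)
  have BN: "x \<in> space N" if "x \<in> B" for x using that by (simp add: B_def)
  \<comment> \<open>\<open>e1\<close> and \<open>e2\<close> are the defects in the mass and in the
    forcing when the whole flow is replaced by the two weighted representatives \<open>w\<close> and
    \<open>z\<close>.\<close>
  define e1 where "e1 t = \<mu> - (p * w t + q * z t)" for t
  define e2 where "e2 t = lam t - (p * f (w t) + q * f (z t))" for t
  have "((\<lambda>t. (LINT x|N. W t x) - (measure N A * w t + measure N B * z t)) \<longlongrightarrow> 0) at_top"
    by (rule average_tendsto[OF A B full disjoint W_measurable R w(2) z(2) w(1) z(1)])
  then have "((\<lambda>t. e1 t * measure N (space N)) \<longlongrightarrow> 0) at_top"
  proof (rule Lim_transform_eventually)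
    show "eventually (\<lambda>t. (LINT x|N. W t x) - (measure N A * w t + measure N B * z t)
        = e1 t * measure N (space N)) at_top"
      using eventually_ge_at_top[of 0]
      by eventually_elim (simp add: mass e1_def pq_measure algebra_simps)
  qed
  then have e1: "(e1 \<longlongrightarrow> 0) at_top"
    using tendsto_divide[OF _ tendsto_const[of "measure N (space N)"]] N_pos by fastforce
  have "((\<lambda>t. (LINT x|N. f (W t x)) - (measure N A * f (w t) + measure N B * f (z t))) \<longlongrightarrow> 0) at_top"
    by (rule average_tendsto[OF A B full disjoint, where C = F])
      (use R w z F f_lim AN BN W_measurable in \<open>auto\<close>)
  then have "((\<lambda>t. e2 t * measure N (space N)) \<longlongrightarrow> 0) at_top"
  proof (rule Lim_transform_eventually)
    show "eventually (\<lambda>t. (LINT x|N. f (W t x)) - (measure N A * f (w t) + measure N B * f (z t))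
        = e2 t * measure N (space N)) at_top"
      using eventually_ge_at_top[of 0]
      by eventually_elim (simp add: lam_average[symmetric] e2_def pq_measure algebra_simps)
  qed
  then have e2: "(e2 \<longlongrightarrow> 0) at_top"
    using tendsto_divide[OF _ tendsto_const[of "measure N (space N)"]] N_pos by fastforce
  have lam_limit: "((\<lambda>t. lam t) \<longlongrightarrow> l) at_top" if "((\<lambda>t. p * f (w t) + q * f (z t)) \<longlongrightarrow> l) at_top" for l
    using tendsto_add[OF e2 that] by (simp add: e2_def)
  \<comment> \<open>If one region is null, conservation of mass alone sends the other representative
    to \<open>\<mu>\<close>.\<close>
  consider "p = 0" | "q = 0" | "p > 0" "q > 0" using pq_nonneg by linarith
  then show False
  proof cases
    case 1
    then have "(z \<longlongrightarrow> \<mu> - 0) at_top"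
      using tendsto_diff[OF tendsto_const[of \<mu>] e1] pq by (simp add: e1_def)
    then have "((\<lambda>t. p * f (w t) + q * f (z t)) \<longlongrightarrow> f \<mu>) at_top"
      using 1 pq isCont_tendsto_compose[OF isCont_f] by simp
    then show False using lam_limit not_conv by blast
  next
    case 2
    then have "(w \<longlongrightarrow> \<mu> - 0) at_top"
      using tendsto_diff[OF tendsto_const[of \<mu>] e1] pq by (simp add: e1_def)
    then have "((\<lambda>t. p * f (w t) + q * f (z t)) \<longlongrightarrow> f \<mu>) at_top"
      using 2 pq isCont_tendsto_compose[OF isCont_f] by simp
    then show False using lam_limit not_conv by blast
  next
    case 3
    then have "A \<noteq> {}" "B \<noteq> {}" by (auto simp: p_def q_def)
    then obtain a b where a: "a \<in> A" "w = (\<lambda>t. W t a)" and b: "b \<in> B" "z = (\<lambda>t. W t b)"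
      using w(3) z(3) by blast
    \<comment> \<open>\<open>\<zeta> s\<close> solves \<open>p * s + q * \<zeta> s = \<mu>\<close>:
      it is the upper value that conservation of mass assigns to the lower value \<open>s\<close>.
      Since \<open>1 - p = q\<close>, the velocity of \<open>w\<close> becomes
      \<open>G (w t) + e t\<close>.\<close>
    define \<zeta> where "\<zeta> s = (\<mu> - p * s) / q" for s
    define G where "G s = q * (f s - f (\<zeta> s))" for s
    define e where "e t = q * (f (\<zeta> (w t)) - f (z t)) - e2 t" for t
    have \<zeta>z: "\<zeta> (w t) = z t + e1 t / q" for t using 3 by (simp add: \<zeta>_def e1_def field_simps)
    have e1q: "((\<lambda>t. e1 t / q) \<longlongrightarrow> 0) at_top" using tendsto_divide[OF e1 tendsto_const[of q]] 3 by simp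
    have "((\<lambda>t. f (\<zeta> (w t)) - f (z t)) \<longlongrightarrow> 0) at_top"
    proof -
      obtain L' where L': "L' \<ge> 0" "\<And>r s. \<bar>r\<bar> \<le> R + 1 \<Longrightarrow> \<bar>s\<bar> \<le> R + 1 \<Longrightarrow> \<bar>f r - f s\<bar> \<le> L' * \<bar>r - s\<bar>"
        using lipschitz by meson
      show ?thesis
      proof (rule Lim_null_comparison)
        show "((\<lambda>t. L' * \<bar>e1 t / q\<bar>) \<longlongrightarrow> 0) at_top"
          using tendsto_mult_right_zero[OF tendsto_rabs_zero[OF e1q]] .
        have "eventually (\<lambda>t. \<bar>e1 t / q\<bar> < 1) at_top"
          using tendstoD[OF e1q, of 1] by (simp add: dist_real_def)
        then show "eventually (\<lambda>t. norm (f (\<zeta> (w t)) - f (z t)) \<le> L' * \<bar>e1 t / q\<bar>) at_top"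
          using eventually_ge_at_top[of 0]
        proof eventually_elim
          case (elim t)
          then have "\<bar>f (\<zeta> (w t)) - f (z t)\<bar> \<le> L' * \<bar>\<zeta> (w t) - z t\<bar>"
            using z(2)[of t] unfolding \<zeta>z by (intro L') linarith+
          then show ?case by (simp add: \<zeta>z)
        qed
      qed
    qed
    then have e: "(e \<longlongrightarrow> 0) at_top"
      unfolding e_def using tendsto_diff[OF tendsto_mult_right_zero e2] by fastforce
    have "\<exists>l. (w \<longlongrightarrow> l) at_top"
    proof (rule asymptotically_autonomous_convergent[where g = G and e = e and ?t0.0 = 0, OF _ e])
      fix t :: real assume "t > 0"
      have "f (w t) - lam t = G (w t) + e t"
        using pq by (simp add: G_def e_def e2_def algebra_simps flip: distrib_right)
      then show "(w has_real_derivative G (w t) + e t) (at t)"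
        using trajectoryD(2)[OF W_trajectory[OF AN[OF a(1)]] \<open>t > 0\<close>] a(2) by simp
      show "\<bar>w t\<bar> \<le> R" using w(2) \<open>t > 0\<close> by simp
    next
      \<comment> \<open>A level \<open>s\<close> that \<open>w\<close> keeps reaching satisfies
        \<open>s < m\<close> and \<open>\<zeta> s \<ge> M\<close>. To the left of it both terms of
        \<open>G\<close> are therefore evaluated on decreasing branches of \<open>f\<close>, and
        \<open>G\<close> is strictly decreasing because \<open>\<zeta>\<close> reverses
        order.\<close>
      fix r s assume rs: "r < s" and fs: "frequently (\<lambda>t. s \<le> w t) at_top"
      have wm: "eventually (\<lambda>t. w t < m) at_top"
        using A_below[OF a(1)] a(2) by (auto simp: eventually_at_top_linorder)
      have zM: "eventually (\<lambda>t. M < z t) at_top"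
        using B_above[OF b(1)] b(2) by (auto simp: eventually_at_top_linorder)
      have "s < m" using frequently_ex[OF frequently_eventually_frequently[OF fs wm]] by auto
      have \<zeta>_anti: "\<zeta> t < \<zeta> r" if "r < t" for r t
        using that 3 by (simp add: \<zeta>_def divide_strict_right_mono)
      have "\<zeta> s \<ge> M"
      proof (rule ccontr)
        assume "\<not> M \<le> \<zeta> s"
        \<comment> \<open>At late times with \<open>s \<le> w t\<close>, the value
          \<open>\<zeta> (w t)\<close> is at most \<open>\<zeta> s\<close> and yet within
          \<open>M - \<zeta> s\<close> of \<open>z t\<close>, which is larger than
          \<open>M\<close>.\<close>
        then have "M - \<zeta> s > 0" by simp
        from tendstoD[OF e1q this] have "eventually (\<lambda>t. \<bar>e1 t / q\<bar> < M - \<zeta> s) at_top"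
          by (simp add: dist_real_def)
        from frequently_ex[OF frequently_eventually_frequently[OF fs eventually_conj[OF this zM]]]
        obtain t where t: "s \<le> w t" "\<bar>e1 t / q\<bar> < M - \<zeta> s" "M < z t" by blast
        then have "\<zeta> (w t) \<le> \<zeta> s" using \<zeta>_anti[of s "w t"] by (cases "s = w t") auto
        then show False using t \<zeta>z[of t] by linarith
      qed
      \<comment> \<open>A strictly decreasing \<open>G\<close> cannot vanish at two distinct levels,
        so one of \<open>c1\<close>, \<open>c2\<close> is admissible.\<close>
      obtain c1 where c1: "r < c1" "c1 < s" using dense[OF rs] by blast
      obtain c2 where c2: "c1 < c2" "c2 < s" using dense[OF c1(2)] by blast
      have "f c2 < f c1" using dec_lo[of c1 c2] c1 c2 \<open>s < m\<close> by simp
      moreover have "f (\<zeta> c1) < f (\<zeta> c2)"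
        using dec_hi[of "\<zeta> c2" "\<zeta> c1"] \<zeta>_anti[of c1 c2] \<zeta>_anti[of c2 s] c2 \<open>\<zeta> s \<ge> M\<close> by simp
      ultimately have "G c2 < G c1" using 3 by (simp add: G_def)
      then have "G c1 \<noteq> 0 \<or> G c2 \<noteq> 0" by linarith
      moreover have "isCont G c" for c
        unfolding G_def \<zeta>_def using 3 by (intro continuous_intros isCont_o2[OF _ isCont_f]) auto
      ultimately show "\<exists>c>r. c < s \<and> G c \<noteq> 0 \<and> isCont G c"
        using c1 c2 by (meson order.strict_trans)
    qed
    then obtain l where l: "(w \<longlongrightarrow> l) at_top" by blast
    have "((\<lambda>t. \<zeta> (w t) - e1 t / q) \<longlongrightarrow> \<zeta> l - 0) at_top"
      unfolding \<zeta>_def using 3 by (intro tendsto_intros l e1q) auto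
    then have "(z \<longlongrightarrow> \<zeta> l) at_top" by (simp add: \<zeta>z)
    then have "((\<lambda>t. p * f (w t) + q * f (z t)) \<longlongrightarrow> p * f l + q * f (\<zeta> l)) at_top"
      by (intro tendsto_intros isCont_tendsto_compose[OF isCont_f] l)
    then show False using lam_limit not_conv by blast
  qed
qed

section \<open>Limits of single trajectories and of the whole flow\<close>

lemma trajectory_tendsto_root:
  assumes l: "(lam \<longlongrightarrow> l) at_top" and x: "x \<in> space N"
  shows "\<exists>r. ((\<lambda>t. W t x) \<longlongrightarrow> r) at_top \<and> f r = l"
proof -
  have e: "((\<lambda>t. l - lam t) \<longlongrightarrow> 0) at_top" using tendsto_diff[OF tendsto_const[of l] l] by simp
  note der = trajectoryD(2)[OF W_trajectory[OF x]]
  have "\<exists>r. ((\<lambda>t. W t x) \<longlongrightarrow> r) at_top"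
  proof (rule asymptotically_autonomous_convergent[where g = "\<lambda>s. f s - l" and ?t0.0 = 0, OF _ e])
    show "((\<lambda>t. W t x) has_real_derivative f (W t x) - l + (l - lam t)) (at t)" if "t > 0" for t
      using der[OF that] by simp
    show "\<bar>W t x\<bar> \<le> R" if "t > 0" for t using R x that by simp
    show "\<exists>c>a. c < b \<and> f c - l \<noteq> 0 \<and> isCont (\<lambda>s. f s - l) c" if "a < b" for a b
      using f_not_constant[OF that, of l] isCont_f by (auto intro!: continuous_intros)
  qed
  then obtain r where r: "((\<lambda>t. W t x) \<longlongrightarrow> r) at_top" by blast
  have lim: "((\<lambda>t. f (W t x) - lam t) \<longlongrightarrow> f r - l) at_top"
    by (intro tendsto_diff isCont_tendsto_compose[OF isCont_f r] l)
  \<comment> \<open>Otherwise the velocity would eventually keep one sign and have size at least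
    half of \<open>\<bar>f r - l\<bar>\<close>, against the boundedness of the trajectory.\<close>
  have "f r = l"
  proof (rule ccontr)
    assume "f r \<noteq> l"
    define c where "c = \<bar>f r - l\<bar> / 2"
    have "c > 0" using \<open>f r \<noteq> l\<close> by (simp add: c_def)
    from tendstoD[OF lim this] obtain t0' where "\<And>t. t \<ge> t0' \<Longrightarrow> \<bar>f (W t x) - lam t - (f r - l)\<bar> < c"
      by (auto simp: eventually_at_top_linorder dist_real_def)
    then obtain t0 where t0: "t0 \<ge> 0" "\<And>t. t > t0 \<Longrightarrow> \<bar>f (W t x) - lam t - (f r - l)\<bar> < c"
      by (metis max.cobounded1 max.strict_boundedE less_imp_le)
    have bdd: "\<bar>W t x\<bar> \<le> R" if "t > t0" for t using R x t0 that by simp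
    show False
    proof (cases "f r > l")
      case True
      then have c_eq: "c = (f r - l) / 2" by (simp add: c_def)
      show False
      proof (rule derivative_bounded_below_imp_unbounded[OF _ \<open>c > 0\<close>])
        show "((\<lambda>t. W t x) has_real_derivative f (W t x) - lam t) (at t)" if "t > t0" for t
          using der t0 that by simp
        show "c \<le> f (W t x) - lam t" if "t > t0" for t using t0(2)[OF that] unfolding c_eq abs_less_iff by (simp add: field_simps)
        show "W t x \<le> R" if "t > t0" for t using bdd[OF that] by simp
      qed
    next
      case False
      then have c_eq: "c = (l - f r) / 2" by (simp add: c_def)
      show False
      proof (rule derivative_bounded_below_imp_unbounded[OF _ \<open>c > 0\<close>])
        show "((\<lambda>t. - W t x) has_real_derivative - (f (W t x) - lam t)) (at t)" if "t > t0" for t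
          using t0 that by (intro derivative_intros der) simp
        show "c \<le> - (f (W t x) - lam t)" if "t > t0" for t
          using t0(2)[OF that] unfolding c_eq abs_less_iff by (simp add: field_simps)
        show "- W t x \<le> R" if "t > t0" for t using bdd[OF that] by simp
      qed
    qed
  qed
  then show ?thesis using r by blast
qed

theorem flow_limit:
  assumes \<mu>: "s_lo \<le> \<mu>" "\<mu> \<le> s_hi"
  obtains \<phi> where "integrable N \<phi>" "((\<lambda>t. LINT x|N. \<bar>W t x - \<phi> x\<bar>) \<longlongrightarrow> 0) at_top"
    "(\<exists>a_lo a_hi. s_lo < a_lo \<and> a_lo < m \<and> M < a_hi \<and> a_hi < s_hi \<and> f a_lo = f a_hi \<and>
        (AE x in N. \<phi> x \<in> {a_lo, a_hi})) \<or>
     (AE x in N. \<phi> x \<in> {m, s_hi}) \<or> (AE x in N. \<phi> x \<in> {s_lo, M})"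
proof -
  obtain l where l: "(lam \<longlongrightarrow> l) at_top" using lam_convergent by blast
  define \<phi> where "\<phi> x = Lim at_top (\<lambda>t. W t x)" for x
  have \<phi>: "((\<lambda>t. W t x) \<longlongrightarrow> \<phi> x) at_top" and root: "f (\<phi> x) = l" if x: "x \<in> space N" for x
  proof -
    obtain r where r: "((\<lambda>t. W t x) \<longlongrightarrow> r) at_top" "f r = l" using trajectory_tendsto_root[OF l x] by blast
    then have "\<phi> x = r" unfolding \<phi>_def by (intro tendsto_Lim) auto
    with r show "((\<lambda>t. W t x) \<longlongrightarrow> \<phi> x) at_top" "f (\<phi> x) = l" by auto
  qed
  have [measurable]: "\<phi> \<in> borel_measurable N"
  proof (rule borel_measurable_LIMSEQ_real)
    show "(\<lambda>n. W (real n) x) \<longlonglongrightarrow> \<phi> x" if "x \<in> space N" for x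
      using filterlim_compose[OF \<phi>[OF that] filterlim_real_sequentially] .
    show "W (real n) \<in> borel_measurable N" for n by (rule W_measurable) simp
  qed
  have \<phi>_bdd: "\<bar>\<phi> x\<bar> \<le> R" if "x \<in> space N" for x
  proof (rule tendsto_upperbound[OF tendsto_rabs[OF \<phi>[OF that]]])
    show "eventually (\<lambda>t. \<bar>W t x\<bar> \<le> R) at_top"
      using eventually_ge_at_top[of 0] by eventually_elim (rule R[OF _ that])
  qed simp
  have int: "integrable N \<phi>" by (rule integrable_bounded[of _ R]) (use \<phi>_bdd in auto)
  have R0: "R \<ge> 0" using R[of 0] space_nonempty by fastforce
  define D where "D t x = (if t \<ge> 0 then \<bar>W t x - \<phi> x\<bar> else 0)" for t x
  have "((\<lambda>t. LINT x|N. D t x) \<longlongrightarrow> (LINT x|N. 0)) at_top"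
  proof (rule integral_dominated_convergence_at_top[where w = "\<lambda>_. 2 * R"])
    show "D t \<in> borel_measurable N" for t
      by (cases "t \<ge> 0") (use W_measurable[of t] in \<open>auto simp: D_def[abs_def]\<close>)
    show "AE x in N. ((\<lambda>t. D t x) \<longlongrightarrow> 0) at_top"
    proof (rule AE_I2)
      fix x assume x: "x \<in> space N"
      have "eventually (\<lambda>t. \<bar>W t x - \<phi> x\<bar> = D t x) at_top"
        using eventually_ge_at_top[of 0] by eventually_elim (simp add: D_def)
      moreover have "((\<lambda>t. \<bar>W t x - \<phi> x\<bar>) \<longlongrightarrow> 0) at_top"
        using tendsto_rabs_zero[OF Lim_null[THEN iffD1, OF \<phi>[OF x]]] .
      ultimately show "((\<lambda>t. D t x) \<longlongrightarrow> 0) at_top" by (rule Lim_transform_eventually[rotated])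
    qed
    show "eventually (\<lambda>t. AE x in N. norm (D t x) \<le> 2 * R) at_top"
    proof (rule always_eventually, rule allI, rule AE_I2)
      fix t x assume "x \<in> space N"
      then show "norm (D t x) \<le> 2 * R" using R[of t x] \<phi>_bdd[of x] R0 by (auto simp: D_def)
    qed
  qed auto
  moreover have "eventually (\<lambda>t. (LINT x|N. D t x) = (LINT x|N. \<bar>W t x - \<phi> x\<bar>)) at_top"
    using eventually_ge_at_top[of 0] by eventually_elim (simp add: D_def)
  ultimately have "((\<lambda>t. LINT x|N. \<bar>W t x - \<phi> x\<bar>) \<longlongrightarrow> (LINT x|N. 0)) at_top"
    by (rule Lim_transform_eventually)
  then have L1: "((\<lambda>t. LINT x|N. \<bar>W t x - \<phi> x\<bar>) \<longlongrightarrow> 0) at_top" by simp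
  \<comment> \<open>The function is constant in \<open>t\<close> and dominated by a null function,
    so the constant is 0: the mass passes to the limit.\<close>
  have "((\<lambda>t::real. \<mu> * measure N (space N) - (LINT x|N. \<phi> x)) \<longlongrightarrow> 0) at_top"
  proof (rule Lim_null_comparison[OF _ L1])
    show "eventually (\<lambda>t. norm (\<mu> * measure N (space N) - (LINT x|N. \<phi> x)) \<le> (LINT x|N. \<bar>W t x - \<phi> x\<bar>)) at_top"
      using eventually_ge_at_top[of 0]
    proof eventually_elim
      case (elim t)
      have "\<mu> * measure N (space N) - (LINT x|N. \<phi> x) = (LINT x|N. W t x - \<phi> x)"
        using mass[OF elim] int integrable_W[OF elim] by simp
      then show ?case using integral_abs_bound[of N "\<lambda>x. W t x - \<phi> x"] by simp
    qed
  qed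
  then have int_\<phi>: "(LINT x|N. \<phi> x) = \<mu> * measure N (space N)"
    by (simp add: tendsto_const_iff)
  have eq_constant: "\<mu> = r" if "\<And>x. x \<in> space N \<Longrightarrow> \<phi> x = r" for r
  proof -
    have "(LINT x|N. \<phi> x) = (LINT x|N. r)" using that by (intro Bochner_Integration.integral_cong) auto
    then show ?thesis using int_\<phi> N_pos by simp
  qed
  obtain x0 where x0: "x0 \<in> space N" using space_nonempty by blast
  \<comment> \<open>Here the assumption on the mean acts. A value above \<open>f M\<close> is taken
    only to the left of \<open>s_lo\<close>, where \<open>f\<close> is injective, so
    \<open>\<phi>\<close> would be a constant equal to \<open>\<mu>\<close> and smaller than
    \<open>s_lo\<close>.\<close>
  have "l \<le> f M"
  proof (rule ccontr)
    assume "\<not> l \<le> f M"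
    then have low: "\<phi> x < s_lo" if "x \<in> space N" for x
      using f_le_fM[of "\<phi> x"] root[OF that] by force
    have "\<phi> x = \<phi> x0" if "x \<in> space N" for x
      using dec_lo[of "\<phi> x" "\<phi> x0"] dec_lo[of "\<phi> x0" "\<phi> x"] low[OF that] low[OF x0] root[OF that] root[OF x0] s_lo_less
      by (cases "\<phi> x" "\<phi> x0" rule: linorder_cases) auto
    then show False using eq_constant[of "\<phi> x0"] low[OF x0] \<mu> by simp
  qed
  moreover have "f m \<le> l"
  proof (rule ccontr)
    assume "\<not> f m \<le> l"
    then have high: "\<phi> x > s_hi" if "x \<in> space N" for x
      using f_ge_fm[of "\<phi> x"] root[OF that] by force
    have "\<phi> x = \<phi> x0" if "x \<in> space N" for x
      using dec_hi[of "\<phi> x" "\<phi> x0"] dec_hi[of "\<phi> x0" "\<phi> x"] high[OF that] high[OF x0] root[OF that] root[OF x0] s_hi_greater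
      by (cases "\<phi> x" "\<phi> x0" rule: linorder_cases) auto
    then show False using eq_constant[of "\<phi> x0"] high[OF x0] \<mu> by simp
  qed
  ultimately consider "l = f M" | "l = f m" | "f m < l" "l < f M" by linarith
  then have "(\<exists>a_lo a_hi. s_lo < a_lo \<and> a_lo < m \<and> M < a_hi \<and> a_hi < s_hi \<and> f a_lo = f a_hi \<and>
        (AE x in N. \<phi> x \<in> {a_lo, a_hi})) \<or>
     (AE x in N. \<phi> x \<in> {m, s_hi}) \<or> (AE x in N. \<phi> x \<in> {s_lo, M})"
  proof cases
    case 1
    then have "AE x in N. \<phi> x \<in> {s_lo, M}" using f_eq_fM root by (intro AE_I2) auto
    then show ?thesis by blast
  next
    case 2
    then have "AE x in N. \<phi> x \<in> {m, s_hi}" using f_eq_fm root by (intro AE_I2) auto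
    then show ?thesis by blast
  next
    case 3
    have "\<exists>a\<ge>s_lo. a \<le> m \<and> f a = l"
      by (rule IVT2') (use 3 f_s_lo s_lo_less in \<open>auto intro: continuous_on_f\<close>)
    then obtain a_lo where "s_lo \<le> a_lo" "a_lo \<le> m" "f a_lo = l" by blast
    then have a_lo: "s_lo < a_lo" "a_lo < m" "f a_lo = l"
      using 3 f_s_lo by (auto simp: order_le_less)
    have "\<exists>a\<ge>M. a \<le> s_hi \<and> f a = l"
      by (rule IVT2') (use 3 f_s_hi s_hi_greater in \<open>auto intro: continuous_on_f\<close>)
    then obtain a_hi where "M \<le> a_hi" "a_hi \<le> s_hi" "f a_hi = l" by blast
    then have a_hi: "M < a_hi" "a_hi < s_hi" "f a_hi = l"
      using 3 f_s_hi by (auto simp: order_le_less)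
    \<comment> \<open>Each outer branch carries exactly one root of \<open>f = l\<close>, so any
      other limit lies in the open middle interval.\<close>
    have roots: "\<phi> x \<in> {a_lo, a_hi} \<or> m < \<phi> x \<and> \<phi> x < M" if "x \<in> space N" for x
    proof (cases "m < \<phi> x \<and> \<phi> x < M")
      case False
      then consider "\<phi> x \<le> m" | "\<phi> x \<ge> M" by linarith
      then show ?thesis
      proof cases
        case 1
        then have "\<phi> x = a_lo"
          using dec_lo[of "\<phi> x" a_lo] dec_lo[of a_lo "\<phi> x"] root[OF that] a_lo
          by (cases "\<phi> x" a_lo rule: linorder_cases) auto
        then show ?thesis by simp
      next
        case 2
        then have "\<phi> x = a_hi"
          using dec_hi[of "\<phi> x" a_hi] dec_hi[of a_hi "\<phi> x"] root[OF that] a_hi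
          by (cases "\<phi> x" a_hi rule: linorder_cases) auto
        then show ?thesis by simp
      qed
    qed simp
    have eventually_mid: "eventually (\<lambda>t. m \<le> W t x \<and> W t x \<le> M) at_top" if "x \<in> space N" "m < \<phi> x" "\<phi> x < M" for x
      using order_tendstoD(1)[OF \<phi>[OF that(1)] that(2)] order_tendstoD(2)[OF \<phi>[OF that(1)] that(3)]
      by eventually_elim simp
    have same: "W 0 x = W 0 z" if x: "x \<in> space N" "m < \<phi> x" "\<phi> x < M" and z: "z \<in> space N" "m < \<phi> z" "\<phi> z < M" for x z
    proof -
      from eventually_conj[OF eventually_mid[OF x] eventually_mid[OF z]]
      have "eventually (\<lambda>t. 0 \<le> t \<and> (m \<le> W t x \<and> W t x \<le> M) \<and> m \<le> W t z \<and> W t z \<le> M) at_top"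
        using eventually_ge_at_top[of 0] by eventually_elim simp
      then obtain T where T: "\<And>t. t \<ge> T \<Longrightarrow> 0 \<le> t \<and> (m \<le> W t x \<and> W t x \<le> M) \<and> m \<le> W t z \<and> W t z \<le> M"
        by (auto simp: eventually_at_top_linorder)
      show ?thesis
        by (rule trajectory_middle_unique[OF W_trajectory[OF x(1)] W_trajectory[OF z(1)], of T]) (use T in auto)
    qed
    \<comment> \<open>Points with a limit in the middle interval are eventually trapped there, hence
      all start from one value, and such a level set is null.\<close>
    have "AE x in N. \<phi> x \<in> {a_lo, a_hi}"
    proof (cases "\<exists>z\<in>space N. m < \<phi> z \<and> \<phi> z < M")
      case True
      then obtain z where z: "z \<in> space N" "m < \<phi> z" "\<phi> z < M" by blast
      show ?thesis using nonatomic[of "W 0 z"] AE_space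
        by eventually_elim (use same[OF _ _ _ z] roots in blast)
    next
      case False
      then show ?thesis using roots by (intro AE_I2) blast
    qed
    with a_lo a_hi show ?thesis
      by (intro disjI1 exI[of _ a_lo] exI[of _ a_hi]) simp
  qed
  with int L1 show thesis by (rule that)
qed

end

section \<open>Pointwise representatives of solutions in the \<open>L\<^sup>\<infinity>\<close> sense\<close>

lemma Linf_norm_less_AE:
  assumes "Linf_norm \<Omega> g < ereal e"
  shows "AE x in lebesgue_on \<Omega>. \<bar>g x\<bar> < e"
  using esssup_AE[of "\<lambda>x. ereal \<bar>g x\<bar>" "lebesgue_on \<Omega>"]
proof eventually_elim
  case (elim x)
  then have "ereal \<bar>g x\<bar> < ereal e" using assms unfolding Linf_norm_def by (rule le_less_trans)
  then show ?case by simp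
qed

lemma Linf_bounded_AE:
  assumes "g \<in> Linf \<Omega>"
  shows "\<exists>C. AE x in lebesgue_on \<Omega>. \<bar>g x\<bar> \<le> C"
proof -
  obtain C where "Linf_norm \<Omega> g < ereal C"
    using assms less_PInf_Ex_of_nat[of "Linf_norm \<Omega> g"] unfolding Linf_def by auto
  from Linf_norm_less_AE[OF this] have "AE x in lebesgue_on \<Omega>. \<bar>g x\<bar> \<le> C"
    by eventually_elim simp
  then show ?thesis ..
qed

lemma Linf_limit_AE:
  fixes t :: real
  assumes "((\<lambda>r. Linf_norm \<Omega> (g r)) \<longlongrightarrow> 0) (at t within {0..})" "e > 0"
  shows "\<exists>d>0. \<forall>r\<ge>0. r \<noteq> t \<and> \<bar>r - t\<bar> < d \<longrightarrow> (AE x in lebesgue_on \<Omega>. \<bar>g r x\<bar> < e)"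
proof -
  have "eventually (\<lambda>r. Linf_norm \<Omega> (g r) < ereal e) (at t within {0..})"
    using assms by (intro order_tendstoD(2)) auto
  then obtain d where "d > 0" "\<forall>r\<in>{0..}. r \<noteq> t \<and> dist r t < d \<longrightarrow> Linf_norm \<Omega> (g r) < ereal e"
    unfolding eventually_at by blast
  then show ?thesis
    by (intro exI[of _ d]) (auto simp: dist_real_def intro: Linf_norm_less_AE)
qed

text \<open>Clearing the denominator includes the case \<open>r = t\<close> and makes the error
  proportional to \<open>\<bar>r - t\<bar>\<close>, so that errors can be added over adjacent
  intervals.\<close>

lemma C1_Linf_difference:
  assumes "C1_Linf \<Omega> u v" "t \<ge> 0" "e > 0"
  shows "\<exists>d>0. \<forall>r\<ge>0. \<bar>r - t\<bar> < d \<longrightarrow>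
    (AE x in lebesgue_on \<Omega>. \<bar>u r x - u t x - (r - t) * v t x\<bar> \<le> e * \<bar>r - t\<bar>)"
proof -
  have "((\<lambda>r. Linf_norm \<Omega> (\<lambda>x. (u r x - u t x) / (r - t) - v t x)) \<longlongrightarrow> 0) (at t within {0..})"
    using assms unfolding C1_Linf_def by blast
  from Linf_limit_AE[OF this \<open>e > 0\<close>] obtain d where d: "d > 0"
    "\<And>r. r \<ge> 0 \<Longrightarrow> r \<noteq> t \<Longrightarrow> \<bar>r - t\<bar> < d \<Longrightarrow>
      (AE x in lebesgue_on \<Omega>. \<bar>(u r x - u t x) / (r - t) - v t x\<bar> < e)" by blast
  have "AE x in lebesgue_on \<Omega>. \<bar>u r x - u t x - (r - t) * v t x\<bar> \<le> e * \<bar>r - t\<bar>"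
    if r: "r \<ge> 0" "\<bar>r - t\<bar> < d" for r
  proof (cases "r = t")
    case False
    show ?thesis using d(2)[OF r(1) False r(2)]
    proof eventually_elim
      case (elim x)
      have "u r x - u t x - (r - t) * v t x = ((u r x - u t x) / (r - t) - v t x) * (r - t)"
        using False by (simp add: field_simps)
      also have "\<bar>\<dots>\<bar> \<le> e * \<bar>r - t\<bar>" using elim by (simp add: abs_mult mult_right_mono)
      finally show ?case .
    qed
  qed simp
  with d(1) show ?thesis by blast
qed

text \<open>Norm continuity bounds \<open>v\<close> near each time, and the bisection principle
  \<open>Bolzano\<close> joins the local bounds into one on the compact interval.\<close>

lemma C1_Linf_derivative_bounded:
  assumes C1: "C1_Linf \<Omega> u v" and "T \<ge> 0"
  shows "\<exists>C. \<forall>t. 0 \<le> t \<longrightarrow> t \<le> T \<longrightarrow> (AE x in lebesgue_on \<Omega>. \<bar>v t x\<bar> \<le> C)"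
proof -
  \<comment> \<open>Small intervals around time 0 may reach into negative times, where nothing is
    known; hence the guard \<open>0 \<le> t\<close>.\<close>
  define P where "P a b \<longleftrightarrow> (\<exists>C. \<forall>t. 0 \<le> t \<longrightarrow> a \<le> t \<longrightarrow> t \<le> b \<longrightarrow> (AE x in lebesgue_on \<Omega>. \<bar>v t x\<bar> \<le> C))" for a b
  have "P 0 T"
    using \<open>T \<ge> 0\<close>
  proof (induction rule: Bolzano)
    case (trans a b c)
    obtain C1 where C1: "\<And>t. 0 \<le> t \<Longrightarrow> a \<le> t \<Longrightarrow> t \<le> b \<Longrightarrow> (AE x in lebesgue_on \<Omega>. \<bar>v t x\<bar> \<le> C1)"
      using trans(1) unfolding P_def by blast
    obtain C2 where C2: "\<And>t. 0 \<le> t \<Longrightarrow> b \<le> t \<Longrightarrow> t \<le> c \<Longrightarrow> (AE x in lebesgue_on \<Omega>. \<bar>v t x\<bar> \<le> C2)"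
      using trans(2) unfolding P_def by blast
    have "AE x in lebesgue_on \<Omega>. \<bar>v t x\<bar> \<le> max C1 C2" if t: "0 \<le> t" "a \<le> t" "t \<le> c" for t
    proof (cases "t \<le> b")
      case True
      from C1[OF t(1,2) this] show ?thesis by eventually_elim simp
    next
      case False
      with C2[OF t(1) _ t(3)] have "AE x in lebesgue_on \<Omega>. \<bar>v t x\<bar> \<le> C2" by simp
      then show ?thesis by eventually_elim simp
    qed
    then show ?case unfolding P_def by blast
  next
    case (local t)
    have vt: "v t \<in> Linf \<Omega>" "((\<lambda>r. Linf_norm \<Omega> (\<lambda>x. v r x - v t x)) \<longlongrightarrow> 0) (at t within {0..})"
      using C1 local unfolding C1_Linf_def by auto
    obtain C where C: "AE x in lebesgue_on \<Omega>. \<bar>v t x\<bar> \<le> C"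
      using Linf_bounded_AE[OF vt(1)] by blast
    obtain d where "d > 0"
      and d: "\<And>r. r \<ge> 0 \<Longrightarrow> r \<noteq> t \<Longrightarrow> \<bar>r - t\<bar> < d \<Longrightarrow> (AE x in lebesgue_on \<Omega>. \<bar>v r x - v t x\<bar> < 1)"
      using Linf_limit_AE[OF vt(2) zero_less_one] by blast
    have "AE x in lebesgue_on \<Omega>. \<bar>v r x\<bar> \<le> C + 1" if r: "r \<ge> 0" "\<bar>r - t\<bar> < d" for r
    proof (cases "r = t")
      case True
      then show ?thesis using C by (auto elim: eventually_mono)
    next
      case False
      from C d[OF r(1) False r(2)] show ?thesis by eventually_elim linarith
    qed
    then have "P a b" if "a \<le> t" "t \<le> b" "b - a < d" for a b
      using that unfolding P_def by (intro exI[of _ "C + 1"]) auto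
    then show ?case using \<open>d > 0\<close> by blast
  qed
  then show ?thesis by (simp add: P_def)
qed

text \<open>A mean value inequality in the norm. The estimate is additive over adjacent intervals,
  so by \<open>Bolzano\<close> it suffices to check it close to one time, where the difference
  quotient is controlled by \<open>v\<close>.\<close>

lemma C1_Linf_Lipschitz:
  assumes C1: "C1_Linf \<Omega> u v" and "T \<ge> 0"
  shows "\<exists>K\<ge>0. \<forall>a b. 0 \<le> a \<longrightarrow> a \<le> b \<longrightarrow> b \<le> T \<longrightarrow>
    (AE x in lebesgue_on \<Omega>. \<bar>u b x - u a x\<bar> \<le> K * (b - a))"
proof -
  obtain C where C: "\<And>t. 0 \<le> t \<Longrightarrow> t \<le> T \<Longrightarrow> (AE x in lebesgue_on \<Omega>. \<bar>v t x\<bar> \<le> C)"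
    using C1_Linf_derivative_bounded[OF assms] by blast
  \<comment> \<open>\<open>\<bar>C\<bar>\<close> accounts for the derivative and 1 for the error of
    the difference quotient.\<close>
  define K where "K = \<bar>C\<bar> + 1"
  define P where "P a b \<longleftrightarrow> (0 \<le> a \<longrightarrow> b \<le> T \<longrightarrow> (AE x in lebesgue_on \<Omega>. \<bar>u b x - u a x\<bar> \<le> K * (b - a)))" for a b
  have "P a b" if "0 \<le> a" "a \<le> b" "b \<le> T" for a b
    using \<open>a \<le> b\<close>
  proof (induction rule: Bolzano)
    case (trans a b c)
    show ?case unfolding P_def
    proof (intro impI)
      assume "0 \<le> a" "c \<le> T"
      then have "AE x in lebesgue_on \<Omega>. \<bar>u b x - u a x\<bar> \<le> K * (b - a)"
        "AE x in lebesgue_on \<Omega>. \<bar>u c x - u b x\<bar> \<le> K * (c - b)"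
        using trans by (auto simp: P_def)
      then show "AE x in lebesgue_on \<Omega>. \<bar>u c x - u a x\<bar> \<le> K * (c - a)"
        by eventually_elim (simp add: algebra_simps)
    qed
  next
    case (local t)
    then have t: "0 \<le> t" "t \<le> T" using that by auto
    obtain d where d: "d > 0" "\<And>r. r \<ge> 0 \<Longrightarrow> \<bar>r - t\<bar> < d \<Longrightarrow>
      (AE x in lebesgue_on \<Omega>. \<bar>u r x - u t x - (r - t) * v t x\<bar> \<le> 1 * \<bar>r - t\<bar>)"
      using C1_Linf_difference[OF C1 t(1) zero_less_one] by blast
    have near: "AE x in lebesgue_on \<Omega>. \<bar>u r x - u t x\<bar> \<le> K * \<bar>r - t\<bar>" if "r \<ge> 0" "\<bar>r - t\<bar> < d" for r
      using d(2)[OF that] C[OF t]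
    proof eventually_elim
      case (elim x)
      have "\<bar>r - t\<bar> * \<bar>v t x\<bar> \<le> \<bar>r - t\<bar> * \<bar>C\<bar>" using elim by (intro mult_left_mono) auto
      then have "\<bar>(r - t) * v t x\<bar> \<le> \<bar>C\<bar> * \<bar>r - t\<bar>" by (simp add: abs_mult mult.commute)
      then show ?case using elim unfolding K_def distrib_right by linarith
    qed
    have "P a b" if ab: "a \<le> t" "t \<le> b" "b - a < d" for a b
      unfolding P_def
    proof (intro impI)
      assume "0 \<le> a" "b \<le> T"
      then have "AE x in lebesgue_on \<Omega>. \<bar>u a x - u t x\<bar> \<le> K * \<bar>a - t\<bar>"
        "AE x in lebesgue_on \<Omega>. \<bar>u b x - u t x\<bar> \<le> K * \<bar>b - t\<bar>"
        using near[of a] near[of b] ab \<open>0 \<le> a\<close> by auto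
      then show "AE x in lebesgue_on \<Omega>. \<bar>u b x - u a x\<bar> \<le> K * (b - a)"
      proof eventually_elim
        case (elim x)
        have "K * \<bar>a - t\<bar> + K * \<bar>b - t\<bar> = K * (b - a)" using ab by (simp add: algebra_simps)
        then show ?case using elim by linarith
      qed
    qed
    then show ?case using d(1) by blast
  qed
  then show ?thesis by (intro exI[of _ K]) (auto simp: P_def K_def)
qed

text \<open>Explicit approximants that stay nonnegative when \<open>t\<close> is. The sequence
  depends on \<open>t\<close> alone, so limits of \<open>u\<close> along it remain measurable in
  \<open>x\<close>.\<close>

definition rational_below :: "nat \<Rightarrow> real \<Rightarrow> real" where
  "rational_below k t = of_int \<lfloor>t * (real k + 1)\<rfloor> / (real k + 1)"

lemma rational_below:
  fixes k :: nat and t :: real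
  shows
  "rational_below k t \<in> \<rat>" "rational_below k t \<le> t" "t - rational_below k t \<le> 1 / (real k + 1)"
  "t \<ge> 0 \<Longrightarrow> rational_below k t \<ge> 0"
proof -
  show "rational_below k t \<in> \<rat>" by (auto simp: rational_below_def)
  show "rational_below k t \<le> t" by (simp add: rational_below_def divide_le_eq)
  have "t * (real k + 1) \<le> of_int \<lfloor>t * (real k + 1)\<rfloor> + 1" by linarith
  then have "t \<le> (of_int \<lfloor>t * (real k + 1)\<rfloor> + 1) / (real k + 1)" by (simp add: le_divide_eq)
  then show "t - rational_below k t \<le> 1 / (real k + 1)"
    by (simp add: rational_below_def add_divide_distrib)
  show "t \<ge> 0 \<Longrightarrow> rational_below k t \<ge> 0" by (auto simp: rational_below_def)
qed

lemma rational_below_tendsto: "(\<lambda>k. rational_below k t) \<longlonglongrightarrow> t"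
proof -
  have "(\<lambda>k. t - rational_below k t) \<longlonglongrightarrow> 0"
  proof (rule Lim_null_comparison)
    show "(\<lambda>k. 1 / (real k + 1)) \<longlonglongrightarrow> 0"
      using LIMSEQ_inverse_real_of_nat by (simp add: inverse_eq_divide add.commute)
    show "eventually (\<lambda>k. norm (t - rational_below k t) \<le> 1 / (real k + 1)) sequentially"
      using rational_below(2,3)[where t = t] by (auto intro: always_eventually)
  qed
  then show ?thesis using tendsto_diff[OF tendsto_const[of t]] by fastforce
qed

text \<open>Up to each horizon \<open>n\<close> the function is uniformly continuous on the
  nonnegative rationals, so its values along rational approximants are Cauchy. The constants may
  grow with the horizon.\<close>

lemma rational_Lipschitz_extension:
  fixes g :: "real \<Rightarrow> real" and K :: "nat \<Rightarrow> real"
  defines "h \<equiv> \<lambda>t. lim (\<lambda>k. g (rational_below k t))"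
  assumes K: "\<And>n. K n \<ge> 0"
    and lip: "\<And>n a b. a \<in> \<rat> \<Longrightarrow> b \<in> \<rat> \<Longrightarrow> 0 \<le> a \<Longrightarrow> a \<le> b \<Longrightarrow> b \<le> real n \<Longrightarrow> \<bar>g b - g a\<bar> \<le> K n * (b - a)"
  shows "t \<ge> 0 \<Longrightarrow> (\<lambda>k. g (rational_below k t)) \<longlonglongrightarrow> h t"
    and "\<And>n a b. 0 \<le> a \<Longrightarrow> a \<le> b \<Longrightarrow> b \<le> real n \<Longrightarrow> \<bar>h b - h a\<bar> \<le> K n * (b - a)"
    and "t \<in> \<rat> \<Longrightarrow> t \<ge> 0 \<Longrightarrow> h t = g t"
proof -
  have lip': "\<bar>g b - g a\<bar> \<le> K n * \<bar>b - a\<bar>"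
    if "a \<in> \<rat>" "b \<in> \<rat>" "0 \<le> a" "0 \<le> b" "a \<le> real n" "b \<le> real n" for a b n
    using lip[of a b n] lip[of b a n] that by (cases "a \<le> b") (auto simp: abs_minus_commute)
  have conv: "(\<lambda>k. g (rational_below k t)) \<longlonglongrightarrow> h t" if t: "t \<ge> 0" for t
  proof -
    obtain n where n: "t \<le> real n" using real_arch_simple by blast
    have "Cauchy (\<lambda>k. g (rational_below k t))"
    proof (rule CauchyI)
      fix e :: real assume "e > 0"
      \<comment> \<open>Dividing by \<open>K n + 1\<close> keeps the quotient meaningful when
        \<open>K n\<close> is 0.\<close>
      then have e': "e / (K n + 1) > 0" using K[of n] by (intro divide_pos_pos) auto
      from CauchyD[OF LIMSEQ_imp_Cauchy[OF rational_below_tendsto[of t]] this]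
      obtain k0 where k0: "\<And>i j. i \<ge> k0 \<Longrightarrow> j \<ge> k0 \<Longrightarrow> \<bar>rational_below i t - rational_below j t\<bar> < e / (K n + 1)"
        by auto
      have "norm (g (rational_below i t) - g (rational_below j t)) < e" if "i \<ge> k0" "j \<ge> k0" for i j
      proof -
        have le_n: "rational_below i t \<le> real n" for i using rational_below(2)[of i t] n by simp
        have "\<bar>g (rational_below i t) - g (rational_below j t)\<bar> \<le> K n * \<bar>rational_below i t - rational_below j t\<bar>"
          using le_n rational_below(1,4) t by (intro lip') auto
        also have "\<dots> \<le> (K n + 1) * \<bar>rational_below i t - rational_below j t\<bar>"
          by (intro mult_right_mono) auto
        also have "\<dots> < (K n + 1) * (e / (K n + 1))"
          using k0[OF that] K[of n] by (intro mult_strict_left_mono) auto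
        also have "\<dots> = e" using K[of n] by simp
        finally show ?thesis by simp
      qed
      then show "\<exists>k0. \<forall>i\<ge>k0. \<forall>j\<ge>k0. norm (g (rational_below i t) - g (rational_below j t)) < e" by blast
    qed
    then show ?thesis unfolding h_def by (simp add: Cauchy_convergent_iff convergent_LIMSEQ_iff)
  qed
  then show "t \<ge> 0 \<Longrightarrow> (\<lambda>k. g (rational_below k t)) \<longlonglongrightarrow> h t" .
  show "\<bar>h b - h a\<bar> \<le> K n * (b - a)" if ab: "0 \<le> a" "a \<le> b" "b \<le> real n" for n a b
  proof (rule tendsto_le[OF sequentially_bot])
    show "(\<lambda>k. \<bar>g (rational_below k b) - g (rational_below k a)\<bar>) \<longlonglongrightarrow> \<bar>h b - h a\<bar>"
      using ab by (intro tendsto_intros conv) auto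
    have "(\<lambda>k. K n * \<bar>rational_below k b - rational_below k a\<bar>) \<longlonglongrightarrow> K n * \<bar>b - a\<bar>"
      by (intro tendsto_intros rational_below_tendsto)
    then show "(\<lambda>k. K n * \<bar>rational_below k b - rational_below k a\<bar>) \<longlonglongrightarrow> K n * (b - a)"
      using ab by simp
    show "eventually (\<lambda>k. \<bar>g (rational_below k b) - g (rational_below k a)\<bar>
        \<le> K n * \<bar>rational_below k b - rational_below k a\<bar>) sequentially"
    proof (intro always_eventually allI lip')
      fix k show "rational_below k a \<le> real n" "rational_below k b \<le> real n"
        using rational_below(2)[of k a] rational_below(2)[of k b] ab by auto
    qed (use ab rational_below(1,4) in auto)
  qed
  show "h t = g t" if t: "t \<in> \<rat>" "t \<ge> 0"
  proof -
    obtain n where n: "t \<le> real n" using real_arch_simple by blast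
    have "(\<lambda>k. g (rational_below k t) - g t) \<longlonglongrightarrow> 0"
    proof (rule Lim_null_comparison)
      have "(\<lambda>k. K n * \<bar>rational_below k t - t\<bar>) \<longlonglongrightarrow> K n * \<bar>t - t\<bar>"
        by (intro tendsto_intros rational_below_tendsto)
      then show "(\<lambda>k. K n * \<bar>rational_below k t - t\<bar>) \<longlonglongrightarrow> 0" by simp
      show "eventually (\<lambda>k. norm (g (rational_below k t) - g t) \<le> K n * \<bar>rational_below k t - t\<bar>) sequentially"
      proof (intro always_eventually allI)
        fix k show "norm (g (rational_below k t) - g t) \<le> K n * \<bar>rational_below k t - t\<bar>"
          using lip'[of t "rational_below k t" n] rational_below[where k = k and t = t] n t by auto
      qed
    qed
    then have "(\<lambda>k. g (rational_below k t)) \<longlonglongrightarrow> g t" by (simp add: LIM_zero_iff)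
    with conv[OF t(2)] show ?thesis using LIMSEQ_unique by blast
  qed
qed

text \<open>The approximants of \<open>s\<close> lie below it; \<open>a < s\<close> brings them into
  the interval from some index on.\<close>

lemma continuous_zero_on_rationals:
  fixes D :: "real \<Rightarrow> real"
  assumes cont: "continuous_on {a..b} D" and zero: "\<And>s. s \<in> \<rat> \<Longrightarrow> a \<le> s \<Longrightarrow> s \<le> b \<Longrightarrow> D s = 0"
    and "a < s" "s \<le> b"
  shows "D s = 0"
proof -
  have ev: "eventually (\<lambda>k. rational_below k s \<in> {a..b}) sequentially"
    using order_tendstoD(1)[OF rational_below_tendsto \<open>a < s\<close>]
    by eventually_elim (use rational_below(2)[of _ s] \<open>s \<le> b\<close> in \<open>auto intro: order_trans\<close>)
  have "(\<lambda>k. D (rational_below k s)) \<longlonglongrightarrow> D s"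
    by (rule continuous_on_tendsto_compose[OF cont rational_below_tendsto _ ev]) (use assms in auto)
  moreover have "eventually (\<lambda>k. D (rational_below k s) = 0) sequentially"
    using ev by eventually_elim (use zero rational_below(1) in auto)
  ultimately have "(\<lambda>k::nat. 0) \<longlonglongrightarrow> D s" by (rule Lim_transform_eventually)
  then show ?thesis by (simp add: tendsto_const_iff)
qed

section \<open>From a solution in the norm sense to a flow of scalar trajectories\<close>

locale Linf_solution = bistable f m M s_lo s_hi for f m M s_lo s_hi +
  fixes \<Omega> :: "'a::euclidean_space set" and u v :: "real \<Rightarrow> 'a \<Rightarrow> real"
  assumes \<Omega>_lmeasurable: "\<Omega> \<in> lmeasurable" and \<Omega>_pos: "measure lebesgue \<Omega> > 0"
    and C1: "C1_Linf \<Omega> u v"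
    and ode: "\<And>t. t > 0 \<Longrightarrow>
      AE x in lebesgue_on \<Omega>. v t x = f (u t x) - average \<Omega> (\<lambda>y. f (u t y))"
begin

abbreviation "N \<equiv> lebesgue_on \<Omega>"

sublocale finite_measure N
  by (rule finite_measure_lebesgue_on[OF \<Omega>_lmeasurable])

lemma measure_N: "measure N (space N) = measure lebesgue \<Omega>"
  using \<Omega>_lmeasurable by (simp add: measure_restrict_space)

lemma u_measurable: "t \<ge> 0 \<Longrightarrow> u t \<in> borel_measurable N"
  using C1 unfolding C1_Linf_def Linf_def by auto

text \<open>One constant for each integer horizon, all chosen at once, so that the Lipschitz
  conditions at rational times stay countably many.\<close>

definition K :: "nat \<Rightarrow> real" where
  "K = (SOME K. \<forall>n. K n \<ge> 0 \<and> (\<forall>a b. 0 \<le> a \<longrightarrow> a \<le> b \<longrightarrow> b \<le> real n \<longrightarrow>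
    (AE x in N. \<bar>u b x - u a x\<bar> \<le> K n * (b - a))))"

lemma K: "K n \<ge> 0"
  "0 \<le> a \<Longrightarrow> a \<le> b \<Longrightarrow> b \<le> real n \<Longrightarrow> (AE x in N. \<bar>u b x - u a x\<bar> \<le> K n * (b - a))"
proof -
  have "\<forall>n. \<exists>K\<ge>0. \<forall>a b. 0 \<le> a \<longrightarrow> a \<le> b \<longrightarrow> b \<le> real n \<longrightarrow>
      (AE x in N. \<bar>u b x - u a x\<bar> \<le> K * (b - a))"
    using C1_Linf_Lipschitz[OF C1] by simp
  from someI_ex[OF choice[OF this], folded K_def]
  show "K n \<ge> 0" "0 \<le> a \<Longrightarrow> a \<le> b \<Longrightarrow> b \<le> real n \<Longrightarrow> (AE x in N. \<bar>u b x - u a x\<bar> \<le> K n * (b - a))"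
    by blast+
qed

definition C0 :: real where "C0 = (SOME C. AE x in N. \<bar>u 0 x\<bar> \<le> C)"

lemma C0: "AE x in N. \<bar>u 0 x\<bar> \<le> C0"
proof -
  have "u 0 \<in> Linf \<Omega>" using C1 by (simp add: C1_Linf_def)
  from someI_ex[OF Linf_bounded_AE[OF this]] show ?thesis unfolding C0_def .
qed

text \<open>
  The null set on which \<open>u t x\<close> fails to be Lipschitz in \<open>t\<close> may depend on the times that are compared.
  Rational times need only one null set, so the representative is rebuilt from them.
\<close>

definition U :: "real \<Rightarrow> 'a \<Rightarrow> real" where
  "U t x = lim (\<lambda>k. u (rational_below k t) x)"

definition good :: "'a \<Rightarrow> bool" where
  "good x \<longleftrightarrow> \<bar>u 0 x\<bar> \<le> C0 \<and>
    (\<forall>n. \<forall>a\<in>\<rat>. \<forall>b\<in>\<rat>. 0 \<le> a \<longrightarrow> a \<le> b \<longrightarrow> b \<le> real n \<longrightarrow> \<bar>u b x - u a x\<bar> \<le> K n * (b - a))"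

lemma AE_good: "AE x in N. good x"
proof -
  have "AE x in N. \<forall>n. \<forall>a\<in>\<rat>. \<forall>b\<in>\<rat>. 0 \<le> a \<longrightarrow> a \<le> b \<longrightarrow> b \<le> real n \<longrightarrow> \<bar>u b x - u a x\<bar> \<le> K n * (b - a)"
    by (auto simp: AE_all_countable AE_ball_countable countable_rat intro!: AE_impI K(2))
  with C0 show ?thesis unfolding good_def by eventually_elim blast
qed

lemma
  assumes "good x"
  shows U_tendsto: "t \<ge> 0 \<Longrightarrow> (\<lambda>k. u (rational_below k t) x) \<longlonglongrightarrow> U t x"
    and U_Lipschitz: "0 \<le> a \<Longrightarrow> a \<le> b \<Longrightarrow> b \<le> real n \<Longrightarrow> \<bar>U b x - U a x\<bar> \<le> K n * (b - a)"
    and U_rational: "t \<in> \<rat> \<Longrightarrow> t \<ge> 0 \<Longrightarrow> U t x = u t x"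
proof -
  have "\<bar>u b x - u a x\<bar> \<le> K n * (b - a)"
    if "a \<in> \<rat>" "b \<in> \<rat>" "0 \<le> a" "a \<le> b" "b \<le> real n" for n a b
    using assms that unfolding good_def by blast
  note ext = rational_Lipschitz_extension[where g = "\<lambda>t. u t x" and K = K, OF K(1) this, folded U_def]
  show "t \<ge> 0 \<Longrightarrow> (\<lambda>k. u (rational_below k t) x) \<longlonglongrightarrow> U t x" by (rule ext(1))
  show "0 \<le> a \<Longrightarrow> a \<le> b \<Longrightarrow> b \<le> real n \<Longrightarrow> \<bar>U b x - U a x\<bar> \<le> K n * (b - a)" by (rule ext(2))
  show "t \<in> \<rat> \<Longrightarrow> t \<ge> 0 \<Longrightarrow> U t x = u t x" by (rule ext(3))
qed

lemma U_Lipschitz':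
  assumes "good x" "0 \<le> a" "a \<le> real n" "0 \<le> b" "b \<le> real n"
  shows "\<bar>U b x - U a x\<bar> \<le> K n * \<bar>b - a\<bar>"
  using U_Lipschitz[OF assms(1), of a b n] U_Lipschitz[OF assms(1), of b a n] assms
  by (cases "a \<le> b") (auto simp: abs_minus_commute)

lemma U_bounded:
  assumes "good x" "0 \<le> t" "t \<le> real n"
  shows "\<bar>U t x\<bar> \<le> C0 + K n * real n"
proof -
  have "\<bar>U t x - U 0 x\<bar> \<le> K n * (t - 0)" using assms by (intro U_Lipschitz) auto
  also have "\<dots> \<le> K n * real n" using K(1) assms by (intro mult_left_mono) auto
  finally have "\<bar>U t x - U 0 x\<bar> \<le> K n * real n" .
  moreover have "\<bar>U 0 x\<bar> \<le> C0" using U_rational[OF assms(1), of 0] assms(1) by (simp add: good_def)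
  ultimately show ?thesis by linarith
qed

text \<open>For a fixed \<open>t\<close>, real or rational, comparing \<open>u t\<close> with its
  values at the approximants costs only countably many null sets.\<close>

lemma AE_U_eq: assumes "t \<ge> 0" shows "AE x in N. U t x = u t x"
proof -
  obtain n where n: "t \<le> real n" using real_arch_simple by blast
  have "AE x in N. \<forall>k. \<bar>u t x - u (rational_below k t) x\<bar> \<le> K n * (t - rational_below k t)"
    unfolding AE_all_countable
    using assms n rational_below(2,4)[where t = t] by (auto intro!: K(2))
  with AE_good show ?thesis
  proof eventually_elim
    case (elim x)
    have "(\<lambda>k. u t x - u (rational_below k t) x) \<longlonglongrightarrow> 0"
    proof (rule Lim_null_comparison)
      have "(\<lambda>k. K n * (t - rational_below k t)) \<longlonglongrightarrow> K n * (t - t)"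
        by (intro tendsto_intros rational_below_tendsto)
      then show "(\<lambda>k. K n * (t - rational_below k t)) \<longlonglongrightarrow> 0" by simp
    qed (use elim in auto)
    from tendsto_diff[OF tendsto_const[of "u t x"] this]
    have "(\<lambda>k. u (rational_below k t) x) \<longlonglongrightarrow> u t x" by simp
    with U_tendsto[OF elim(1) assms] show ?case by (rule LIMSEQ_unique)
  qed
qed

lemma U_measurable: "t \<ge> 0 \<Longrightarrow> U t \<in> borel_measurable N"
  unfolding U_def[abs_def]
  by (intro borel_measurable_lim_metric u_measurable rational_below)

definition lam :: "real \<Rightarrow> real" where
  "lam t = (LINT x|N. f (U t x)) / measure N (space N)"

lemma average_eq_lam: assumes "t \<ge> 0" shows "average \<Omega> (\<lambda>y. f (u t y)) = lam t"
proof -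
  note [measurable] = U_measurable[OF assms] u_measurable[OF assms]
  have "(LINT x|N. f (u t x)) = (LINT x|N. f (U t x))"
    by (rule integral_cong_AE) (use AE_U_eq[OF assms] in auto)
  then show ?thesis unfolding average_def lam_def measure_N by simp
qed

lemma integrable_AE_bounded:
  fixes g :: "'a \<Rightarrow> real"
  assumes "g \<in> borel_measurable N" "\<And>x. good x \<Longrightarrow> \<bar>g x\<bar> \<le> B"
  shows "integrable N g"
proof (rule integrable_const_bound[where B = B])
  show "AE x in N. norm (g x) \<le> B" using AE_good by eventually_elim (use assms in auto)
qed (rule assms)

lemma integral_abs_le:
  fixes g :: "'a \<Rightarrow> real"
  assumes "g \<in> borel_measurable N" "AE x in N. \<bar>g x\<bar> \<le> B"
  shows "\<bar>LINT x|N. g x\<bar> \<le> B * measure N (space N)"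
proof -
  have int: "integrable N g"
    by (rule integrable_const_bound[where B = B]) (use assms in auto)
  have "\<bar>LINT x|N. g x\<bar> \<le> (LINT x|N. \<bar>g x\<bar>)" by (rule integral_abs_bound)
  also have "\<dots> \<le> (LINT x|N. B)"
    by (rule integral_mono_AE) (use int assms in auto)
  finally show ?thesis by (simp add: mult.commute)
qed

lemma integrable_U: "t \<ge> 0 \<Longrightarrow> integrable N (U t)"
  and integrable_fU: "t \<ge> 0 \<Longrightarrow> integrable N (\<lambda>x. f (U t x))"
proof -
  assume t: "t \<ge> 0"
  obtain n where n: "t \<le> real n" using real_arch_simple by blast
  note [measurable] = U_measurable[OF t]
  show "integrable N (U t)" by (rule integrable_AE_bounded[OF _ U_bounded[OF _ t n]]) simp
  obtain F where F: "\<And>r. \<bar>r\<bar> \<le> C0 + K n * real n \<Longrightarrow> \<bar>f r\<bar> \<le> F" using f_bounded by blast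
  show "integrable N (\<lambda>x. f (U t x))"
    by (rule integrable_AE_bounded[of _ F]) (use F U_bounded[OF _ t n] in auto)
qed

lemma lam_average: "t \<ge> 0 \<Longrightarrow> lam t * measure N (space N) = (LINT x|N. f (U t x))"
  using \<Omega>_pos unfolding lam_def measure_N by simp

section \<open>The scalar equation in integrated and in differential form\<close>

definition velocity :: "real \<Rightarrow> 'a \<Rightarrow> real" where
  "velocity t x = f (U t x) - lam t"

lemma velocity_Lipschitz:
  "\<exists>H\<ge>0. \<forall>x s t. good x \<longrightarrow> 0 \<le> s \<longrightarrow> s \<le> real n \<longrightarrow> 0 \<le> t \<longrightarrow> t \<le> real n \<longrightarrow>
    \<bar>velocity t x - velocity s x\<bar> \<le> H * \<bar>t - s\<bar>"
proof -
  obtain L where L: "L \<ge> 0" "\<And>r s. \<bar>r\<bar> \<le> C0 + K n * real n \<Longrightarrow> \<bar>s\<bar> \<le> C0 + K n * real n \<Longrightarrow>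
      \<bar>f r - f s\<bar> \<le> L * \<bar>r - s\<bar>"
    using lipschitz by meson
  have fU: "\<bar>f (U t x) - f (U s x)\<bar> \<le> L * K n * \<bar>t - s\<bar>"
    if "good x" "0 \<le> s" "s \<le> real n" "0 \<le> t" "t \<le> real n" for x s t
  proof -
    have "\<bar>f (U t x) - f (U s x)\<bar> \<le> L * \<bar>U t x - U s x\<bar>" using that U_bounded by (intro L) auto
    also have "\<dots> \<le> L * (K n * \<bar>t - s\<bar>)" using L U_Lipschitz'[OF that] by (intro mult_left_mono)
    finally show ?thesis by (simp add: mult.assoc)
  qed
  have lam: "\<bar>lam t - lam s\<bar> \<le> L * K n * \<bar>t - s\<bar>"
    if st: "0 \<le> s" "s \<le> real n" "0 \<le> t" "t \<le> real n" for s t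
  proof -
    note [measurable] = U_measurable[OF st(1)] U_measurable[OF st(3)]
    have "\<bar>lam t - lam s\<bar> * measure N (space N) = \<bar>(lam t - lam s) * measure N (space N)\<bar>"
      by (simp add: abs_mult)
    also have "(lam t - lam s) * measure N (space N) = (LINT x|N. f (U t x) - f (U s x))"
      using lam_average[OF st(1)] lam_average[OF st(3)]
        Bochner_Integration.integral_diff[OF integrable_fU[OF st(3)] integrable_fU[OF st(1)]]
      by (simp only: left_diff_distrib)
    also have "\<bar>\<dots>\<bar> \<le> L * K n * \<bar>t - s\<bar> * measure N (space N)"
    proof (rule integral_abs_le)
      show "AE x in N. \<bar>f (U t x) - f (U s x)\<bar> \<le> L * K n * \<bar>t - s\<bar>"
        using AE_good by eventually_elim (use fU st in auto)
    qed simp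
    finally show ?thesis using \<Omega>_pos unfolding measure_N by simp
  qed
  have "\<bar>velocity t x - velocity s x\<bar> \<le> (2 * (L * K n)) * \<bar>t - s\<bar>"
    if "good x" "0 \<le> s" "s \<le> real n" "0 \<le> t" "t \<le> real n" for x s t
    using fU[OF that] lam[OF that(2-)] unfolding velocity_def by (simp add: algebra_simps)
  moreover have "2 * (L * K n) \<ge> 0" using L K(1) by simp
  ultimately show ?thesis by blast
qed

lemma velocity_continuous:
  assumes "good x" "0 \<le> a"
  shows "continuous_on {a..b} (\<lambda>s. velocity s x)"
proof -
  obtain n where n: "b \<le> real n" using real_arch_simple by blast
  obtain H where H: "H \<ge> 0" "\<And>x s t. good x \<Longrightarrow> 0 \<le> s \<Longrightarrow> s \<le> real n \<Longrightarrow> 0 \<le> t \<Longrightarrow> t \<le> real n \<Longrightarrow>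
    \<bar>velocity t x - velocity s x\<bar> \<le> H * \<bar>t - s\<bar>"
    using velocity_Lipschitz[of n] by blast
  have "H-lipschitz_on {a..b} (\<lambda>s. velocity s x)"
    using H assms n by (intro lipschitz_onI) (auto simp: dist_real_def)
  then show ?thesis by (rule lipschitz_on_continuous_on)
qed

lemma AE_v_eq_velocity: "t > 0 \<Longrightarrow> AE x in N. v t x = velocity t x"
  using ode[of t] AE_U_eq[of t] average_eq_lam[of t]
  by (auto simp: velocity_def elim: eventually_elim2)

text \<open>Differentiability in the norm brings a separate null set for every time, so the
  integrated equation is first proved with an error \<open>e\<close> per unit length. In this form
  it is additive over adjacent intervals, and \<open>Bolzano\<close> reduces it to short intervals
  around one time.\<close>

lemma AE_integral_approx:
  assumes ab: "0 < a" "a \<le> b" and "e > 0"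
  shows "AE x in N. \<bar>U b x - U a x - integral {a..b} (\<lambda>s. velocity s x)\<bar> \<le> e * (b - a)"
proof -
  define P where "P a b \<longleftrightarrow> (0 < a \<longrightarrow>
    (AE x in N. \<bar>U b x - U a x - integral {a..b} (\<lambda>s. velocity s x)\<bar> \<le> e * (b - a)))" for a b
  have "P a b"
    using \<open>a \<le> b\<close>
  proof (induction rule: Bolzano)
    case (trans a b c)
    show ?case unfolding P_def
    proof
      assume "0 < a"
      then have "AE x in N. \<bar>U b x - U a x - integral {a..b} (\<lambda>s. velocity s x)\<bar> \<le> e * (b - a)"
        "AE x in N. \<bar>U c x - U b x - integral {b..c} (\<lambda>s. velocity s x)\<bar> \<le> e * (c - b)"
        using trans by (auto simp: P_def)
      with AE_good show "AE x in N. \<bar>U c x - U a x - integral {a..c} (\<lambda>s. velocity s x)\<bar> \<le> e * (c - a)"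
      proof eventually_elim
        case (elim x)
        have "integral {a..b} (\<lambda>s. velocity s x) + integral {b..c} (\<lambda>s. velocity s x)
            = integral {a..c} (\<lambda>s. velocity s x)"
          by (rule Henstock_Kurzweil_Integration.integral_combine)
            (use trans \<open>0 < a\<close> elim in \<open>auto intro!: integrable_continuous_real velocity_continuous\<close>)
        moreover have "e * (b - a) + e * (c - b) = e * (c - a)" by (simp add: algebra_simps)
        ultimately show ?case using elim by linarith
      qed
    qed
  next
    case (local t)
    then have t: "t > 0" using ab by simp
    obtain n where n: "t + 1 \<le> real n" using real_arch_simple by blast
    obtain H where H: "H \<ge> 0" "\<And>x s t. good x \<Longrightarrow> 0 \<le> s \<Longrightarrow> s \<le> real n \<Longrightarrow> 0 \<le> t \<Longrightarrow> t \<le> real n \<Longrightarrow>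
      \<bar>velocity t x - velocity s x\<bar> \<le> H * \<bar>t - s\<bar>"
      using velocity_Lipschitz[of n] by blast
    obtain d where d: "d > 0" "\<And>r. r \<ge> 0 \<Longrightarrow> \<bar>r - t\<bar> < d \<Longrightarrow>
      (AE x in N. \<bar>u r x - u t x - (r - t) * v t x\<bar> \<le> e / 2 * \<bar>r - t\<bar>)"
      using C1_Linf_difference[OF C1, of t "e/2"] t \<open>e > 0\<close> by auto
    have diff: "AE x in N. \<bar>U r x - U t x - (r - t) * velocity t x\<bar> \<le> e / 2 * \<bar>r - t\<bar>"
      if "r \<ge> 0" "\<bar>r - t\<bar> < d" for r
      using d(2)[OF that] AE_U_eq[OF that(1)] AE_U_eq[OF less_imp_le[OF t]] AE_v_eq_velocity[OF t]
      by eventually_elim simp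
    \<comment> \<open>The three entries control the difference quotient, keep the interval below the
      horizon \<open>n\<close>, and hold the variation of the velocity to at most
      \<open>e / 2\<close>.\<close>
    define d' where "d' = min (min d 1) (e / (2 * (H + 1)))"
    have "d' > 0" using d(1) \<open>e > 0\<close> H(1) by (simp add: d'_def)
    have "P a b" if ab: "a \<le> t" "t \<le> b" "b - a < d'" for a b
      unfolding P_def
    proof
      assume "0 < a"
      then have "a \<ge> 0" "\<bar>a - t\<bar> < d" "b \<ge> 0" "\<bar>b - t\<bar> < d" using ab by (auto simp: d'_def)
      from diff[OF this(1,2)] diff[OF this(3,4)]
      have "AE x in N. \<bar>U a x - U t x - (a - t) * velocity t x\<bar> \<le> e / 2 * \<bar>a - t\<bar>"
        "AE x in N. \<bar>U b x - U t x - (b - t) * velocity t x\<bar> \<le> e / 2 * \<bar>b - t\<bar>"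
        .
      with AE_good show "AE x in N. \<bar>U b x - U a x - integral {a..b} (\<lambda>s. velocity s x)\<bar> \<le> e * (b - a)"
      proof eventually_elim
        case (elim x)
        have cont: "continuous_on {a..b} (\<lambda>s. velocity s x)"
          using elim(1) \<open>0 < a\<close> by (intro velocity_continuous) auto
        have "norm (integral {a..b} (\<lambda>s. velocity s x - velocity t x)) \<le> e / 2 * (b - a)"
        proof (rule integral_bound)
          show "continuous_on {a..b} (\<lambda>s. velocity s x - velocity t x)"
            by (intro continuous_intros cont)
          fix s assume s: "s \<in> {a..b}"
          have "\<bar>velocity s x - velocity t x\<bar> \<le> H * \<bar>s - t\<bar>"
            using elim(1) s ab n \<open>0 < a\<close> by (intro H) (auto simp: d'_def)
          also have "\<dots> \<le> H * (e / (2 * (H + 1)))"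
            using s ab H(1) by (intro mult_left_mono) (auto simp: d'_def)
          also have "\<dots> \<le> e / 2" using H(1) \<open>e > 0\<close> by (simp add: field_simps)
          finally show "norm (velocity s x - velocity t x) \<le> e / 2" by simp
        qed (use ab in auto)
        moreover have "integral {a..b} (\<lambda>s. velocity s x - velocity t x)
            = integral {a..b} (\<lambda>s. velocity s x) - (b - a) * velocity t x"
          using ab integral_diff[OF integrable_continuous_real[OF cont] integrable_const_ivl[of "velocity t x" a b]]
          by simp
        moreover have "(b - t) * velocity t x - (a - t) * velocity t x = (b - a) * velocity t x"
          by (simp add: algebra_simps)
        \<comment> \<open>The difference quotients on the two sides of \<open>t\<close> and the
          variation of the velocity contribute half of the permitted error each.\<close>
        moreover have "e / 2 * \<bar>a - t\<bar> + e / 2 * \<bar>b - t\<bar> + e / 2 * (b - a) = e * (b - a)"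
          using ab by (simp add: field_simps)
        ultimately show ?case using elim(2,3) unfolding real_norm_def by linarith
      qed
    qed
    then show ?case using \<open>d' > 0\<close> by blast
  qed
  then show ?thesis using ab by (simp add: P_def)
qed

lemma AE_integral_eq:
  assumes ab: "0 < a" "a \<le> b"
  shows "AE x in N. U b x - U a x = integral {a..b} (\<lambda>s. velocity s x)"
proof -
  have "AE x in N. \<forall>k. \<bar>U b x - U a x - integral {a..b} (\<lambda>s. velocity s x)\<bar> \<le> 1 / real (Suc k) * (b - a)"
    unfolding AE_all_countable by (intro allI AE_integral_approx ab) simp
  then show ?thesis
  proof eventually_elim
    case (elim x)
    have "(\<lambda>k. 1 / real (Suc k) * (b - a)) \<longlonglongrightarrow> 0 * (b - a)"
      using LIMSEQ_inverse_real_of_nat by (intro tendsto_intros) (simp add: inverse_eq_divide)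
    then have "\<bar>U b x - U a x - integral {a..b} (\<lambda>s. velocity s x)\<bar> \<le> 0 * (b - a)"
      by (rule tendsto_lowerbound) (use elim in auto)
    then show ?case by simp
  qed
qed

text \<open>Rational endpoints keep the integrated equation to countably many identities; continuity
  recovers the other times afterwards.\<close>

definition regular :: "'a \<Rightarrow> bool" where
  "regular x \<longleftrightarrow> good x \<and> (\<forall>a\<in>\<rat>. \<forall>b\<in>\<rat>. 0 < a \<longrightarrow> a \<le> b \<longrightarrow>
    U b x - U a x = integral {a..b} (\<lambda>s. velocity s x))"

lemma AE_regular: "AE x in N. regular x"
proof -
  have "AE x in N. \<forall>a\<in>\<rat>. \<forall>b\<in>\<rat>. 0 < a \<longrightarrow> a \<le> b \<longrightarrow>
    U b x - U a x = integral {a..b} (\<lambda>s. velocity s x)"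
    by (auto simp: AE_ball_countable countable_rat intro!: AE_impI AE_integral_eq)
  with AE_good show ?thesis unfolding regular_def by eventually_elim blast
qed

lemma U_continuous: assumes "good x" shows "continuous_on {0..} (\<lambda>t. U t x)"
proof (rule continuous_on_atLeast)
  fix T
  obtain n where n: "T \<le> real n" using real_arch_simple by blast
  have "(K n)-lipschitz_on {0..T} (\<lambda>t. U t x)"
    using K(1) U_Lipschitz'[OF assms] n by (intro lipschitz_onI) (auto simp: dist_real_def)
  then show "continuous_on {0..T} (\<lambda>t. U t x)" by (rule lipschitz_on_continuous_on)
qed

lemma regular_trajectory:
  assumes "regular x"
  shows "trajectory f lam (\<lambda>t. U t x)"
  unfolding trajectory_def
proof (intro conjI allI impI)
  have good: "good x" using assms by (simp add: regular_def)
  show cont: "continuous_on {0..} (\<lambda>t. U t x)" by (rule U_continuous[OF good])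
  fix t :: real assume "t > 0"
  \<comment> \<open>A rational base point before \<open>t\<close> is needed since the integrated
    equation is available between positive rational times. The identity extends to real
    \<open>s\<close> by continuity and can then be differentiated.\<close>
  obtain a where a: "a \<in> \<rat>" "0 < a" "a < t" using Rats_dense_in_real[OF \<open>t > 0\<close>] by blast
  let ?I = "\<lambda>s. integral {a..s} (\<lambda>s. velocity s x)"
  have vel: "continuous_on {a..t+1} (\<lambda>s. velocity s x)"
    using good a by (intro velocity_continuous) auto
  have der: "(?I has_real_derivative velocity t x) (at t within {a..t+1})"
    by (rule integral_has_real_derivative[OF vel]) (use a in auto)
  have at_t: "at t within {a..t+1} = at t"
    by (rule at_within_interior) (use a in auto)
  have eq: "U s x = U a x + ?I s" if "a < s" "s \<le> t + 1" for s
  proof -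
    have "U s x - U a x - ?I s = 0"
    proof (rule continuous_zero_on_rationals[of a "t + 1" "\<lambda>s. U s x - U a x - ?I s"])
      show "continuous_on {a..t+1} (\<lambda>s. U s x - U a x - ?I s)"
        using a by (intro continuous_intros continuous_on_subset[OF cont]
            indefinite_integral_continuous_1 integrable_continuous_real vel) auto
      show "U s x - U a x - ?I s = 0" if "s \<in> \<rat>" "a \<le> s" for s
        using assms a that by (simp add: regular_def)
    qed (use that in auto)
    then show ?thesis by simp
  qed
  have "((\<lambda>s. U a x + ?I s) has_real_derivative velocity t x) (at t)"
    using DERIV_add[OF DERIV_const der] at_t by simp
  then have "((\<lambda>t. U t x) has_real_derivative velocity t x) (at t)"
    by (rule has_field_derivative_transform_within_open[where S = "{a<..<t+1}"]) (use a eq in auto)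
  then show "((\<lambda>t. U t x) has_real_derivative f (U t x) - lam t) (at t)"
    by (simp only: velocity_def)
qed

text \<open>By the choice of \<open>lam\<close> the velocity has integral 0, so the first-order term
  of the increment disappears, and the Lipschitz bound on the velocity leaves a remainder of second
  order.\<close>

lemma integral_U_quadratic:
  assumes ab: "0 \<le> a" "a < b" "b \<le> real n"
    and H: "\<And>x s t. good x \<Longrightarrow> 0 \<le> s \<Longrightarrow> s \<le> real n \<Longrightarrow> 0 \<le> t \<Longrightarrow> t \<le> real n \<Longrightarrow>
      \<bar>velocity t x - velocity s x\<bar> \<le> H * \<bar>t - s\<bar>" and "H \<ge> 0"
  shows "\<bar>(LINT x|N. U b x) - (LINT x|N. U a x)\<bar> \<le> H * (b - a)\<^sup>2 * measure N (space N)"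
proof -
  have b: "b \<ge> 0" using ab by simp
  note [measurable] = U_measurable[OF ab(1)] U_measurable[OF b]
  have "(LINT x|N. velocity a x) = 0"
    using lam_average[OF ab(1)] integrable_fU[OF ab(1)] by (simp add: velocity_def mult.commute)
  moreover have "integrable N (velocity a)"
    unfolding velocity_def[abs_def] using integrable_fU[OF ab(1)] by simp
  ultimately have "(LINT x|N. U b x) - (LINT x|N. U a x)
      = (LINT x|N. U b x - U a x - (b - a) * velocity a x)"
    using integrable_U[OF ab(1)] integrable_U[OF b] by simp
  also have "\<bar>\<dots>\<bar> \<le> H * (b - a)\<^sup>2 * measure N (space N)"
  proof (rule integral_abs_le)
    show "(\<lambda>x. U b x - U a x - (b - a) * velocity a x) \<in> borel_measurable N"
      unfolding velocity_def by measurable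
    show "AE x in N. \<bar>U b x - U a x - (b - a) * velocity a x\<bar> \<le> H * (b - a)\<^sup>2"
      using AE_regular
    proof eventually_elim
      case (elim x)
      then have good: "good x" by (simp add: regular_def)
      note traj = regular_trajectory[OF elim]
      obtain \<xi> where \<xi>: "a < \<xi>" "\<xi> < b" "U b x - U a x = (b - a) * velocity \<xi> x"
      proof (rule mvt[OF ab(2), of "\<lambda>t. U t x" "\<lambda>\<xi> h. h * velocity \<xi> x"])
        show "continuous_on {a..b} (\<lambda>t. U t x)"
          using trajectoryD(1)[OF traj ab(1)] by (rule continuous_on_subset) auto
        show "((\<lambda>t. U t x) has_derivative (\<lambda>h. h * velocity \<xi> x)) (at \<xi>)" if "a < \<xi>" for \<xi>
          using trajectoryD(2)[OF traj, of \<xi>] that ab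
          by (simp add: has_field_derivative_def velocity_def mult.commute[of _ "f _ - _"])
      qed
      have "\<bar>U b x - U a x - (b - a) * velocity a x\<bar> = (b - a) * \<bar>velocity \<xi> x - velocity a x\<bar>"
        using ab \<xi>(3) by (simp add: abs_mult flip: right_diff_distrib)
      also have "\<dots> \<le> (b - a) * (H * (b - a))"
      proof (intro mult_left_mono)
        have "\<bar>velocity \<xi> x - velocity a x\<bar> \<le> H * \<bar>\<xi> - a\<bar>" using \<xi> ab good by (intro H) auto
        also have "\<dots> \<le> H * (b - a)" using \<xi> \<open>H \<ge> 0\<close> by (intro mult_left_mono) auto
        finally show "\<bar>velocity \<xi> x - velocity a x\<bar> \<le> H * (b - a)" .
      qed (use ab in auto)
      finally show ?case by (simp add: power2_eq_square mult.left_commute)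
    qed
  qed
  finally show ?thesis .
qed

text \<open>Increments that are quadratic in the time step force a zero derivative. Differentiation
  under the integral sign is thereby avoided.\<close>

lemma mass_conserved: assumes "t \<ge> 0" shows "(LINT x|N. U t x) = (LINT x|N. U 0 x)"
proof -
  obtain n where n: "t \<le> real n" using real_arch_simple by blast
  obtain H where H: "H \<ge> 0" "\<And>x s t. good x \<Longrightarrow> 0 \<le> s \<Longrightarrow> s \<le> real n \<Longrightarrow> 0 \<le> t \<Longrightarrow> t \<le> real n \<Longrightarrow>
    \<bar>velocity t x - velocity s x\<bar> \<le> H * \<bar>t - s\<bar>"
    using velocity_Lipschitz[of n] by blast
  define J where "J t = (LINT x|N. U t x)" for t
  define C where "C = H * measure N (space N)"
  have less: "\<bar>J b - J a\<bar> \<le> C * (b - a)\<^sup>2" if "0 \<le> a" "a < b" "b \<le> t" for a b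
    using integral_U_quadratic[of a b n H] that n H by (simp add: J_def C_def mult_ac)
  have quad: "\<bar>J b - J a\<bar> \<le> C * (b - a)\<^sup>2" if "a \<in> {0..t}" "b \<in> {0..t}" for a b
    using less[of a b] less[of b a] that
    by (cases a b rule: linorder_cases) (auto simp: abs_minus_commute power2_commute)
  have "\<exists>c. \<forall>s\<in>{0..t}. J s = c"
  proof (rule has_field_derivative_zero_constant)
    fix a assume a: "a \<in> {0..t}"
    have "((\<lambda>b. (J b - J a) / (b - a)) \<longlongrightarrow> 0) (at a within {0..t})"
    proof (rule Lim_null_comparison)
      have "((\<lambda>b. C * \<bar>b - a\<bar>) \<longlongrightarrow> C * \<bar>a - a\<bar>) (at a within {0..t})"
        by (intro tendsto_intros)
      then show "((\<lambda>b. C * \<bar>b - a\<bar>) \<longlongrightarrow> 0) (at a within {0..t})" by simp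
      show "eventually (\<lambda>b. norm ((J b - J a) / (b - a)) \<le> C * \<bar>b - a\<bar>) (at a within {0..t})"
        unfolding eventually_at
      proof (intro exI[of _ 1] conjI ballI impI)
        fix b assume "b \<in> {0..t}" "b \<noteq> a \<and> dist b a < 1"
        then show "norm ((J b - J a) / (b - a)) \<le> C * \<bar>b - a\<bar>"
          using quad[OF a, of b] by (simp add: divide_le_eq power2_eq_square abs_mult_self_eq mult.assoc)
      qed simp
    qed
    then show "(J has_field_derivative 0) (at a within {0..t})"
      by (simp add: has_field_derivative_iff)
  qed simp
  then show ?thesis using assms by (auto simp: J_def)
qed

lemma regular_flow:
  obtains W where
    "\<And>t. t \<ge> 0 \<Longrightarrow> W t \<in> borel_measurable N"
    "\<And>t. t \<ge> 0 \<Longrightarrow> AE x in N. W t x = u t x"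
    "(\<forall>s. AE x in N. u 0 x \<noteq> s) \<Longrightarrow> nonlocal_flow f m M s_lo s_hi N W lam (average \<Omega> (u 0))"
proof -
  obtain Z where Z: "{x \<in> space N. \<not> regular x} \<subseteq> Z" "emeasure N Z = 0" "Z \<in> sets N"
    using AE_E[OF AE_regular] by blast
  define G where "G = space N - Z"
  have G: "G \<in> sets N" "\<And>x. x \<in> G \<Longrightarrow> regular x" using Z by (auto simp: G_def)
  have AE_G: "AE x in N. x \<in> G"
    by (rule AE_I[of _ _ Z]) (use Z in \<open>auto simp: G_def\<close>)
  have "G \<noteq> {}"
  proof
    assume "G = {}"
    then have "emeasure N (space N) = 0"
      using Z emeasure_mono[of "space N" Z N] by (auto simp: G_def)
    then have "measure N (space N) = 0" unfolding measure_def by simp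
    then show False using \<Omega>_pos unfolding measure_N by simp
  qed
  then obtain x0 where x0: "x0 \<in> G" by blast
  \<comment> \<open>Points of the exceptional set receive the trajectory of \<open>x0\<close>, so
    the equation holds everywhere, while the change concerns one null set that does not depend on
    time.\<close>
  define W where "W t x = (if x \<in> G then U t x else U t x0)" for t x
  have regular: "\<exists>z. regular z \<and> (\<forall>t. W t x = U t z)" for x
    using G(2) x0 by (cases "x \<in> G") (auto simp: W_def)
  have AE_W: "AE x in N. \<forall>t. W t x = U t x"
    using AE_G by eventually_elim (simp add: W_def)
  have meas: "W t \<in> borel_measurable N" if "t \<ge> 0" for t
    unfolding W_def[abs_def] using U_measurable[OF that] G(1)
    by (intro measurable_If_set) (auto simp: Int_absorb2 sets.sets_into_space)
  have AE_u: "AE x in N. W t x = u t x" if "t \<ge> 0" for t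
    using AE_W AE_U_eq[OF that] by eventually_elim simp
  have "nonlocal_flow f m M s_lo s_hi N W lam (average \<Omega> (u 0))"
    if nonatomic: "\<forall>s. AE x in N. u 0 x \<noteq> s"
  proof
    show "measure N (space N) > 0" using \<Omega>_pos by (simp only: measure_N)
    show "W t \<in> borel_measurable N" if "t \<ge> 0" for t by (rule meas[OF that])
    show "\<exists>C. \<forall>t\<in>{0..T}. \<forall>x\<in>space N. \<bar>W t x\<bar> \<le> C" for T
    proof -
      obtain n where n: "T \<le> real n" using real_arch_simple by blast
      have "\<bar>W t x\<bar> \<le> C0 + K n * real n" if "t \<in> {0..T}" for t x
      proof -
        obtain z where "regular z" "W t x = U t z" using regular by blast
        then show ?thesis using U_bounded[of z t n] that n by (simp add: regular_def)
      qed
      then show ?thesis by blast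
    qed
    show "trajectory f lam (\<lambda>t. W t x)" for x
    proof -
      obtain z where "regular z" "(\<lambda>t. W t x) = (\<lambda>t. U t z)" using regular by metis
      then show ?thesis using regular_trajectory by simp
    qed
    have cong: "(LINT x|N. g (W t x)) = (LINT x|N. g (U t x))" if "t \<ge> 0" "g \<in> borel_measurable borel" for g :: "real \<Rightarrow> real" and t
    proof -
      note [measurable] = meas[OF that(1)] U_measurable[OF that(1)] that(2)
      show ?thesis
        by (rule integral_cong_AE) (use AE_W in \<open>auto elim: eventually_mono\<close>)
    qed
    show "lam t * measure N (space N) = (LINT x|N. f (W t x))" if "t \<ge> 0" for t
      using lam_average[OF that] cong[OF that, of f] by simp
    show "(LINT x|N. W t x) = average \<Omega> (u 0) * measure N (space N)" if "t \<ge> 0" for t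
    proof -
      note [measurable] = U_measurable[of 0] u_measurable[of 0]
      have "(LINT x|N. U 0 x) = (LINT x|N. u 0 x)"
        by (rule integral_cong_AE) (use AE_U_eq[of 0] in auto)
      then show ?thesis
        using cong[OF that, of "\<lambda>r. r"] mass_conserved[OF that] \<Omega>_pos unfolding average_def measure_N by simp
    qed
    show "AE x in N. W 0 x \<noteq> s" for s
      using nonatomic[rule_format, of s] AE_u[of 0, simplified] by eventually_elim simp
  qed
  then show thesis using that[of W] meas AE_u by blast
qed

end

section \<open>The main theorem\<close>

text \<open>The derivative has a sign only on open intervals; continuity carries strict monotonicity
  to their endpoints. A bound of the derivative on a compact interval is a Lipschitz constant
  there.\<close>

lemma bistableI_deriv:
  fixes f :: "real \<Rightarrow> real"
  assumes C1: "f C1_differentiable_on UNIV" and "m < M"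
    and neg: "\<forall>s \<in> {..<m} \<union> {M<..}. deriv f s < 0" and pos: "\<forall>s \<in> {m<..<M}. deriv f s > 0"
    and "s_lo < m" "M < s_hi" "f s_lo = f M" "f s_hi = f m"
  shows "bistable f m M s_lo s_hi"
proof -
  obtain D where D: "\<And>x. (f has_vector_derivative D x) (at x)" "continuous_on UNIV D"
    using C1 unfolding C1_differentiable_on_def by auto
  have der: "(f has_real_derivative D x) (at x)" for x
    using D(1) by (simp add: has_real_derivative_iff_has_vector_derivative)
  then have deriv: "deriv f x = D x" for x by (rule DERIV_imp_deriv)
  have cont: "continuous_on S f" for S
    using der by (intro DERIV_continuous_on) (auto intro: has_field_derivative_at_within)
  show ?thesis
  proof
    fix R :: real
    have "compact (D ` {-R..R})"
      by (intro compact_continuous_image continuous_on_subset[OF D(2)]) auto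
    then obtain L where L: "\<forall>x\<in>{-R..R}. \<bar>D x\<bar> \<le> L"
      by (auto dest!: compact_imp_bounded simp: bounded_iff)
    have "\<bar>f r - f s\<bar> \<le> \<bar>L\<bar> * \<bar>r - s\<bar>" if "\<bar>r\<bar> \<le> R" "\<bar>s\<bar> \<le> R" for r s
    proof -
      have "norm (f r - f s) \<le> \<bar>L\<bar> * norm (r - s)"
        by (rule field_differentiable_bound[of "{-R..R}" f D])
          (use that L der in \<open>force intro: has_field_derivative_at_within\<close>)+
      then show ?thesis by simp
    qed
    then show "\<exists>L\<ge>0. \<forall>r s. \<bar>r\<bar> \<le> R \<longrightarrow> \<bar>s\<bar> \<le> R \<longrightarrow> \<bar>f r - f s\<bar> \<le> L * \<bar>r - s\<bar>"
      by (intro exI[of _ "\<bar>L\<bar>"]) auto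
  next
    show "f s < f r" if "r < s" "s \<le> m" for r s
      by (rule DERIV_neg_imp_decreasing_open[OF that(1) _ cont])
        (use der neg deriv that in \<open>auto intro!: exI\<close>)
    show "f r < f s" if "m \<le> r" "r < s" "s \<le> M" for r s
      by (rule DERIV_pos_imp_increasing_open[OF that(2) _ cont])
        (use der pos deriv that in \<open>auto intro!: exI\<close>)
    show "f s < f r" if "M \<le> r" "r < s" for r s
      by (rule DERIV_neg_imp_decreasing_open[OF that(2) _ cont])
        (use der neg deriv that in \<open>auto intro!: exI\<close>)
  qed (use assms in auto)
qed

theorem theorem1p6:
  fixes \<Omega> :: "(real ^ 'N) set"
    and f :: "real \<Rightarrow> real"
    and m M s_lo s_hi :: real
    and u\<^sub>0 :: "real ^ 'N \<Rightarrow> real"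
    and u :: "real \<Rightarrow> real ^ 'N \<Rightarrow> real"
  assumes "open \<Omega>" and "bounded \<Omega>" and "\<Omega> \<noteq> {}"
    and "f C1_differentiable_on UNIV"
    and "m < M"
    and "deriv f m = 0" and "deriv f M = 0"
    and "\<forall>s \<in> {..<m} \<union> {M<..}. deriv f s < 0"
    and "\<forall>s \<in> {m<..<M}. deriv f s > 0"
    and "s_lo < m" and "M < s_hi"
    and "f s_lo = f M" and "f s_hi = f m"
    and "u\<^sub>0 \<in> Linf \<Omega>"
    and "solution_P f \<Omega> u\<^sub>0 u"
    and "s_lo \<le> average \<Omega> u\<^sub>0" and "average \<Omega> u\<^sub>0 \<le> s_hi"
    and "\<forall>s. emeasure lebesgue {x \<in> \<Omega>. u\<^sub>0 x = s} = 0"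
  shows "\<exists>\<phi> \<in> omega_limit \<Omega> u.
    (\<forall>\<psi> \<in> omega_limit \<Omega> u. AE x in lebesgue_on \<Omega>. \<psi> x = \<phi> x) \<and>
    (\<exists>p q. AE x in lebesgue_on \<Omega>. \<phi> x \<in> {p, q}) \<and>
    ((\<exists>a_lo a_hi \<Omega>_lo \<Omega>_hi.
        s_lo < a_lo \<and> a_lo < m \<and> M < a_hi \<and> a_hi < s_hi \<and> f a_lo = f a_hi \<and>
        \<Omega>_lo \<in> sets lebesgue \<and> \<Omega>_hi \<in> sets lebesgue \<and>
        \<Omega>_lo \<inter> \<Omega>_hi = {} \<and> \<Omega>_lo \<union> \<Omega>_hi = \<Omega> \<and>
        (AE x in lebesgue_on \<Omega>.
          \<phi> x = a_lo * indicator \<Omega>_lo x + a_hi * indicator \<Omega>_hi x)) \<or>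
     (AE x in lebesgue_on \<Omega>. \<phi> x \<in> {m, s_hi}) \<or>
     (AE x in lebesgue_on \<Omega>. \<phi> x \<in> {s_lo, M}))"
proof -
  let ?N = "lebesgue_on \<Omega>"
  have lmeas: "\<Omega> \<in> lmeasurable" by (rule lmeasurable_open) (use assms in auto)
  have "measure lebesgue \<Omega> \<noteq> 0"
    using open_not_negligible[OF assms(1,3)] lmeas by (simp add: negligible_iff_measure)
  then have pos: "measure lebesgue \<Omega> > 0" by (simp add: zero_less_measure_iff)
  obtain v where v: "C1_Linf \<Omega> u v"
    "\<And>t. t > 0 \<Longrightarrow> AE x in ?N. v t x = f (u t x) - average \<Omega> (\<lambda>y. f (u t y))"
    and u0: "AE x in ?N. u 0 x = u\<^sub>0 x"
    using assms(15) unfolding solution_P_def by blast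
  interpret bistable f m M s_lo s_hi
    by (rule bistableI_deriv) (use assms in auto)
  interpret sol: Linf_solution f m M s_lo s_hi \<Omega> u v
    by unfold_locales (use lmeas pos v in auto)
  obtain W where W: "\<And>t. t \<ge> 0 \<Longrightarrow> W t \<in> borel_measurable ?N"
    "\<And>t. t \<ge> 0 \<Longrightarrow> AE x in ?N. W t x = u t x"
    "(\<forall>s. AE x in ?N. u 0 x \<noteq> s) \<Longrightarrow> nonlocal_flow f m M s_lo s_hi ?N W sol.lam (average \<Omega> (u 0))"
    using sol.regular_flow by blast
  have u0_meas: "u\<^sub>0 \<in> borel_measurable ?N" using assms(14) by (simp add: Linf_def)
  \<comment> \<open>The absence of atoms is assumed for the given representative of the initial
    datum and passes to \<open>u 0\<close>, which agrees with it almost everywhere.\<close>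
  have "AE x in ?N. u 0 x \<noteq> s" for s
  proof -
    have "{x \<in> space ?N. u\<^sub>0 x = s} \<in> sets ?N" using u0_meas by measurable
    moreover have "emeasure ?N {x \<in> space ?N. u\<^sub>0 x = s} = 0"
      using assms(18) lmeas by (subst emeasure_restrict_space) (auto simp: fmeasurableD)
    ultimately have "AE x in ?N. u\<^sub>0 x \<noteq> s" by (intro AE_I[of _ _ "{x \<in> space ?N. u\<^sub>0 x = s}"]) auto
    with u0 show ?thesis by eventually_elim simp
  qed
  then interpret flow: nonlocal_flow f m M s_lo s_hi ?N W sol.lam "average \<Omega> (u 0)"
    by (intro W(3)) simp
  have "average \<Omega> (u 0) = average \<Omega> u\<^sub>0"
    unfolding average_def using u0 u0_meas sol.u_measurable[of 0]
    by (simp cong: integral_cong_AE)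
  then have "s_lo \<le> average \<Omega> (u 0)" "average \<Omega> (u 0) \<le> s_hi" using assms(16,17) by simp_all
  from flow.flow_limit[OF this]
  obtain \<phi> where int: "integrable ?N \<phi>" and lim: "((\<lambda>t. LINT x|?N. \<bar>W t x - \<phi> x\<bar>) \<longlongrightarrow> 0) at_top"
    and cases: "(\<exists>a_lo a_hi. s_lo < a_lo \<and> a_lo < m \<and> M < a_hi \<and> a_hi < s_hi \<and> f a_lo = f a_hi \<and>
        (AE x in ?N. \<phi> x \<in> {a_lo, a_hi})) \<or>
     (AE x in ?N. \<phi> x \<in> {m, s_hi}) \<or> (AE x in ?N. \<phi> x \<in> {s_lo, M})" .
  have [measurable]: "\<phi> \<in> borel_measurable ?N" using int by auto
  \<comment> \<open>For each single time \<open>W\<close> and \<open>u\<close> agree off a null set,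
    which may vary with \<open>t\<close>; under the integral this is enough.\<close>
  have uW: "(LINT x|?N. \<bar>u t x - \<psi> x\<bar>) = (LINT x|?N. \<bar>W t x - \<psi> x\<bar>)"
    if "t \<ge> 0" "integrable ?N \<psi>" for t \<psi>
  proof (rule integral_cong_AE)
    show "AE x in ?N. \<bar>u t x - \<psi> x\<bar> = \<bar>W t x - \<psi> x\<bar>"
      using W(2)[OF that(1)] by eventually_elim simp
  qed (use W(1)[OF that(1)] sol.u_measurable[OF that(1)] that(2) in auto)
  have in_omega: "\<phi> \<in> omega_limit \<Omega> u"
    unfolding omega_limit_def
  proof (intro CollectI conjI int exI[of _ real])
    have "(\<lambda>n. LINT x|?N. \<bar>W (real n) x - \<phi> x\<bar>) \<longlonglongrightarrow> 0"
      by (rule filterlim_compose[OF lim filterlim_real_sequentially])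
    then show "(\<lambda>n. LINT x|?N. \<bar>u (real n) x - \<phi> x\<bar>) \<longlonglongrightarrow> 0"
      using int by (simp add: uW)
  qed (auto simp: filterlim_real_sequentially)
  have unique: "AE x in ?N. \<psi> x = \<phi> x" if "\<psi> \<in> omega_limit \<Omega> u" for \<psi>
  proof -
    obtain t :: "nat \<Rightarrow> real" where \<psi>: "integrable ?N \<psi>" and t: "\<And>n. t n \<ge> 0" "filterlim t at_top sequentially"
      "(\<lambda>n. LINT x|?N. \<bar>u (t n) x - \<psi> x\<bar>) \<longlonglongrightarrow> 0"
      using \<open>\<psi> \<in> omega_limit \<Omega> u\<close> unfolding omega_limit_def by blast
    \<comment> \<open>The whole flow converges to \<open>\<phi>\<close>, so the triangle inequality
      through \<open>W (t n)\<close> bounds the fixed distance of \<open>\<psi>\<close> and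
      \<open>\<phi>\<close> by a null sequence.\<close>
    have "(\<lambda>n. (LINT x|?N. \<bar>W (t n) x - \<psi> x\<bar>) + (LINT x|?N. \<bar>W (t n) x - \<phi> x\<bar>)) \<longlonglongrightarrow> 0 + 0"
      using t(3) uW[OF t(1) \<psi>] by (intro tendsto_add filterlim_compose[OF lim t(2)]) simp
    moreover have "(LINT x|?N. \<bar>\<psi> x - \<phi> x\<bar>) \<le> (LINT x|?N. \<bar>W (t n) x - \<psi> x\<bar>) + (LINT x|?N. \<bar>W (t n) x - \<phi> x\<bar>)" for n
    proof -
      have "(LINT x|?N. \<bar>\<psi> x - \<phi> x\<bar>) \<le> (LINT x|?N. \<bar>W (t n) x - \<psi> x\<bar> + \<bar>W (t n) x - \<phi> x\<bar>)"
        using \<psi> int flow.integrable_W[OF t(1)] by (intro integral_mono) auto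
      also have "\<dots> = (LINT x|?N. \<bar>W (t n) x - \<psi> x\<bar>) + (LINT x|?N. \<bar>W (t n) x - \<phi> x\<bar>)"
        using \<psi> int flow.integrable_W[OF t(1)] by (intro Bochner_Integration.integral_add) auto
      finally show ?thesis .
    qed
    ultimately have "(LINT x|?N. \<bar>\<psi> x - \<phi> x\<bar>) \<le> 0 + 0"
      by (intro tendsto_lowerbound[of _ _ sequentially]) auto
    moreover have "(LINT x|?N. \<bar>\<psi> x - \<phi> x\<bar>) \<ge> 0" by (intro integral_nonneg_AE) auto
    ultimately have "(LINT x|?N. \<bar>\<psi> x - \<phi> x\<bar>) = 0" by simp
    then have "AE x in ?N. \<bar>\<psi> x - \<phi> x\<bar> = 0"
      using \<psi> int by (subst (asm) integral_nonneg_eq_0_iff_AE) auto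
    then show ?thesis by eventually_elim simp
  qed
  have two_valued: "\<exists>p q. AE x in ?N. \<phi> x \<in> {p, q}" using cases by blast
  have split: "\<exists>\<Omega>_lo \<Omega>_hi. \<Omega>_lo \<in> sets lebesgue \<and> \<Omega>_hi \<in> sets lebesgue \<and>
        \<Omega>_lo \<inter> \<Omega>_hi = {} \<and> \<Omega>_lo \<union> \<Omega>_hi = \<Omega> \<and>
        (AE x in ?N. \<phi> x = a_lo * indicator \<Omega>_lo x + a_hi * indicator \<Omega>_hi x)"
    if ae: "AE x in ?N. \<phi> x \<in> {a_lo, a_hi}" for a_lo a_hi
  proof -
    \<comment> \<open>The second set is the full complement of this level set in
      \<open>\<Omega>\<close>. The partition is thus exact, and the almost everywhere exception is
      confined to the formula for \<open>\<phi>\<close>.\<close>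
    define A where "A = {x \<in> space ?N. \<phi> x = a_lo}"
    have "A \<in> sets ?N" unfolding A_def by measurable
    then have A: "A \<in> sets lebesgue" "A \<subseteq> \<Omega>"
      using lmeas sets_restrict_space_iff[of \<Omega> lebesgue] by (auto simp: A_def fmeasurableD)
    have "AE x in ?N. \<phi> x = a_lo * indicator A x + a_hi * indicator (\<Omega> - A) x"
      using ae AE_space by eventually_elim (auto simp: A_def indicator_def)
    then show ?thesis using A lmeas by (intro exI[of _ A] exI[of _ "\<Omega> - A"]) (auto simp: fmeasurableD)
  qed
  from cases have "(\<exists>a_lo a_hi \<Omega>_lo \<Omega>_hi.
        s_lo < a_lo \<and> a_lo < m \<and> M < a_hi \<and> a_hi < s_hi \<and> f a_lo = f a_hi \<and>
        \<Omega>_lo \<in> sets lebesgue \<and> \<Omega>_hi \<in> sets lebesgue \<and>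
        \<Omega>_lo \<inter> \<Omega>_hi = {} \<and> \<Omega>_lo \<union> \<Omega>_hi = \<Omega> \<and>
        (AE x in ?N. \<phi> x = a_lo * indicator \<Omega>_lo x + a_hi * indicator \<Omega>_hi x)) \<or>
     (AE x in ?N. \<phi> x \<in> {m, s_hi}) \<or> (AE x in ?N. \<phi> x \<in> {s_lo, M})"
  proof (elim disjE exE conjE)
    fix a_lo a_hi
    assume a: "s_lo < a_lo" "a_lo < m" "M < a_hi" "a_hi < s_hi" "f a_lo = f a_hi"
      and "AE x in ?N. \<phi> x \<in> {a_lo, a_hi}"
    from split[OF this(6)] obtain \<Omega>_lo \<Omega>_hi where "\<Omega>_lo \<in> sets lebesgue" "\<Omega>_hi \<in> sets lebesgue"
      "\<Omega>_lo \<inter> \<Omega>_hi = {}" "\<Omega>_lo \<union> \<Omega>_hi = \<Omega>"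
      "AE x in ?N. \<phi> x = a_lo * indicator \<Omega>_lo x + a_hi * indicator \<Omega>_hi x" by (elim exE conjE)
    with a show ?thesis
      by (intro disjI1 exI[of _ a_lo] exI[of _ a_hi] exI[of _ \<Omega>_lo] exI[of _ \<Omega>_hi] conjI)
  qed (rule disjI2, rule disjI1, assumption, rule disjI2, rule disjI2, assumption)
  with unique two_valued show ?thesis by (intro bexI[OF _ in_omega] conjI ballI)
qed

end
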